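(* Let $(\alpha_n)_{n\in\mathbb{N}}$ be the boundary expansion of a (non-cuspidal) direction $\theta$ and let $W^{(n)}_\theta=(v^{(n)}_r,v^{(n)}_l)$, $n\in\mathbb{N}$, be the wedges associated to $\theta$. For two sequences of numbers write $x_n\sim y_n$ if $|x_n-y_n|\to0$ as $n\to\infty$. Then $$\frac{1}{\mathrm{Area}(v^{(n)}_r,\theta)}\sim\frac{1}{\det(W_{\alpha_n})}\Big([\alpha_{n-1},\dots,\alpha_0]^-_{\alpha_n}+[\alpha_{n+1},\alpha_{n+2},\dots]^+_{\alpha_n}\Big),$$ $$\frac{1}{\mathrm{Area}(v^{(n)}_l,\theta)}\sim\frac{1}{\det(W_{\alpha_n})}\left(\frac{1}{[\alpha_{n-1},\dots,\alpha_0]^-_{\alpha_n}}+\frac{1}{[\alpha_{n+1},\alpha_{n+2},\dots]^+_{\alpha_n}}\right).$$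
   Context: Surfaces. A translation surface $S$ is a compact connected surface obtained from finitely many polygons in $\mathbb{R}^2\cong\mathbb{C}$ by identifying pairs of parallel sides by translations (with opposite outward normals); it is flat outside a finite non-empty set $\Sigma$ of singularities contained in the image of the vertices. A saddle connection is a flat geodesic segment joining points of $\Sigma$ without points of $\Sigma$ in its interior; its displacement vector $v\in\mathbb{R}^2$ (defined up to sign) is its holonomy. The Veech group $V(S)\subset SL(2,\mathbb{R})$ is the group of derivatives of affine automorphisms of $S$ (homeomorphisms preserving $\Sigma$, smooth with constant derivative off $\Sigma$); $S$ is a Veech surface if $V(S)$ is a lattice in $SL(2,\mathbb{R})$. $S$ is a fixed Veech surface. Coding. $A*z=\frac{az+b}{cz+d}$ denotes the Möbius action of $A=\begin{pmatrix}a&b\\c&d\end{pmatrix}$. $PSL(2,\mathbb{R})$ acts on the unit disk $\mathbb{D}$ and on $\partial\mathbb{D}$ by conjugating this action by $\mathscr{C}(z)=\frac{z-i}{z+i}$; the point $\mathscr{C}(x/y)\in\partial\mathbb{D}$ is identified with the line (direction) spanned by $(x,y)\in\mathbb{R}^2$, so the action on $\partial\mathbb{D}$ is the linear action on lines. $\Gamma$ is a torsion-free finite-index subgroup of the image of $V(S)$ in $PSL(2,\mathbb{R})$, and $D\subset\mathbb{D}$ is a fixed fundamental domain of $\Gamma$ which is an ideal polygon (all vertices on $\partial\mathbb{D}$) with $2d\ge4$ sides and contains the centre of $\mathbb{D}$. $\mathcal{A}=\mathcal{A}_0\sqcup\overline{\mathcal{A}_0}$ is an alphabet of $2d$ letters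 with involution $\alpha\mapsto\overline{\alpha}$, $\overline{\overline\alpha}=\alpha$. The sides of $D$ are labelled $e_\alpha$, $\alpha\in\mathcal{A}$, so that the side pairings $G_\alpha\in\Gamma$ satisfy $G_\alpha(e_{\overline\alpha})=e_\alpha$, $G_{\overline\alpha}=G_\alpha^{-1}$, and $G_\alpha(D)$ is adjacent to $D$ across $e_\alpha$; $G_\alpha$ also denotes a fixed representative in $SL(2,\mathbb{R})$ (vectors obtained from products of the $G_\alpha$ matter only up to sign). $\mathcal{A}[\alpha]\subset\partial\mathbb{D}$ is the closed arc with the same endpoints as $e_\alpha$ containing no other vertex of $D$, and $\mathcal{A}[\alpha_0,\dots,\alpha_n]=G_{\alpha_0}\cdots G_{\alpha_{n-1}}\mathcal{A}[\alpha_n]$. A word or sequence satisfies the no-backtracking condition if $\alpha_{n+1}\ne\overline{\alpha_n}$ for all $n$. A point (direction) is cuspidal if it is in the $\Gamma$-orbit of a vertex of $D$; a non-cuspidal $\xi$ has a unique boundary expansion, the no-backtracking sequence $(\alpha_n)_{n\in\mathbb{N}}$ with $\xi\in\mathcal{A}[\alpha_0,\dots,\alpha_n]$ for all $n$. The boundary expansion of a direction is that of the corresponding point. Wedges. $\xi^r_\alpha,\xi^l_\alpha$ are the endpoints of $e_\alpha$, named so that rotating a line counterclockwise in $\mathbb{R}^2$ through the directions in $\mathcal{A}[\alpha]$ goes from $\xi^r_\alpha$ to $\xi^l_\alpha$. $v^r_\alpha,v^l_\alpha$ are displacement vectors of the shortest saddle connections of $S$ in the directions $\xi^r_\alpha,\xi^l_\alpha$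 (these directions are parabolic, so saddle connections exist). $S$ is normalized within its $SL(2,\mathbb{R})$-orbit so that the horizontal direction is a vertex of $D$, and signs are chosen so that $v^r_\alpha,v^l_\alpha$ lie in the closed upper half-plane, form a positively oriented basis, and the vectors $\pm(av^r_\alpha+bv^l_\alpha)$, $a,b\ge0$, are those with direction in $\mathcal{A}[\alpha]$. The wedge $W_\alpha=(v^r_\alpha,v^l_\alpha)$ also denotes the matrix in $GL(2,\mathbb{R})$ with these columns ($\det W_\alpha>0$). For non-cuspidal $\theta$ with boundary expansion $(\alpha_n)$ put $W^{(0)}_\theta=W_{\alpha_0}$, $W^{(n)}_\theta=G_{\alpha_0}\cdots G_{\alpha_{n-1}}W_{\alpha_n}=(v^{(n)}_r,v^{(n)}_l)$ for $n\ge1$. Areas. A direction is given by $\theta\in[-\pi/2,\pi/2)$, its angle with the vertical measured counterclockwise; $\mathrm{Re}_\theta(v)=\mathrm{Re}(e^{-i\theta}v)$, $\mathrm{Im}_\theta(v)=\mathrm{Im}(e^{-i\theta}v)$ (coordinates after rotating direction $\theta$ to the vertical), $\mathrm{Area}(v,\theta)=|\mathrm{Re}_\theta(v)||\mathrm{Im}_\theta(v)|$. Continued fractions. With $R=\begin{pmatrix}0&1\\1&0\end{pmatrix}$ and matrices up to scalar multiples, $A^\alpha_\beta=W_\alpha^{-1}G_\alpha G_\beta G_\alpha^{-1}W_\alpha$ and $B^\alpha_\beta=RW_\alpha^TG_\beta^T(W_\alpha^T)^{-1}R$. If $\alpha\,\alpha_0\cdots\alpha_n$ satisfies the no-backtracking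 condition, $[\alpha_0,\dots,\alpha_n]^+_\alpha=A^\alpha_{\alpha_0}\cdots A^\alpha_{\alpha_{n-1}}(W_\alpha^{-1}G_\alpha W_{\alpha_n})*\infty$ and $[\alpha_0,\dots,\alpha_n]^-_\alpha=B^\alpha_{\alpha_0}\cdots B^\alpha_{\alpha_n}(RW_\alpha^T(W_{\alpha_n}^T)^{-1}R)*\infty$. For infinite no-backtracking sequences with $\alpha_0\ne\overline\alpha$, $[\alpha_0,\alpha_1,\dots]^\pm_\alpha=\lim_{n\to\infty}[\alpha_0,\dots,\alpha_n]^\pm_\alpha\in[0,+\infty]$ (the limits exist). *)

theory Defs
  imports "HOL-Analysis.Analysis" "HOL-Algebra.Coset"
begin

section \<open>Translation surfaces\<close>

type_synonym plane = "real^2"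

definition vtx :: "plane list \<Rightarrow> nat \<Rightarrow> plane" where
  "vtx ps j = ps ! (j mod length ps)"

definition side :: "plane list \<Rightarrow> nat \<Rightarrow> plane set" where
  "side ps j = closed_segment (vtx ps j) (vtx ps (Suc j))"

definition side_vec :: "plane list \<Rightarrow> nat \<Rightarrow> plane" where
  "side_vec ps j = vtx ps (Suc j) - vtx ps j"

definition boundary :: "plane list \<Rightarrow> plane set" where
  "boundary ps = (\<Union>j<length ps. side ps j)"

definition region :: "plane list \<Rightarrow> plane set" where
  "region ps = boundary ps \<union> inside (boundary ps)"

definition cross :: "plane \<Rightarrow> plane \<Rightarrow> real" where
  "cross u v = u$1 * v$2 - u$2 * v$1"

text \<open>The vertices of a simple polygon are listed counterclockwise: the last condition says that
  the (shoelace) signed area is positive.\<close>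

definition simple_polygon :: "plane list \<Rightarrow> bool" where
  "simple_polygon ps \<longleftrightarrow> length ps \<ge> 3 \<and> distinct ps \<and>
     (\<forall>j<length ps. \<forall>k<length ps. j \<noteq> k \<longrightarrow>
        side ps j \<inter> side ps k \<subseteq> {vtx ps j, vtx ps (Suc j)} \<inter> {vtx ps k, vtx ps (Suc k)}) \<and>
     (\<Sum>j<length ps. cross (vtx ps j) (vtx ps (Suc j))) > 0"

text \<open>A point of the disjoint union of the polygons is a pair \<open>(i, z)\<close>, with \<open>z\<close> in the \<open>i\<close>-th
  polygon; a side is a pair \<open>(i, j)\<close>, the \<open>j\<close>-th side of the \<open>i\<close>-th polygon. A point of the
  glued surface is an equivalence class of points of the disjoint union.\<close>

type_synonym surf_point = "(nat \<times> plane) set"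

record glued_polygons =
  polys :: "plane list list"
  glue :: "nat \<times> nat \<Rightarrow> nat \<times> nat"
  sing :: "surf_point set"

definition sides :: "glued_polygons \<Rightarrow> (nat \<times> nat) set" where
  "sides S = {(i, j). i < length (polys S) \<and> j < length (polys S ! i)}"

definition poly_points :: "glued_polygons \<Rightarrow> (nat \<times> plane) set" where
  "poly_points S = {(i, z). i < length (polys S) \<and> z \<in> region (polys S ! i)}"

text \<open>As boundaries are counterclockwise, two sides are parallel, of equal length and with opposite
  outward normals iff their side vectors are opposite.\<close>

definition side_pairing :: "glued_polygons \<Rightarrow> bool" where
  "side_pairing S \<longleftrightarrow> (\<forall>(i, j) \<in> sides S. glue S (i, j) \<in> sides S \<and> glue S (i, j) \<noteq> (i, j) \<and>
     glue S (glue S (i, j)) = (i, j) \<and>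
     (case glue S (i, j) of (i', j') \<Rightarrow>
        side_vec (polys S ! i') j' = - side_vec (polys S ! i) j))"

text \<open>The translation identifying side \<open>(i, j)\<close> with side \<open>(i', j')\<close> takes the initial point of the
  former to the terminal point of the latter.\<close>

definition glue_step :: "glued_polygons \<Rightarrow> ((nat \<times> plane) \<times> (nat \<times> plane)) set" where
  "glue_step S = {((i, z), (i', z')). \<exists>j j'. (i, j) \<in> sides S \<and> glue S (i, j) = (i', j') \<and>
     z \<in> side (polys S ! i) j \<and>
     z' = z - vtx (polys S ! i) j + vtx (polys S ! i') (Suc j')}"

definition pt :: "glued_polygons \<Rightarrow> nat \<times> plane \<Rightarrow> surf_point" where
  "pt S p = (glue_step S)\<^sup>* `` {p}"

definition surface_points :: "glued_polygons \<Rightarrow> surf_point set" where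
  "surface_points S = pt S ` poly_points S"

definition vertex_points :: "glued_polygons \<Rightarrow> surf_point set" where
  "vertex_points S = {pt S (i, vtx (polys S ! i) j) | i j. (i, j) \<in> sides S}"

text \<open>The quotient topology of the disjoint union of the polygons.\<close>

definition surf_open :: "glued_polygons \<Rightarrow> surf_point set \<Rightarrow> bool" where
  "surf_open S U \<longleftrightarrow> U \<subseteq> surface_points S \<and>
     (\<forall>i<length (polys S). openin (top_of_set (region (polys S ! i)))
        {z \<in> region (polys S ! i). pt S (i, z) \<in> U})"

definition surf_top :: "glued_polygons \<Rightarrow> surf_point topology" where
  "surf_top S = topology (surf_open S)"

lemma istopology_surf_open: "istopology (surf_open S)"
proof -
  have "surf_open S (A \<inter> B)" if A: "surf_open S A" and B: "surf_open S B" for A B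
  proof -
    have eq: "{z \<in> X. pt S (i, z) \<in> A \<inter> B} = {z \<in> X. pt S (i, z) \<in> A} \<inter> {z \<in> X. pt S (i, z) \<in> B}"
      for X i by auto
    show ?thesis
      using A B unfolding surf_open_def eq by (auto intro: openin_Int)
  qed
  moreover have "surf_open S (\<Union>K)" if K: "\<forall>A\<in>K. surf_open S A" for K
  proof -
    have eq: "{z \<in> X. pt S (i, z) \<in> \<Union>K} = \<Union> ((\<lambda>A. {z \<in> X. pt S (i, z) \<in> A}) ` K)" for X i
      by auto
    show ?thesis
      using K unfolding surf_open_def eq by (auto intro!: openin_Union)
  qed
  ultimately show ?thesis
    unfolding istopology_def by blast
qed

lemma openin_surf_top: "openin (surf_top S) = surf_open S"
  unfolding surf_top_def by (rule topology_inverse'[OF istopology_surf_open])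

lemma topspace_surf_top: "topspace (surf_top S) = surface_points S"
proof -
  have "{z \<in> region (polys S ! i). pt S (i, z) \<in> surface_points S} = region (polys S ! i)"
    if "i < length (polys S)" for i
    using that by (auto simp: surface_points_def poly_points_def)
  then have "surf_open S (surface_points S)"
    by (simp add: surf_open_def)
  then show ?thesis
    unfolding topspace_def openin_surf_top by (auto simp: surf_open_def)
qed

text \<open>A translation chart is a homeomorphism from an open set avoiding the singularities onto an
  open subset of the plane which, on every polygon, is locally a translation. Such a chart
  exists around a vertex point iff the total angle there is \<open>2\<pi>\<close>; around points that do not
  come from vertices it always exists.\<close>

definition translation_chart :: "glued_polygons \<Rightarrow> surf_point set \<Rightarrow> (surf_point \<Rightarrow> plane) \<Rightarrow> bool" where
  "translation_chart S U \<phi> \<longleftrightarrow>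
     openin (surf_top S) U \<and> U \<inter> sing S = {} \<and> open (\<phi> ` U) \<and>
     homeomorphic_map (subtopology (surf_top S) U) (top_of_set (\<phi> ` U)) \<phi> \<and>
     (\<forall>(i, z) \<in> poly_points S. pt S (i, z) \<in> U \<longrightarrow>
        (\<exists>\<epsilon>>0. \<forall>w \<in> region (polys S ! i). dist w z < \<epsilon> \<and> pt S (i, w) \<in> U \<longrightarrow>
           \<phi> (pt S (i, w)) = \<phi> (pt S (i, z)) + (w - z)))"

definition translation_surface :: "glued_polygons \<Rightarrow> bool" where
  "translation_surface S \<longleftrightarrow>
     (\<forall>ps \<in> set (polys S). simple_polygon ps) \<and> side_pairing S \<and>
     connected_space (surf_top S) \<and>
     finite (sing S) \<and> sing S \<noteq> {} \<and> sing S \<subseteq> vertex_points S \<and>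
     (\<forall>x \<in> surface_points S - sing S. \<exists>U \<phi>. translation_chart S U \<phi> \<and> x \<in> U)"

text \<open>Saddle connections are parametrised with constant velocity \<open>v\<close> on the unit interval, so
  \<open>v\<close> is the displacement vector and \<open>norm v\<close> is the length.\<close>

definition saddle_connection :: "glued_polygons \<Rightarrow> (real \<Rightarrow> surf_point) \<Rightarrow> plane \<Rightarrow> bool" where
  "saddle_connection S \<gamma> v \<longleftrightarrow>
     pathin (surf_top S) \<gamma> \<and> \<gamma> 0 \<in> sing S \<and> \<gamma> 1 \<in> sing S \<and> v \<noteq> 0 \<and>
     (\<forall>t\<in>{0<..<1}. \<gamma> t \<notin> sing S \<and>
        (\<forall>U \<phi>. translation_chart S U \<phi> \<and> \<gamma> t \<in> U \<longrightarrow>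
           ((\<lambda>s. \<phi> (\<gamma> s)) has_vector_derivative v) (at t)))"

definition holonomies :: "glued_polygons \<Rightarrow> plane set" where
  "holonomies S = {v. \<exists>\<gamma>. saddle_connection S \<gamma> v}"

text \<open>Smoothness off the singularities is implied by the constancy of the derivative.\<close>

definition affine_automorphism ::
    "glued_polygons \<Rightarrow> real^2^2 \<Rightarrow> (surf_point \<Rightarrow> surf_point) \<Rightarrow> bool" where
  "affine_automorphism S A f \<longleftrightarrow>
     homeomorphic_map (surf_top S) (surf_top S) f \<and> f ` sing S = sing S \<and>
     (\<forall>U \<phi> V \<psi>. \<forall>x\<in>U. translation_chart S U \<phi> \<and> translation_chart S V \<psi> \<and> f x \<in> V \<longrightarrow>
        ((\<lambda>z. \<psi> (f (inv_into U \<phi> z))) has_derivative (\<lambda>v. A *v v)) (at (\<phi> x)))"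

definition veech_group :: "glued_polygons \<Rightarrow> (real^2^2) set" where
  "veech_group S = {A. det A = 1 \<and> (\<exists>f. affine_automorphism S A f)}"

section \<open>\<open>SL(2,\<real>)\<close>, \<open>PSL(2,\<real>)\<close> and lattices\<close>

definition SL2 :: "(real^2^2) monoid" where
  "SL2 = \<lparr>carrier = {A. det A = 1}, mult = (**), one = mat 1\<rparr>"

definition PSL2 :: "(real^2^2) set monoid" where
  "PSL2 = SL2 Mod {mat 1, - mat 1}"

definition psl :: "real^2^2 \<Rightarrow> (real^2^2) set" where
  "psl A = {mat 1, - mat 1} #>\<^bsub>SL2\<^esub> A"

lemma psl_eq: "psl A = {A, - A}"
proof -
  have "- mat 1 ** A = - A"
    by (vector matrix_matrix_mult_def mat_def) (auto simp: sum_2 forall_2)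
  then show ?thesis
    by (auto simp: psl_def r_coset_def SL2_def)
qed

text \<open>A Haar measure of \<open>F \<subseteq> SL(2,\<real>)\<close> is the Lebesgue measure of the cone over \<open>F\<close> with apex \<open>0\<close>
  in the four-dimensional space of matrices. A discrete subgroup is a lattice iff the translates
  of some Borel set of finite Haar measure cover the whole group.\<close>

definition SL2_lattice :: "(real^2^2) set \<Rightarrow> bool" where
  "SL2_lattice L \<longleftrightarrow> subgroup L SL2 \<and> discrete L \<and>
     (\<exists>F \<in> sets borel. F \<subseteq> carrier SL2 \<and>
        (\<Union>A\<in>L. (\<lambda>B. A ** B) ` F) = carrier SL2 \<and>
        emeasure lborel {t *\<^sub>R B | t B. 0 < t \<and> t \<le> 1 \<and> B \<in> F} < \<infinity>)"

definition veech_surface :: "glued_polygons \<Rightarrow> bool" where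
  "veech_surface S \<longleftrightarrow> translation_surface S \<and> SL2_lattice (veech_group S)"

text \<open>The image of the Veech group in \<open>PSL(2,\<real>)\<close>.\<close>

definition projective_veech_group :: "glued_polygons \<Rightarrow> (real^2^2) set monoid" where
  "projective_veech_group S = PSL2\<lparr>carrier := psl ` veech_group S\<rparr>"

definition torsion_free_subgroup :: "'g set \<Rightarrow> ('g, 'm) monoid_scheme \<Rightarrow> bool" where
  "torsion_free_subgroup H G \<longleftrightarrow> subgroup H G \<and>
     (\<forall>g\<in>H. \<forall>n::nat. n > 0 \<and> g [^]\<^bsub>G\<^esub> n = \<one>\<^bsub>G\<^esub> \<longrightarrow> g = \<one>\<^bsub>G\<^esub>)"

definition finite_index_subgroup :: "'g set \<Rightarrow> ('g, 'm) monoid_scheme \<Rightarrow> bool" where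
  "finite_index_subgroup H G \<longleftrightarrow> subgroup H G \<and> finite (rcosets\<^bsub>G\<^esub> H)"

section \<open>Action on the closed disk\<close>

definition mobius :: "complex^2^2 \<Rightarrow> complex \<Rightarrow> complex" where
  "mobius M z = (M$1$1 * z + M$1$2) / (M$2$1 * z + M$2$2)"

definition cayley :: "complex^2^2" where
  "cayley = vector [vector [1, - \<i>], vector [1, \<i>]]"

definition complex_mat :: "real^2^2 \<Rightarrow> complex^2^2" where
  "complex_mat A = (\<chi> i j. complex_of_real (A$i$j))"

text \<open>The conjugated matrix lies in \<open>SU(1,1)\<close>, so for \<open>det A = 1\<close> the denominator does not vanish on
  the closed unit disk.\<close>

definition disk_act :: "real^2^2 \<Rightarrow> complex \<Rightarrow> complex" where
  "disk_act A = mobius (cayley ** complex_mat A ** matrix_inv cayley)"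

definition to_complex :: "plane \<Rightarrow> complex" where
  "to_complex v = Complex (v$1) (v$2)"

text \<open>The boundary point identified with the line spanned by \<open>v = (x, y) \<noteq> 0\<close>, that is the image
  \<open>(x/y - \<i>) / (x/y + \<i>) = (x - \<i> y) / (x + \<i> y)\<close> of \<open>x/y\<close> under the Cayley transform.\<close>

definition line_pt :: "plane \<Rightarrow> complex" where
  "line_pt v = cnj (to_complex v) / to_complex v"

lemma inv_cayley: "matrix_inv cayley = vector [vector [1/2, 1/2], vector [\<i>/2, -\<i>/2]]" (is "_ = ?B")
proof -
  have 1: "cayley ** ?B = mat 1" and 2: "?B ** cayley = mat 1"
    by (simp_all add: cayley_def matrix_matrix_mult_def mat_def vec_eq_iff forall_2 sum_2)
  have "\<exists>B. cayley ** B = mat 1 \<and> B ** cayley = mat 1"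
    using 1 2 by blast
  then have *: "matrix_inv cayley ** cayley = mat 1"
    unfolding matrix_inv_def by (rule someI2_ex) simp
  have "matrix_inv cayley = matrix_inv cayley ** (cayley ** ?B)"
    unfolding 1 by (rule matrix_mul_rid[symmetric])
  also have "\<dots> = ?B"
    unfolding matrix_mul_assoc * by (rule matrix_mul_lid)
  finally show ?thesis .
qed

lemma disk_act_line_pt:
  assumes "det A \<noteq> 0" "v \<noteq> 0"
  shows "disk_act A (line_pt v) = line_pt (A *v v)"
proof -
  have z: "to_complex v \<noteq> 0" using assms(2)
    by (auto simp: to_complex_def complex_eq_iff vec_eq_iff forall_2)
  have "A *v v \<noteq> 0" using assms by (metis invertible_det_nz matrix_left_invertible_ker invertible_def)
  then have z': "to_complex (A *v v) \<noteq> 0" 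
    by (auto simp: to_complex_def complex_eq_iff vec_eq_iff forall_2)
  define M where "M = cayley ** complex_mat A ** matrix_inv cayley"
  have 1: "M$1$1 * cnj (to_complex v) + M$1$2 * to_complex v = cnj (to_complex (A *v v))"
   and 2: "M$2$1 * cnj (to_complex v) + M$2$2 * to_complex v = to_complex (A *v v)"
    unfolding M_def inv_cayley
    by (auto simp: cayley_def complex_mat_def matrix_matrix_mult_def matrix_vector_mult_def sum_2
      to_complex_def complex_eq_iff field_simps)
  show ?thesis
    unfolding disk_act_def line_pt_def M_def[symmetric] mobius_def
    using z z' 1 2 by (simp add: field_simps)
qed

text \<open>The unit disk is the Poincare disk. The map \<open>klein\<close> to the Klein model fixes the
  circle and turns geodesics into chords, hence hyperbolic convex hulls into Euclidean ones.\<close>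

definition klein :: "complex \<Rightarrow> complex" where
  "klein z = (2 / (1 + (cmod z)\<^sup>2)) *\<^sub>R z"

definition geodesic :: "complex \<Rightarrow> complex \<Rightarrow> complex set" where
  "geodesic p q = {z \<in> ball 0 1. klein z \<in> open_segment p q}"

definition ideal_polygon :: "complex set \<Rightarrow> complex set" where
  "ideal_polygon V = {z \<in> ball 0 1. klein z \<in> convex hull V}"

definition fundamental_domain :: "(real^2^2) set set \<Rightarrow> complex set \<Rightarrow> bool" where
  "fundamental_domain \<Gamma> D \<longleftrightarrow> D \<subseteq> ball 0 1 \<and>
     (\<Union>g\<in>\<Gamma>. \<Union>A\<in>g. disk_act A ` D) = ball 0 1 \<and>
     (\<forall>g\<in>\<Gamma>. g \<noteq> \<one>\<^bsub>PSL2\<^esub> \<longrightarrow> (\<forall>A\<in>g. disk_act A ` interior D \<inter> interior D = {}))"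

section \<open>Boundary expansions\<close>

definition alphabet_involution :: "'a set \<Rightarrow> ('a \<Rightarrow> 'a) \<Rightarrow> bool" where
  "alphabet_involution A0 bar \<longleftrightarrow> (\<forall>\<alpha>. bar (bar \<alpha>) = \<alpha>) \<and>
     A0 \<union> bar ` A0 = UNIV \<and> A0 \<inter> bar ` A0 = {}"

text \<open>The closed arc run through clockwise from \<open>p\<close> until \<open>q\<close> is first met. Rotating a line
  counterclockwise by \<open>s\<close> moves its point on the circle clockwise by \<open>2 s\<close>; so the directions in
  \<open>cw_arc \<xi>r \<xi>l\<close> are those met when rotating counterclockwise from \<open>\<xi>r\<close> to \<open>\<xi>l\<close>.\<close>

definition cw_arc :: "complex \<Rightarrow> complex \<Rightarrow> complex set" where
  "cw_arc p q = {p * cis (- s) | s. 0 \<le> s \<and> (\<forall>t. 0 \<le> t \<and> t < s \<longrightarrow> p * cis (- t) \<noteq> q)}"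

text \<open>Labelling of the sides of the ideal polygon with vertex set \<open>V\<close>: the side \<open>\<alpha>\<close> joins
  \<open>\<xi>r \<alpha>\<close> to the next vertex in clockwise order, \<open>\<xi>l \<alpha>\<close>.\<close>

definition side_labelling :: "complex set \<Rightarrow> ('a \<Rightarrow> complex) \<Rightarrow> ('a \<Rightarrow> complex) \<Rightarrow> bool" where
  "side_labelling V \<xi>r \<xi>l \<longleftrightarrow> bij_betw \<xi>r UNIV V \<and>
     (\<forall>\<alpha>. \<xi>l \<alpha> \<in> V \<and> \<xi>l \<alpha> \<noteq> \<xi>r \<alpha> \<and> cw_arc (\<xi>r \<alpha>) (\<xi>l \<alpha>) \<inter> V = {\<xi>r \<alpha>, \<xi>l \<alpha>})"

definition side_pairing_maps :: "(real^2^2) set set \<Rightarrow> complex set \<Rightarrow> ('a \<Rightarrow> 'a) \<Rightarrow>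
    ('a \<Rightarrow> complex set) \<Rightarrow> ('a \<Rightarrow> real^2^2) \<Rightarrow> bool" where
  "side_pairing_maps \<Gamma> D bar e G \<longleftrightarrow> (\<forall>\<alpha>.
     det (G \<alpha>) = 1 \<and> psl (G \<alpha>) \<in> \<Gamma> \<and>
     psl (G (bar \<alpha>)) = inv\<^bsub>PSL2\<^esub> (psl (G \<alpha>)) \<and>
     disk_act (G \<alpha>) ` e (bar \<alpha>) = e \<alpha> \<and>
     disk_act (G \<alpha>) ` D \<inter> D = e \<alpha>)"

definition mat_prod :: "(real^2^2) list \<Rightarrow> real^2^2" where
  "mat_prod Ms = foldr (**) Ms (mat 1)"

definition prefix_mat :: "('a \<Rightarrow> real^2^2) \<Rightarrow> (nat \<Rightarrow> 'a) \<Rightarrow> nat \<Rightarrow> real^2^2" where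
  "prefix_mat G a n = mat_prod (map (\<lambda>k. G (a k)) [0..<n])"

definition cuspidal :: "(real^2^2) set set \<Rightarrow> complex set \<Rightarrow> complex \<Rightarrow> bool" where
  "cuspidal \<Gamma> V \<xi> \<longleftrightarrow> (\<exists>g\<in>\<Gamma>. \<exists>A\<in>g. \<exists>p\<in>V. \<xi> = disk_act A p)"

definition boundary_expansion :: "('a \<Rightarrow> 'a) \<Rightarrow> ('a \<Rightarrow> real^2^2) \<Rightarrow> ('a \<Rightarrow> complex) \<Rightarrow>
    ('a \<Rightarrow> complex) \<Rightarrow> (nat \<Rightarrow> 'a) \<Rightarrow> complex \<Rightarrow> bool" where
  "boundary_expansion bar G \<xi>r \<xi>l a \<xi> \<longleftrightarrow>
     (\<forall>n. a (Suc n) \<noteq> bar (a n)) \<and>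
     (\<forall>n. \<xi> \<in> disk_act (prefix_mat G a n) ` cw_arc (\<xi>r (a n)) (\<xi>l (a n)))"

section \<open>Wedges and areas\<close>

definition shortest_holonomy :: "glued_polygons \<Rightarrow> complex \<Rightarrow> plane \<Rightarrow> bool" where
  "shortest_holonomy S \<xi> v \<longleftrightarrow> v \<in> holonomies S \<and> line_pt v = \<xi> \<and>
     (\<forall>w \<in> holonomies S. line_pt w = \<xi> \<longrightarrow> norm v \<le> norm w)"

definition is_wedge :: "glued_polygons \<Rightarrow> complex \<Rightarrow> complex \<Rightarrow> real^2^2 \<Rightarrow> bool" where
  "is_wedge S \<xi>r \<xi>l W \<longleftrightarrow>
     (let vr = column 1 W; vl = column 2 W in
       shortest_holonomy S \<xi>r vr \<and> shortest_holonomy S \<xi>l vl \<and>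
       vr$2 \<ge> 0 \<and> vl$2 \<ge> 0 \<and> det W > 0 \<and>
       {v. v \<noteq> 0 \<and> line_pt v \<in> cw_arc \<xi>r \<xi>l} =
         {v. v \<noteq> 0 \<and> (\<exists>a b. a \<ge> 0 \<and> b \<ge> 0 \<and>
            (v = a *\<^sub>R vr + b *\<^sub>R vl \<or> v = - (a *\<^sub>R vr + b *\<^sub>R vl)))})"

definition wedge_seq :: "('a \<Rightarrow> real^2^2) \<Rightarrow> ('a \<Rightarrow> real^2^2) \<Rightarrow> (nat \<Rightarrow> 'a) \<Rightarrow> nat \<Rightarrow> real^2^2" where
  "wedge_seq G W a n = prefix_mat G a n ** W (a n)"

text \<open>\<open>\<theta>\<close> is the angle from the vertical, measured counterclockwise.\<close>

definition direction_pt :: "real \<Rightarrow> complex" where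
  "direction_pt \<theta> = line_pt (vector [- sin \<theta>, cos \<theta>])"

definition Area :: "plane \<Rightarrow> real \<Rightarrow> real" where
  "Area v \<theta> = \<bar>Re (cis (- \<theta>) * to_complex v)\<bar> * \<bar>Im (cis (- \<theta>) * to_complex v)\<bar>"

section \<open>Continued fractions\<close>

text \<open>Values of continued fractions lie in \<open>[0, \<infinity>]\<close>, with the single point at infinity of the
  projective line represented by \<open>\<infinity> :: ereal\<close>. This is the image \<open>a/c\<close> of infinity.\<close>

definition image_of_inf :: "real^2^2 \<Rightarrow> ereal" where
  "image_of_inf M = (if M$2$1 = 0 then \<infinity> else ereal (M$1$1 / M$2$1))"

definition swap_mat :: "real^2^2" where
  "swap_mat = vector [vector [0, 1], vector [1, 0]]"

definition cf_A :: "('a \<Rightarrow> real^2^2) \<Rightarrow> ('a \<Rightarrow> real^2^2) \<Rightarrow> 'a \<Rightarrow> 'a \<Rightarrow> real^2^2" where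
  "cf_A G W \<alpha> \<beta> = matrix_inv (W \<alpha>) ** G \<alpha> ** G \<beta> ** matrix_inv (G \<alpha>) ** W \<alpha>"

definition cf_B :: "('a \<Rightarrow> real^2^2) \<Rightarrow> ('a \<Rightarrow> real^2^2) \<Rightarrow> 'a \<Rightarrow> 'a \<Rightarrow> real^2^2" where
  "cf_B G W \<alpha> \<beta> =
     swap_mat ** transpose (W \<alpha>) ** transpose (G \<beta>) ** matrix_inv (transpose (W \<alpha>)) ** swap_mat"

text \<open>The words in the next two definitions are meant to be non-empty.\<close>

definition cf_plus :: "('a \<Rightarrow> real^2^2) \<Rightarrow> ('a \<Rightarrow> real^2^2) \<Rightarrow> 'a \<Rightarrow> 'a list \<Rightarrow> ereal" where
  "cf_plus G W \<alpha> bs = image_of_inf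
     (mat_prod (map (cf_A G W \<alpha>) (butlast bs)) ** (matrix_inv (W \<alpha>) ** G \<alpha> ** W (last bs)))"

definition cf_minus :: "('a \<Rightarrow> real^2^2) \<Rightarrow> ('a \<Rightarrow> real^2^2) \<Rightarrow> 'a \<Rightarrow> 'a list \<Rightarrow> ereal" where
  "cf_minus G W \<alpha> bs = image_of_inf
     (mat_prod (map (cf_B G W \<alpha>) bs) **
        (swap_mat ** transpose (W \<alpha>) ** matrix_inv (transpose (W (last bs))) ** swap_mat))"

definition cf_plus_inf :: "('a \<Rightarrow> real^2^2) \<Rightarrow> ('a \<Rightarrow> real^2^2) \<Rightarrow> 'a \<Rightarrow> (nat \<Rightarrow> 'a) \<Rightarrow> ereal" where
  "cf_plus_inf G W \<alpha> b = lim (\<lambda>n. cf_plus G W \<alpha> (map b [0..<Suc n]))"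

definition asymp_same :: "(nat \<Rightarrow> ereal) \<Rightarrow> (nat \<Rightarrow> ereal) \<Rightarrow> bool" where
  "asymp_same x y \<longleftrightarrow> (\<lambda>n. \<bar>x n - y n\<bar>) \<longlonglongrightarrow> 0"

end

theory Submission
  imports Defs
begin

text \<open>Write the unit vector \<open>u\<close> in direction \<open>\<theta>\<close> as \<open>x r + y l\<close> in the \<open>n\<close>-th wedge \<open>(r, l)\<close>. Then
  \<open>det / Area r = x / y + (l \<bullet> u) / (r \<bullet> u)\<close> exactly; \<open>x / y\<close> is the forward continued fraction and the
  backward one is \<open>(l \<bullet> w) / (r \<bullet> w)\<close> for a fixed vector \<open>w\<close> with \<open>u \<bullet> w \<noteq> 0\<close>. As the determinants take
  finitely many values, \<open>(l \<bullet> u) / (r \<bullet> u) - (l \<bullet> w) / (r \<bullet> w)\<close> is a bounded multiple of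
  \<open>1 / ((r \<bullet> u) (r \<bullet> w))\<close>, so it suffices that \<open>r\<close> and \<open>l\<close> tend to infinity.

  Side pairings preserve holonomies, so consecutive nested wedges that share a direction share the
  shortest vector in it. The product of the side pairings around a vertex of \<open>D\<close> thus fixes a vector and is
  parabolic; by discreteness of the Veech group the orbit of that vector is locally finite. Hence if \<open>r\<close>
  did not tend to infinity, some value would recur, and by nestedness \<open>r\<close> would be eventually constant;
  then \<open>l\<close> grows linearly along \<open>r\<close> and \<open>u\<close> is parallel to \<open>r\<close>, so \<open>\<theta>\<close> is cuspidal.\<close>

section \<open>Plane vectors and nested cones\<close>

text \<open>The hypotheses on side pairings are equations between subsets of the disk and say
  nothing directly about vectors. To reach the wedges, points of the disk are written as positive
  definite symmetric matrices, on which \<open>A\<close> acts by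
  \<open>A ** Q ** transpose A\<close>. Geodesics become chords lying in zero sets of linear forms,
  and questions of position become signs of \<open>cross\<close> products. The set equation for a
  side still allows two ways of matching its endpoints; that the polygon and its neighbour meet only
  along the side excludes the wrong one.

  Matrices and lines carry an undetermined sign, so positions are stated through products of two
  \<open>cross\<close> values, which do not change when a vector is negated. Signs are fixed once,
  along the expansion, which turns the wedges into nested cones with nonnegative transition
  coefficients.

  Growth of both \<open>r\<close> and \<open>l\<close> is needed to control either one: the distance
  of \<open>r\<close> from the line of \<open>u\<close> is proportional to the coefficient of
  \<open>l\<close> in \<open>u\<close>, which is small because \<open>l\<close> is long, and
  conversely.\<close>

lemma cross_add_left: "cross (u + v) w = cross u w + cross v w"
  and cross_add_right: "cross w (u + v) = cross w u + cross w v"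
  and cross_diff_left: "cross (u - v) w = cross u w - cross v w"
  and cross_diff_right: "cross w (u - v) = cross w u - cross w v"
  and cross_minus_left: "cross (- u) w = - cross u w"
  and cross_minus_right: "cross w (- u) = - cross w u"
  and cross_scaleR_left: "cross (c *\<^sub>R u) w = c * cross u w"
  and cross_scaleR_right: "cross w (c *\<^sub>R u) = c * cross w u"
  and cross_self: "cross u u = 0"
  by (simp_all add: cross_def algebra_simps)

lemmas cross_simps = cross_add_left cross_add_right cross_diff_left cross_diff_right cross_minus_left
  cross_minus_right cross_scaleR_left cross_scaleR_right cross_self

lemma cross_commute: "cross v u = - cross u v"
  by (simp add: cross_def)

lemma cross_matrix: "cross (A *v u) (A *v v) = det A * cross u v"
  by (simp add: cross_def matrix_vector_mult_def sum_2 det_2 algebra_simps)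

lemma cross_columns: "cross (column 1 W) (column 2 W) = det W"
  by (simp add: cross_def det_2 column_def)

lemma column_matrix_mult: "column i (A ** B) = A *v column i B"
  by (simp add: column_def matrix_matrix_mult_def matrix_vector_mult_def)

lemma matrix_vector_columns:
  "(W :: real^2^2) *v v = v$1 *\<^sub>R column 1 W + v$2 *\<^sub>R column 2 W"
  by (simp add: vec_eq_iff matrix_vector_mult_def sum_2 column_def)

lemma cross_cramer: "cross p q *\<^sub>R v = cross v q *\<^sub>R p + cross p v *\<^sub>R q"
  by (simp add: vec_eq_iff forall_2 cross_def algebra_simps)

lemma cross_zero_imp_parallel:
  assumes "cross p v = 0" "p \<noteq> 0"
  obtains c where "v = c *\<^sub>R p"
proof (cases "p$1 = 0")
  case True
  with assms have "p$2 \<noteq> 0" by (auto simp: vec_eq_iff forall_2)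
  with assms True have "v = (v$2 / p$2) *\<^sub>R p"
    by (auto simp: vec_eq_iff forall_2 cross_def)
  then show ?thesis using that by blast
next
  case False
  with assms have "v = (v$1 / p$1) *\<^sub>R p"
    by (auto simp: vec_eq_iff forall_2 cross_def field_simps)
  then show ?thesis using that by blast
qed

lemma line_pt_scaleR: "c \<noteq> 0 \<Longrightarrow> line_pt (c *\<^sub>R v) = line_pt v"
proof -
  assume "c \<noteq> 0"
  moreover have "to_complex (c *\<^sub>R v) = of_real c * to_complex v"
    by (simp add: to_complex_def complex_eq_iff)
  ultimately show ?thesis by (simp add: line_pt_def)
qed

lemma line_pt_eq_iff:
  assumes "v \<noteq> 0" "w \<noteq> 0"
  shows "line_pt v = line_pt w \<longleftrightarrow> cross v w = 0"
proof
  assume eq: "line_pt v = line_pt w"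
  have "v$1 \<noteq> 0 \<or> v$2 \<noteq> 0" "w$1 \<noteq> 0 \<or> w$2 \<noteq> 0"
    using assms by (auto simp: vec_eq_iff forall_2)
  then have "to_complex v \<noteq> 0" "to_complex w \<noteq> 0"
    by (auto simp: to_complex_def complex_eq_iff)
  with eq have "cnj (to_complex v) * to_complex w = cnj (to_complex w) * to_complex v"
    by (simp add: line_pt_def frac_eq_eq)
  then have "Im (cnj (to_complex v) * to_complex w) = Im (cnj (to_complex w) * to_complex v)" by simp
  then show "cross v w = 0" by (simp add: to_complex_def cross_def)
next
  assume "cross v w = 0"
  then obtain c where "w = c *\<^sub>R v" using cross_zero_imp_parallel assms by blast
  with assms show "line_pt v = line_pt w" by (auto simp: line_pt_scaleR)
qed

lemma unit_circle_line_pt: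
  assumes "cmod z = 1"
  obtains v where "v \<noteq> 0" "line_pt v = z"
proof -
  obtain t where t: "z = cis t" using assms by (metis cis_Arg norm_zero sgn_eq zero_neq_one div_by_1 of_real_1)
  \<comment> \<open>\<open>line_pt\<close> conjugates and doubles the angle, hence the angle
    \<open>- t / 2\<close>.\<close>
  let ?v = "vector [cos (t / 2), - sin (t / 2)] :: plane"
  have v: "to_complex ?v = cis (- (t / 2))" by (simp add: to_complex_def complex_eq_iff)
  have "line_pt ?v = cis (t / 2) / cis (- (t / 2))" by (simp only: line_pt_def v cis_cnj minus_minus)
  also have "\<dots> = z" by (simp add: cis_divide t)
  finally have "line_pt ?v = z" .
  moreover have "?v \<noteq> 0"
    using sin_zero_norm_cos_one[of "t / 2"] by (auto simp: vec_eq_iff forall_2)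
  ultimately show ?thesis using that by blast
qed

text \<open>The Binet-Cauchy identity. It turns the difference of two quotients of inner products
  into the area of a wedge over a product of two large numbers.\<close>

lemma inner_cross: "(l \<bullet> u) * (r \<bullet> w) - (l \<bullet> w) * (r \<bullet> u) = cross l r * cross u w"
  for l :: plane
  by (simp add: inner_vec_def sum_2 cross_def algebra_simps)

text \<open>The sign \<open>s\<close> allows a second use with the two vectors exchanged, where the
  oriented areas are negative. In \<open>shared\<close>, \<open>c n = 0\<close> says that the ray of
  \<open>r\<close> is kept; then \<open>r\<close> itself is kept and \<open>l\<close> advances along
  it by at least \<open>\<epsilon>\<close>.\<close>

lemma fan_unbounded:
  fixes r l :: "nat \<Rightarrow> plane" and s :: real
  assumes r: "\<And>n. r (Suc n) = a n *\<^sub>R r n + c n *\<^sub>R l n"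
    and l: "\<And>n. l (Suc n) = b n *\<^sub>R r n + d n *\<^sub>R l n"
    and nonneg: "\<And>n. 0 \<le> b n" "\<And>n. 0 \<le> c n" and pos: "\<And>n. 0 < a n" "\<And>n. 0 < d n"
    and shared: "\<And>n. c n = 0 \<Longrightarrow> a n = 1 \<and> \<epsilon> \<le> b n" and "0 < \<epsilon>"
    and u: "\<And>n. u = x n *\<^sub>R r n + y n *\<^sub>R l n" and x: "\<And>n. 0 < x n" and y: "\<And>n. 0 < y n"
    and area: "\<And>n. 0 < s * cross (r n) (l n)" "\<And>n. s * cross (r n) (l n) \<le> \<Delta>"
    and fin: "\<And>R. finite {r n | n. norm (r n) \<le> R}"
  shows "filterlim (\<lambda>n. norm (r n)) at_top sequentially"
proof (rule ccontr)
  assume "\<not> ?thesis"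
  then obtain R where "\<not> (\<forall>\<^sub>F n in sequentially. R \<le> norm (r n))"
    unfolding filterlim_at_top by blast
  then have inf: "infinite {n. norm (r n) \<le> R}"
    unfolding eventually_sequentially infinite_nat_iff_unbounded_le
    by (metis linear mem_Collect_eq)
  have "r ` {n. norm (r n) \<le> R} = {r n | n. norm (r n) \<le> R}" by auto
  with fin have "finite (r ` {n. norm (r n) \<le> R})" by simp
  from pigeonhole_infinite[OF inf this] obtain m
    where inf2: "infinite {n \<in> {n. norm (r n) \<le> R}. r n = r m}" by auto
  \<comment> \<open>\<open>g\<close> measures how far \<open>r\<close> has turned away from
    \<open>r m\<close>. It is fed by the positive \<open>h\<close> and can never return to 0 once
    positive, whereas every recurrence of the value \<open>r m\<close> makes it 0.\<close>
  define g h where "g k = s * cross (r m) (r (m + k))" and "h k = s * cross (r m) (l (m + k))" for k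
  have gS: "g (Suc k) = a (m + k) * g k + c (m + k) * h k"
    and hS: "h (Suc k) = b (m + k) * g k + d (m + k) * h k" for k
    by (simp_all add: g_def h_def r l cross_simps algebra_simps)
  have gh: "0 \<le> g k \<and> 0 < h k" for k
  proof (induction k)
    case 0
    show ?case using area(1)[of m] by (simp add: g_def h_def cross_simps)
  next
    case (Suc k)
    have "0 < d (m + k) * h k" "0 \<le> a (m + k) * g k"
      using Suc pos[of "m + k"] by simp_all
    with Suc nonneg[of "m + k"] show ?case
      unfolding gS hS by (simp add: add_nonneg_pos)
  qed
  have mono: "0 < g k \<Longrightarrow> 0 < g (k + j)" for k j
  proof (induction j)
    case (Suc j)
    then have "0 < a (m + (k + j)) * g (k + j)" using pos by simp
    moreover have "0 \<le> c (m + (k + j)) * h (k + j)" 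
      using gh[of "k + j"] nonneg(2) by (simp add: less_imp_le)
    ultimately show ?case by (simp add: gS)
  qed simp
  have g0: "g k = 0" for k
  proof (rule ccontr)
    assume "g k \<noteq> 0"
    with gh[of k] have "0 < g k" by simp
    from inf2 obtain n where "n \<ge> m + k" "r n = r m"
      unfolding infinite_nat_iff_unbounded_le by blast
    then have "g (k + (n - m - k)) = 0" by (simp add: g_def cross_simps)
    with mono[OF \<open>0 < g k\<close>, of "n - m - k"] show False by simp
  qed
  have c0: "c (m + k) = 0" for k
    using gS[of k] gh[of k] by (simp add: g0)
  have rk: "r (m + k) = r m" for k
    by (induction k) (simp_all add: r c0 shared)
  \<comment> \<open>With \<open>r\<close> constant, the coefficient \<open>y\<close> times the area
    is constant; bounded areas therefore keep \<open>y\<close> away from 0.\<close>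
  define \<kappa> where "\<kappa> = s * cross (r m) u"
  have yk: "\<kappa> = y (m + k) * (s * cross (r (m + k)) (l (m + k)))" for k
    unfolding \<kappa>_def by (subst u[of "m + k"]) (simp add: rk cross_simps)
  have "0 < \<kappa>" using yk[of 0] y[of m] area(1)[of m] by simp
  have "0 < \<Delta>" using area[of 0] by linarith
  have ylow: "\<kappa> / \<Delta> \<le> y (m + k)" for k
    using yk[of k] area(2)[of "m + k"] y[of "m + k"] \<open>0 < \<Delta>\<close>
    by (simp add: pos_divide_le_eq mult_left_mono)
  \<comment> \<open>Expanding \<open>u\<close> in two consecutive cones with the same
    \<open>r\<close> shows that \<open>x\<close> drops by \<open>b * y\<close>. A drop bounded below
    cannot be repeated forever, as \<open>x\<close> stays positive.\<close>
  have xS: "x (m + Suc k) \<le> x (m + k) - \<epsilon> * (\<kappa> / \<Delta>)" for k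
  proof -
    let ?j = "m + k" and ?i = "Suc (m + k)"
    have cr: "cross (r m) (l ?j) \<noteq> 0" using area(1)[of ?j] by (auto simp: rk)
    have "cross u (l ?j) = x ?j * cross (r m) (l ?j)"
      by (subst u[of ?j]) (simp add: rk cross_simps)
    moreover have "cross u (l ?j) = (x ?i + b ?j * y ?i) * cross (r m) (l ?j)"
      using rk[of "Suc k"] by (subst u[of ?i]) (simp add: l rk cross_simps, simp add: algebra_simps)
    ultimately have "x ?j = x ?i + b ?j * y ?i" using cr by simp
    moreover have "\<epsilon> * (\<kappa> / \<Delta>) \<le> b ?j * y ?i"
      using shared[OF c0[of k]] ylow[of "Suc k"] \<open>0 < \<epsilon>\<close> \<open>0 < \<kappa>\<close> \<open>0 < \<Delta>\<close>
      by (intro mult_mono) (simp_all add: less_imp_le)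
    ultimately show ?thesis by simp
  qed
  have xk: "x (m + k) \<le> x m - real k * (\<epsilon> * (\<kappa> / \<Delta>))" for k
  proof (induction k)
    case (Suc k)
    have "real (Suc k) * (\<epsilon> * (\<kappa> / \<Delta>)) = real k * (\<epsilon> * (\<kappa> / \<Delta>)) + \<epsilon> * (\<kappa> / \<Delta>)"
      by (simp only: of_nat_Suc distrib_right mult_1)
    with Suc xS[of k] show ?case by linarith
  qed simp
  have "0 < \<epsilon> * (\<kappa> / \<Delta>)" using \<open>0 < \<epsilon>\<close> \<open>0 < \<kappa>\<close> \<open>0 < \<Delta>\<close> by simp
  then obtain k where "x m < real k * (\<epsilon> * (\<kappa> / \<Delta>))"
    using reals_Archimedean3 by blast
  with xk[of k] x[of "m + k"] show False by simp
qed

section \<open>Limits of the edges of nested cones\<close>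

lemma nested_cones:
  fixes r l :: "nat \<Rightarrow> plane"
  assumes r: "\<And>n. r (Suc n) = a n *\<^sub>R r n + c n *\<^sub>R l n"
    and l: "\<And>n. l (Suc n) = b n *\<^sub>R r n + d n *\<^sub>R l n"
    and nonneg: "\<And>n. 0 \<le> a n" "\<And>n. 0 \<le> b n" "\<And>n. 0 \<le> c n" "\<And>n. 0 \<le> d n"
  shows "(\<exists>s\<ge>0. \<exists>t\<ge>0. r n = s *\<^sub>R r 0 + t *\<^sub>R l 0) \<and> (\<exists>s\<ge>0. \<exists>t\<ge>0. l n = s *\<^sub>R r 0 + t *\<^sub>R l 0)"
proof (induction n)
  case 0
  have "r 0 = 1 *\<^sub>R r 0 + 0 *\<^sub>R l 0" "l 0 = 0 *\<^sub>R r 0 + 1 *\<^sub>R l 0" by simp_all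
  then show ?case by (meson order_refl zero_le_one)
next
  case (Suc n)
  then obtain s t s' t' where *: "s \<ge> 0" "t \<ge> 0" "s' \<ge> 0" "t' \<ge> 0"
    "r n = s *\<^sub>R r 0 + t *\<^sub>R l 0" "l n = s' *\<^sub>R r 0 + t' *\<^sub>R l 0" by blast
  have "r (Suc n) = (a n * s + c n * s') *\<^sub>R r 0 + (a n * t + c n * t') *\<^sub>R l 0"
    "l (Suc n) = (b n * s + d n * s') *\<^sub>R r 0 + (b n * t + d n * t') *\<^sub>R l 0"
    unfolding r l *(5,6) by (simp_all add: algebra_simps)
  moreover have "0 \<le> a n * s + c n * s'" "0 \<le> a n * t + c n * t'"
    "0 \<le> b n * s + d n * s'" "0 \<le> b n * t + d n * t'"
    using * nonneg by simp_all
  ultimately show ?case by blast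
qed

text \<open>A vector \<open>v\<close> is split along \<open>u\<close> and the kernel of the linear form \<open>\<lambda>v. cross v k\<close>, which is
  positive on the initial cone.\<close>

lemma cone_limits:
  fixes r l :: "nat \<Rightarrow> plane"
  assumes cone: "\<And>n. \<exists>s\<ge>0. \<exists>t\<ge>0. r n = s *\<^sub>R r 0 + t *\<^sub>R l 0"
    "\<And>n. \<exists>s\<ge>0. \<exists>t\<ge>0. l n = s *\<^sub>R r 0 + t *\<^sub>R l 0"
    and u: "\<And>n. u = x n *\<^sub>R r n + y n *\<^sub>R l n" and x: "\<And>n. 0 < x n" and y: "\<And>n. 0 < y n"
    and area: "\<And>n. 0 < cross (r n) (l n)" "\<And>n. cross (r n) (l n) \<le> \<Delta>"
    and lim: "filterlim (\<lambda>n. norm (r n)) at_top sequentially"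
      "filterlim (\<lambda>n. norm (l n)) at_top sequentially"
  shows "\<And>w. 0 < u \<bullet> w \<Longrightarrow> filterlim (\<lambda>n. r n \<bullet> w) at_top sequentially"
    and "\<And>w. 0 < u \<bullet> w \<Longrightarrow> filterlim (\<lambda>n. l n \<bullet> w) at_top sequentially"
    and "\<And>p q. cross p u \<noteq> 0 \<Longrightarrow> (\<lambda>n. cross (r n) q / cross p (r n)) \<longlonglongrightarrow> cross u q / cross p u"
proof -
  \<comment> \<open>On \<open>s *\<^sub>R r 0 + t *\<^sub>R l 0\<close> the form \<open>f\<close>
    takes the value \<open>(s + t) * \<delta>\<close>, so on the initial cone it is comparable with
    the norm.\<close>
  define k where "k = l 0 - r 0"
  define f where "f v = cross v k" for v
  define \<delta> where "\<delta> = cross (r 0) (l 0)"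
  have "0 < \<delta>" using area(1) by (simp add: \<delta>_def)
  define K where "K = norm (r 0) + norm (l 0)"
  have low: "0 \<le> f v \<and> norm v * \<delta> \<le> K * f v" if "s \<ge> 0" "t \<ge> 0" "v = s *\<^sub>R r 0 + t *\<^sub>R l 0" for v s t
  proof -
    have f: "f v = (s + t) * \<delta>"
      unfolding that(3) f_def k_def \<delta>_def
      by (simp add: cross_simps cross_commute[of "l 0" "r 0"] algebra_simps)
    have "norm v \<le> s * norm (r 0) + t * norm (l 0)"
      unfolding that(3) using that norm_triangle_ineq[of "s *\<^sub>R r 0" "t *\<^sub>R l 0"] by simp
    also have "\<dots> \<le> K * (s + t)"
      using that by (simp add: K_def algebra_simps)
    finally show ?thesis using f that \<open>0 < \<delta>\<close> by simp
  qed
  have "r 0 \<noteq> 0" using \<open>0 < \<delta>\<close> by (auto simp: \<delta>_def cross_def)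
  then have "0 < K" by (simp add: K_def add_pos_nonneg)
  have fv: "filterlim (\<lambda>n. f (v n)) at_top sequentially"
    if v: "\<And>n. \<exists>s\<ge>0. \<exists>t\<ge>0. v n = s *\<^sub>R r 0 + t *\<^sub>R l 0"
      and "filterlim (\<lambda>n. norm (v n)) at_top sequentially" for v :: "nat \<Rightarrow> plane"
  proof (rule filterlim_at_top_mono)
    show "filterlim (\<lambda>n. (\<delta> / K) * norm (v n)) at_top sequentially"
      using \<open>0 < \<delta>\<close> \<open>0 < K\<close> that(2)
      by (intro filterlim_tendsto_pos_mult_at_top[OF tendsto_const]) simp_all
    have "(\<delta> / K) * norm (v n) \<le> f (v n)" for n
      using v[of n] low \<open>0 < K\<close> by (auto simp: field_simps)
    then show "\<forall>\<^sub>F n in sequentially. (\<delta> / K) * norm (v n) \<le> f (v n)" by simp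
  qed
  note fr = fv[OF cone(1) lim(1)] and fl = fv[OF cone(2) lim(2)]
  have f_nonneg: "0 \<le> f (r n)" "0 \<le> f (l n)" for n
    using cone[of n] low by blast+
  have fu: "f u = x n * f (r n) + y n * f (l n)" for n
    unfolding f_def by (subst u[of n]) (simp add: cross_simps)
  have "f u = (x 0 + y 0) * \<delta>"
    by (subst u[of 0]) (simp add: f_def k_def \<delta>_def cross_simps cross_commute[of "l 0" "r 0"] algebra_simps)
  then have fu_pos: "0 < f u" using x[of 0] y[of 0] \<open>0 < \<delta>\<close> by simp
  \<comment> \<open>The bounded product \<open>z n * f (v' n)\<close> forces the coefficient
    \<open>z n\<close> to 0 as the opposite edge \<open>v'\<close> grows. It is used with
    \<open>v\<close> and \<open>v'\<close> the two edges, in either order.\<close>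
  have small: "(\<lambda>n. cross (v n) u) \<longlonglongrightarrow> 0"
    if "\<And>n. \<bar>cross (v n) u\<bar> \<le> z n * \<Delta>" "\<And>n. z n * f (v' n) \<le> f u" "\<And>n. 0 < z n"
      "filterlim (\<lambda>n. f (v' n)) at_top sequentially" for v v' :: "nat \<Rightarrow> plane" and z
  proof (rule tendsto_rabs_zero_cancel, rule real_tendsto_sandwich[of "\<lambda>_. 0"])
    show "(\<lambda>n. f u * \<Delta> / f (v' n)) \<longlonglongrightarrow> 0"
      using that(4) by (intro real_tendsto_divide_at_top[OF tendsto_const])
    have "0 \<le> \<Delta>" using area[of 0] by linarith
    have "\<forall>\<^sub>F n in sequentially. 0 < f (v' n)"
      using that(4) by (simp add: filterlim_at_top_dense)
    then show "\<forall>\<^sub>F n in sequentially. \<bar>cross (v n) u\<bar> \<le> f u * \<Delta> / f (v' n)"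
    proof eventually_elim
      case (elim n)
      have "\<bar>cross (v n) u\<bar> * f (v' n) \<le> (z n * f (v' n)) * \<Delta>"
        using that(1)[of n] elim mult_right_mono by fastforce
      also have "\<dots> \<le> f u * \<Delta>" using that(2)[of n] \<open>0 \<le> \<Delta>\<close> by (rule mult_right_mono)
      finally show ?case using elim by (simp add: field_simps)
    qed
  qed simp_all
  have ru: "(\<lambda>n. cross (r n) u) \<longlonglongrightarrow> 0"
  proof (rule small[OF _ _ y fl])
    fix n
    have "cross (r n) u = y n * cross (r n) (l n)"
      by (subst u[of n]) (simp add: cross_simps)
    then show "\<bar>cross (r n) u\<bar> \<le> y n * \<Delta>"
      using area[of n] y[of n] by (simp add: abs_mult)
    show "y n * f (l n) \<le> f u" using fu[of n] f_nonneg[of n] x[of n] by simp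
  qed
  have lu: "(\<lambda>n. cross (l n) u) \<longlonglongrightarrow> 0"
  proof (rule small[OF _ _ x fr])
    fix n
    have "cross (l n) u = - x n * cross (r n) (l n)"
      by (subst u[of n]) (simp add: cross_simps cross_commute[of "l n" "r n"])
    then show "\<bar>cross (l n) u\<bar> \<le> x n * \<Delta>"
      using area[of n] x[of n] by (simp add: abs_mult)
    show "x n * f (r n) \<le> f u" using fu[of n] f_nonneg[of n] y[of n] by simp
  qed
  have split: "v = (f v / f u) *\<^sub>R u - (cross v u / f u) *\<^sub>R k" for v
  proof -
    have "f u *\<^sub>R v = f v *\<^sub>R u - cross v u *\<^sub>R k"
      by (simp add: f_def vec_eq_iff forall_2 cross_def algebra_simps)
    then have "(1 / f u) *\<^sub>R (f u *\<^sub>R v) = (1 / f u) *\<^sub>R (f v *\<^sub>R u - cross v u *\<^sub>R k)" by simp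
    then show ?thesis using fu_pos by (simp add: scaleR_diff_right)
  qed
  have inner: "filterlim (\<lambda>n. v n \<bullet> w) at_top sequentially"
    if "0 < u \<bullet> w" "(\<lambda>n. cross (v n) u) \<longlonglongrightarrow> 0" "filterlim (\<lambda>n. f (v n)) at_top sequentially"
    for v :: "nat \<Rightarrow> plane" and w
  proof -
    have eq: "(\<lambda>n. v n \<bullet> w) = (\<lambda>n. - (cross (v n) u / f u * (k \<bullet> w)) + (u \<bullet> w) / f u * f (v n))"
    proof
      fix n
      show "v n \<bullet> w = - (cross (v n) u / f u * (k \<bullet> w)) + (u \<bullet> w) / f u * f (v n)"
        by (subst split) (simp add: inner_diff_left)
    qed
    have "(\<lambda>n. - (cross (v n) u / f u * (k \<bullet> w))) \<longlonglongrightarrow> - (0 / f u * (k \<bullet> w))"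
      using that(2) fu_pos by (intro tendsto_intros) simp_all
    then show ?thesis
      unfolding eq using that fu_pos
      by (intro filterlim_tendsto_add_at_top filterlim_tendsto_pos_mult_at_top[OF tendsto_const]) auto
  qed
  show "\<And>w. 0 < u \<bullet> w \<Longrightarrow> filterlim (\<lambda>n. r n \<bullet> w) at_top sequentially"
    using inner ru fr by blast
  show "\<And>w. 0 < u \<bullet> w \<Longrightarrow> filterlim (\<lambda>n. l n \<bullet> w) at_top sequentially"
    using inner lu fl by blast
  fix p q assume pu: "cross p u \<noteq> 0"
  have quot: "(\<lambda>n. cross (r n) q / f (r n)) \<longlonglongrightarrow> cross u q / f u" for q
  proof -
    have "\<forall>\<^sub>F n in sequentially. 0 < f (r n)"
      using fr by (simp add: filterlim_at_top_dense)
    then have ev: "\<forall>\<^sub>F n in sequentially. cross u q / f u - cross (r n) u / f u * cross k q * (1 / f (r n))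
        = cross (r n) q / f (r n)"
    proof eventually_elim
      case (elim n)
      have "cross (r n) q = f (r n) / f u * cross u q - cross (r n) u / f u * cross k q"
        using arg_cong[OF split[of "r n"], of "\<lambda>v. cross v q"] by (simp add: cross_simps)
      then show ?case using elim by (simp add: field_simps)
    qed
    have "(\<lambda>n. cross u q / f u - cross (r n) u / f u * cross k q * (1 / f (r n)))
        \<longlonglongrightarrow> cross u q / f u - 0 / f u * cross k q * 0"
      using ru fr fu_pos
      by (intro tendsto_intros real_tendsto_divide_at_top[OF tendsto_const]) simp_all
    then show ?thesis using Lim_transform_eventually[OF _ ev] by simp
  qed
  have "(\<lambda>n. (cross (r n) q / f (r n)) / - (cross (r n) p / f (r n))) \<longlonglongrightarrow> (cross u q / f u) / - (cross u p / f u)"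
    using pu fu_pos by (intro tendsto_divide tendsto_minus quot) (simp add: cross_commute[of u p])
  moreover have "\<forall>\<^sub>F n in sequentially.
      (cross (r n) q / f (r n)) / - (cross (r n) p / f (r n)) = cross (r n) q / cross p (r n)"
  proof -
    have "\<forall>\<^sub>F n in sequentially. 0 < f (r n)"
      using fr by (simp add: filterlim_at_top_dense)
    then show ?thesis
      by eventually_elim (simp add: cross_commute[of p])
  qed
  ultimately show "(\<lambda>n. cross (r n) q / cross p (r n)) \<longlonglongrightarrow> cross u q / cross p u"
    using fu_pos Lim_transform_eventually[of _ _ sequentially] by (simp add: cross_commute[of p u])
qed

section \<open>Affine automorphisms and holonomies\<close>

text \<open>Makes the set of holonomies symmetric, so that a matrix lying in the Veech group only up
  to sign also acts on it.\<close>

lemma saddle_connection_reverse: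
  assumes "saddle_connection S \<gamma> v"
  shows "saddle_connection S (\<lambda>s. \<gamma> (1 - s)) (- v)"
  unfolding saddle_connection_def
proof (intro conjI ballI allI impI)
  have "continuous_map (top_of_set {0..1}) (top_of_set {0..1}) (\<lambda>s::real. 1 - s)"
    by (auto intro!: continuous_intros)
  then have "continuous_map (top_of_set {0..1}) (surf_top S) (\<gamma> \<circ> (\<lambda>s. 1 - s))"
    using assms by (intro continuous_map_compose) (auto simp: saddle_connection_def pathin_def)
  then show "pathin (surf_top S) (\<lambda>s. \<gamma> (1 - s))" by (simp add: pathin_def comp_def)
  show "\<gamma> (1 - 0) \<in> sing S" "\<gamma> (1 - 1) \<in> sing S" "- v \<noteq> 0"
    using assms by (simp_all add: saddle_connection_def)
  fix t :: real assume t: "t \<in> {0<..<1}"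
  then have t': "1 - t \<in> {0<..<1}" by simp
  then show "\<gamma> (1 - t) \<notin> sing S" using assms by (simp add: saddle_connection_def)
  fix U \<phi> assume "translation_chart S U \<phi> \<and> \<gamma> (1 - t) \<in> U"
  with assms t' have d: "((\<lambda>s. \<phi> (\<gamma> s)) has_vector_derivative v) (at (1 - t))"
    unfolding saddle_connection_def by blast
  have "((\<lambda>s. 1 - s) has_vector_derivative - 1) (at t)"
    by (auto intro!: derivative_eq_intros)
  from vector_diff_chain_at[OF this d]
  show "((\<lambda>s. \<phi> (\<gamma> (1 - s))) has_vector_derivative - v) (at t)"
    by (simp add: comp_def)
qed

text \<open>The chain rule in a chart at the point and a chart at its image. Interior points stay
  regular because \<open>f\<close> is injective and permutes the singularities.\<close>

lemma saddle_connection_affine_image: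
  assumes S: "translation_surface S" and f: "affine_automorphism S A f" and "det A \<noteq> 0"
    and \<gamma>: "saddle_connection S \<gamma> v"
  shows "saddle_connection S (\<lambda>s. f (\<gamma> s)) (A *v v)"
  unfolding saddle_connection_def
proof (intro conjI ballI allI impI)
  have hom: "homeomorphic_map (surf_top S) (surf_top S) f" and sing: "f ` sing S = sing S"
    using f by (simp_all add: affine_automorphism_def)
  have path: "pathin (surf_top S) \<gamma>" using \<gamma> by (simp add: saddle_connection_def)
  have "pathin (surf_top S) (f \<circ> \<gamma>)"
    using path hom by (intro pathin_compose) (auto intro: homeomorphic_imp_continuous_map)
  then show "pathin (surf_top S) (\<lambda>s. f (\<gamma> s))" by (simp add: comp_def)
  show "f (\<gamma> 0) \<in> sing S" "f (\<gamma> 1) \<in> sing S"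
    using \<gamma> imageI[of _ "sing S" f] unfolding sing saddle_connection_def by blast+
  have "v \<noteq> 0" using \<gamma> by (simp add: saddle_connection_def)
  with \<open>det A \<noteq> 0\<close> show "A *v v \<noteq> 0"
    by (metis invertible_det_nz matrix_left_invertible_ker invertible_def)
  fix t :: real assume t: "t \<in> {0<..<1}"
  have surf: "\<gamma> s \<in> surface_points S" if "s \<in> {0..1}" for s
    using path that unfolding pathin_def topspace_surf_top[symmetric]
    by (auto simp: continuous_map_def Pi_iff)
  have ns: "\<gamma> t \<notin> sing S" using \<gamma> t by (simp add: saddle_connection_def)
  have inj: "inj_on f (surface_points S)"
    using homeomorphic_imp_injective_map[OF hom] by (simp add: topspace_surf_top)
  have "sing S \<subseteq> surface_points S"
  proof -
    have "vtx ps j \<in> region ps" if "j < length ps" for ps j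
      using that unfolding region_def boundary_def side_def by auto
    then have "vertex_points S \<subseteq> surface_points S"
      by (auto simp: vertex_points_def surface_points_def poly_points_def sides_def)
    then show ?thesis using S by (auto simp: translation_surface_def)
  qed
  then show "f (\<gamma> t) \<notin> sing S"
    using inj_on_image_mem_iff[OF inj, of "\<gamma> t" "sing S"] surf[of t] t ns sing by simp
  fix V \<psi> assume V: "translation_chart S V \<psi> \<and> f (\<gamma> t) \<in> V"
  obtain U \<phi> where U: "translation_chart S U \<phi>" "\<gamma> t \<in> U"
  proof -
    have "\<gamma> t \<in> surface_points S - sing S" using surf[of t] t ns by simp
    moreover have "\<forall>x \<in> surface_points S - sing S. \<exists>U \<phi>. translation_chart S U \<phi> \<and> x \<in> U"
      using S by (simp add: translation_surface_def)
    ultimately show ?thesis using that by blast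
  qed
  have A: "((\<lambda>z. \<psi> (f (inv_into U \<phi> z))) has_derivative (\<lambda>v. A *v v)) (at (\<phi> (\<gamma> t)))"
  proof -
    have "\<forall>U \<phi> V \<psi>. \<forall>x\<in>U. translation_chart S U \<phi> \<and> translation_chart S V \<psi> \<and> f x \<in> V \<longrightarrow>
        ((\<lambda>z. \<psi> (f (inv_into U \<phi> z))) has_derivative (\<lambda>v. A *v v)) (at (\<phi> x))"
      using f unfolding affine_automorphism_def by (elim conjE)
    from this[rule_format, OF U(2)] U V show ?thesis by simp
  qed
  have "((\<lambda>s. \<phi> (\<gamma> s)) has_vector_derivative v) (at t)"
  proof -
    have "\<forall>t\<in>{0<..<1}. \<forall>U \<phi>. translation_chart S U \<phi> \<and> \<gamma> t \<in> U \<longrightarrow>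
        ((\<lambda>s. \<phi> (\<gamma> s)) has_vector_derivative v) (at t)"
      using \<gamma> by (simp add: saddle_connection_def)
    from this[rule_format, OF t] U show ?thesis by simp
  qed
  then have "((\<lambda>s. \<phi> (\<gamma> s)) has_derivative (\<lambda>h. h *\<^sub>R v)) (at t)"
    by (simp add: has_vector_derivative_def)
  from has_derivative_compose[OF this A]
  have D: "((\<lambda>s. \<psi> (f (inv_into U \<phi> (\<phi> (\<gamma> s))))) has_vector_derivative (A *v v)) (at t)"
    by (simp add: has_vector_derivative_def scaleR_matrix_vector_assoc[symmetric]
        matrix_vector_mult_scaleR)
  \<comment> \<open>Near \<open>t\<close> the path stays in \<open>U\<close>, where
    \<open>inv_into U \<phi>\<close> undoes \<open>\<phi>\<close>; the derivative is thus that of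
    the image path itself.\<close>
  have "openin (top_of_set {0..1}) {s \<in> topspace (top_of_set {0..1}). \<gamma> s \<in> U}"
    using path U(1) unfolding pathin_def translation_chart_def
    by (intro openin_continuous_map_preimage) auto
  then obtain T where T: "open T" "{s \<in> {0..1}. \<gamma> s \<in> U} = {0..1} \<inter> T"
    unfolding openin_open by auto
  have "homeomorphic_map (subtopology (surf_top S) U) (top_of_set (\<phi> ` U)) \<phi>"
    and "openin (surf_top S) U"
    using U(1) by (simp_all add: translation_chart_def)
  then have injU: "inj_on \<phi> U"
    using homeomorphic_imp_injective_map openin_subset by (metis topspace_subtopology_subset)
  show "((\<lambda>s. \<psi> (f (\<gamma> s))) has_vector_derivative (A *v v)) (at t)"
  proof (rule has_vector_derivative_transform_within_open[OF D])
    show "open (T \<inter> {0<..<1})" using T(1) by (intro open_Int) simp_all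
    have "t \<in> {s \<in> {0..1}. \<gamma> s \<in> U}" using t U(2) by simp
    then show "t \<in> T \<inter> {0<..<1}" unfolding T(2) using t by simp
    show "\<psi> (f (inv_into U \<phi> (\<phi> (\<gamma> s)))) = \<psi> (f (\<gamma> s))" if "s \<in> T \<inter> {0<..<1}" for s
    proof -
      have "s \<in> {0..1} \<inter> T" using that by simp
      then have "\<gamma> s \<in> U" unfolding T(2)[symmetric] by simp
      with injU show ?thesis by simp
    qed
  qed
qed

lemma holonomies_uminus: "v \<in> holonomies S \<Longrightarrow> - v \<in> holonomies S"
  using saddle_connection_reverse by (auto simp: holonomies_def)

lemma holonomies_veech:
  assumes "translation_surface S" "A \<in> veech_group S \<or> - A \<in> veech_group S" "v \<in> holonomies S"
  shows "A *v v \<in> holonomies S"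
proof -
  have *: "B *v v \<in> holonomies S" if B: "B \<in> veech_group S" for B
  proof -
    obtain f where "affine_automorphism S B f" "det B \<noteq> 0"
      using B by (auto simp: veech_group_def)
    with assms(1,3) show ?thesis
      unfolding holonomies_def using saddle_connection_affine_image by blast
  qed
  have "A *v v = - (- A *v v)"
    by (simp add: vec_eq_iff matrix_vector_mult_def sum_2)
  then show ?thesis using * assms(2) holonomies_uminus by metis
qed

section \<open>The Klein model\<close>

text \<open>The Klein model is the projectivised cone of positive definite symmetric matrices; the
  rank one matrices \<open>v v\<^sup>T\<close> are its boundary. The matrix of a point \<open>z\<close> of the disk is the real part
  of \<open>w w\<^sup>*\<close>, where \<open>w\<close> is the vector with \<open>cayley *v w = (z, 1)\<close>.\<close>

definition sym_prod :: "complex \<Rightarrow> complex \<Rightarrow> real^2^2" where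
  "sym_prod a b = vector [vector [(cmod a)\<^sup>2, Re (a * cnj b)], vector [Re (a * cnj b), (cmod b)\<^sup>2]]"

definition disk_mat :: "complex \<Rightarrow> real^2^2" where
  "disk_mat z = sym_prod ((z + 1) / 2) (\<i> * (z - 1) / 2)"

definition rank_one :: "plane \<Rightarrow> real^2^2" where
  "rank_one v = (\<chi> i j. v$i * v$j)"

text \<open>Two linear coordinates divided by the trace. The minus sign matches the conjugation in
  \<open>line_pt\<close>, so that the matrix of \<open>v\<close> goes to the boundary point of its
  line.\<close>

definition klein_pt :: "real^2^2 \<Rightarrow> complex" where
  "klein_pt Q = Complex ((Q$1$1 - Q$2$2) / (Q$1$1 + Q$2$2)) (- 2 * Q$1$2 / (Q$1$1 + Q$2$2))"

text \<open>The linear form in \<open>Q\<close> that equals \<open>cross p v * cross q v\<close> on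
  the rank one matrix of \<open>v\<close>. It vanishes on the matrices of \<open>p\<close> and
  \<open>q\<close>, so it is an equation of the chord between them.\<close>

definition cross_form :: "plane \<Rightarrow> plane \<Rightarrow> real^2^2 \<Rightarrow> real" where
  "cross_form p q Q = p$1 * q$1 * Q$2$2 - (p$1 * q$2 + p$2 * q$1) * Q$1$2 + p$2 * q$2 * Q$1$1"

lemma cmod_sq: "(cmod z)\<^sup>2 = Re z * Re z + Im z * Im z"
  unfolding cmod_power2 by (simp add: power2_eq_square)

lemma rank_one_nth: "rank_one v $ i $ j = v$i * v$j"
  by (simp add: rank_one_def)

lemma cross_form_rank_one: "cross_form p q (rank_one v) = cross p v * cross q v"
  by (simp add: cross_form_def rank_one_nth cross_def algebra_simps)

lemma cross_form_add: "cross_form p q (Q + Q') = cross_form p q Q + cross_form p q Q'"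
  by (simp add: cross_form_def algebra_simps)

lemma cross_form_scaleR: "cross_form p q (c *\<^sub>R Q) = c * cross_form p q Q"
  by (simp add: cross_form_def algebra_simps)

lemmas cross_form_simps = cross_form_rank_one cross_form_add cross_form_scaleR

lemma rank_one_matrix: "A ** rank_one v ** transpose A = rank_one (A *v v)"
  by (simp add: vec_eq_iff forall_2 rank_one_nth matrix_matrix_mult_def matrix_vector_mult_def
      transpose_def sum_2 algebra_simps)

lemma sym_matrix_add: "A ** (Q + Q') ** B = A ** Q ** B + A ** Q' ** B" for A B :: "real^2^2"
  by (simp add: vec_eq_iff forall_2 matrix_matrix_mult_def sum_2 algebra_simps)

lemma sym_matrix_scaleR: "A ** (c *\<^sub>R Q) ** B = c *\<^sub>R (A ** Q ** B)" for A B :: "real^2^2"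
  by (simp add: vec_eq_iff forall_2 matrix_matrix_mult_def sum_2 algebra_simps)

lemma klein_pt_scaleR: "c \<noteq> 0 \<Longrightarrow> klein_pt (c *\<^sub>R Q) = klein_pt Q"
  by (simp add: klein_pt_def complex_eq_iff flip: distrib_left right_diff_distrib)

lemma trace_rank_one: "v \<noteq> 0 \<Longrightarrow> 0 < rank_one v $ 1 $ 1 + rank_one v $ 2 $ 2"
  by (auto simp: rank_one_nth vec_eq_iff forall_2 sum_squares_gt_zero_iff)

lemma klein_pt_rank_one: "v \<noteq> 0 \<Longrightarrow> klein_pt (rank_one v) = line_pt v"
  by (auto simp: klein_pt_def rank_one_nth line_pt_def to_complex_def complex_eq_iff vec_eq_iff forall_2
      Re_divide Im_divide power2_eq_square field_simps)

text \<open>As \<open>klein_pt\<close> is linear up to division by the trace, sums become averages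
  weighted by the traces. This is how positive combinations of rank one matrices become points of
  convex hulls.\<close>

lemma klein_pt_add:
  assumes "Q$1$1 + Q$2$2 = s" "Q'$1$1 + Q'$2$2 = t" "0 < s" "0 < t"
  shows "klein_pt (Q + Q') = (s / (s + t)) *\<^sub>R klein_pt Q + (t / (s + t)) *\<^sub>R klein_pt Q'"
proof -
  have eq: "(Q + Q')$1$1 + (Q + Q')$2$2 = s + t" using assms by simp
  show ?thesis
    unfolding klein_pt_def eq assms(1,2) using assms(3,4)
    by (simp add: complex_eq_iff, simp add: add_divide_distrib diff_divide_distrib)
qed

lemma klein_pt_convex:
  assumes "convex C" "klein_pt Q \<in> C" "klein_pt Q' \<in> C"
    and "0 < Q$1$1 + Q$2$2" "0 < Q'$1$1 + Q'$2$2"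
  shows "klein_pt (Q + Q') \<in> C"
  unfolding klein_pt_add[OF refl refl assms(4,5)]
  using assms by (intro convexD) (auto simp flip: add_divide_distrib)

lemma klein_pt_open_segment:
  assumes "klein_pt Q \<noteq> klein_pt Q'" "0 < Q$1$1 + Q$2$2" "0 < Q'$1$1 + Q'$2$2"
  shows "klein_pt (Q + Q') \<in> open_segment (klein_pt Q) (klein_pt Q')"
proof -
  let ?a = "Q$1$1 + Q$2$2" and ?b = "Q'$1$1 + Q'$2$2"
  have "?a / (?a + ?b) = 1 - ?b / (?a + ?b)" using assms by (simp add: field_simps)
  then show ?thesis
    unfolding in_segment klein_pt_add[OF refl refl assms(2,3)]
    using assms by (intro conjI exI[of _ "?b / (?a + ?b)"]) simp_all
qed

lemma klein_pt_inj:
  assumes "klein_pt Q = klein_pt Q'" "Q$1$2 = Q$2$1" "Q'$1$2 = Q'$2$1"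
    and "0 < Q$1$1 + Q$2$2" "0 < Q'$1$1 + Q'$2$2"
  shows "Q' = ((Q'$1$1 + Q'$2$2) / (Q$1$1 + Q$2$2)) *\<^sub>R Q"
proof -
  define s t where "s = Q$1$1 + Q$2$2" and "t = Q'$1$1 + Q'$2$2"
  have st: "0 < s" "0 < t" using assms(4,5) by (simp_all add: s_def t_def)
  have 1: "(Q$1$1 - Q$2$2) / s = (Q'$1$1 - Q'$2$2) / t" and 2: "Q$1$2 / s = Q'$1$2 / t"
    using assms(1) by (simp_all add: klein_pt_def s_def t_def)
  have 3: "Q$2$2 = s - Q$1$1" "Q'$2$2 = t - Q'$1$1" by (simp_all add: s_def t_def)
  have "Q'$1$1 = t / s * Q$1$1" using 1 st unfolding 3 by (simp add: field_simps)
  moreover from this have "Q'$2$2 = t / s * Q$2$2" using st unfolding 3 by (simp add: field_simps)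
  moreover have "Q'$1$2 = t / s * Q$1$2" using 2 st by (simp add: field_simps)
  moreover from this have "Q'$2$1 = t / s * Q$2$1" unfolding assms(2,3) .
  ultimately have "Q' = (t / s) *\<^sub>R Q" by (simp add: vec_eq_iff forall_2)
  then show ?thesis unfolding s_def t_def .
qed

lemma sym_prod_matrix:
  "A ** sym_prod a b ** transpose A
    = sym_prod (of_real (A$1$1) * a + of_real (A$1$2) * b) (of_real (A$2$1) * a + of_real (A$2$2) * b)"
  by (simp add: vec_eq_iff forall_2 sym_prod_def matrix_matrix_mult_def transpose_def sum_2
      cmod_sq algebra_simps)

text \<open>The argument of \<open>klein\<close> is the Cayley transform of \<open>a / b\<close>. By
  the parallelogram law the squared moduli of numerator and denominator add up to twice that of
  \<open>(a, b)\<close>, which is the trace on the right.\<close>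

lemma klein_mobius:
  assumes "a + \<i> * b \<noteq> 0"
  shows "klein ((a - \<i> * b) / (a + \<i> * b)) = klein_pt (sym_prod a b)"
proof -
  define N D where "N = a - \<i> * b" and "D = a + \<i> * b"
  have D: "0 < (cmod D)\<^sup>2" using assms by (simp add: D_def)
  have sum: "(cmod D)\<^sup>2 + (cmod N)\<^sup>2 = 2 * ((cmod a)\<^sup>2 + (cmod b)\<^sup>2)"
    by (simp add: N_def D_def cmod_sq algebra_simps)
  have "N / D = (1 / (cmod D)\<^sup>2) *\<^sub>R (N * cnj D)"
    using complex_div_cnj[of N D] by (simp only: scaleR_conv_of_real of_real_divide of_real_power
        of_real_1 times_divide_eq_left mult_1)
  then have "klein (N / D) = (2 / (1 + (cmod (N / D))\<^sup>2)) *\<^sub>R ((1 / (cmod D)\<^sup>2) *\<^sub>R (N * cnj D))"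
    unfolding klein_def by (rule arg_cong)
  also have "\<dots> = (2 / (1 + (cmod N)\<^sup>2 / (cmod D)\<^sup>2) / (cmod D)\<^sup>2) *\<^sub>R (N * cnj D)"
    by (simp add: norm_divide power_divide)
  also have "2 / (1 + (cmod N)\<^sup>2 / (cmod D)\<^sup>2) / (cmod D)\<^sup>2 = 2 / ((cmod D)\<^sup>2 + (cmod N)\<^sup>2)"
  proof -
    have "2 / (1 + n / d) / d = 2 / (d + n)" if "0 < d" for d n :: real
    proof -
      have "1 + n / d = (d + n) / d" using that by (simp add: add_divide_distrib)
      then show ?thesis using that by simp
    qed
    from this[OF D] show ?thesis .
  qed
  also have "\<dots> = 1 / ((cmod a)\<^sup>2 + (cmod b)\<^sup>2)"
  proof -
    have "2 / (2 * x) = 1 / x" for x :: real by simp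
    then show ?thesis unfolding sum .
  qed
  also have "(1 / ((cmod a)\<^sup>2 + (cmod b)\<^sup>2)) *\<^sub>R (N * cnj D) = klein_pt (sym_prod a b)"
  proof -
    have "Re (N * cnj D) = (cmod a)\<^sup>2 - (cmod b)\<^sup>2" "Im (N * cnj D) = - 2 * Re (a * cnj b)"
      by (simp_all add: N_def D_def cmod_sq algebra_simps)
    then show ?thesis
      by (simp add: complex_eq_iff klein_pt_def sym_prod_def del: times_complex.sel)
  qed
  finally show ?thesis by (simp add: N_def D_def)
qed

text \<open>This makes the disk action linear: a Moebius map becomes a congruence of symmetric
  matrices.\<close>

lemma disk_act_disk_mat:
  assumes "z \<in> ball 0 1" "det A = 1"
  shows "disk_act A z \<in> ball 0 1"
    and "klein (disk_act A z) = klein_pt (A ** disk_mat z ** transpose A)"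
    and "0 < (A ** disk_mat z ** transpose A)$1$1 + (A ** disk_mat z ** transpose A)$2$2"
proof -
  define a0 b0 where "a0 = (z + 1) / 2" and "b0 = \<i> * (z - 1) / 2"
  define a b where "a = of_real (A$1$1) * a0 + of_real (A$1$2) * b0"
    and "b = of_real (A$2$1) * a0 + of_real (A$2$2) * b0"
  have act: "disk_act A z = (a - \<i> * b) / (a + \<i> * b)"
  proof -
    define M where "M = cayley ** complex_mat A ** matrix_inv cayley"
    have "M$1$1 * z + M$1$2 = a - \<i> * b" "M$2$1 * z + M$2$2 = a + \<i> * b"
      unfolding M_def inv_cayley a_def b_def a0_def b0_def
      by (simp_all add: cayley_def complex_mat_def matrix_matrix_mult_def sum_2 complex_eq_iff field_simps)
    then show ?thesis by (simp add: disk_act_def mobius_def M_def)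
  qed
  \<comment> \<open>\<open>Im (a * cnj b)\<close> is an area form, hence multiplied by
    \<open>det A = 1\<close>. Evaluating it before the action gives
    \<open>1 - (cmod z)\<^sup>2 > 0\<close>, so the denominator is nonzero and dominates the
    numerator.\<close>
  have "(cmod (a + \<i> * b))\<^sup>2 - (cmod (a - \<i> * b))\<^sup>2 = 4 * Im (a * cnj b)"
    by (simp add: cmod_sq algebra_simps)
  also have "Im (a * cnj b) = det A * Im (a0 * cnj b0)"
    by (simp add: a_def b_def det_2 algebra_simps)
  also have "4 * (det A * Im (a0 * cnj b0)) = 1 - (cmod z)\<^sup>2"
    unfolding assms(2) a0_def b0_def by (simp add: cmod_sq field_simps)
  finally have eq: "(cmod (a + \<i> * b))\<^sup>2 - (cmod (a - \<i> * b))\<^sup>2 = 1 - (cmod z)\<^sup>2" .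
  have "(cmod z)\<^sup>2 < 1" using assms(1) by (simp add: abs_square_less_1)
  with eq have lt: "(cmod (a - \<i> * b))\<^sup>2 < (cmod (a + \<i> * b))\<^sup>2" by linarith
  then have nz: "a + \<i> * b \<noteq> 0" by auto
  have "cmod (a - \<i> * b) < cmod (a + \<i> * b)" using lt by (simp add: power2_less_imp_less)
  then show "disk_act A z \<in> ball 0 1"
    using nz by (simp add: act norm_divide)
  show "klein (disk_act A z) = klein_pt (A ** disk_mat z ** transpose A)"
    unfolding act klein_mobius[OF nz] disk_mat_def sym_prod_matrix
    by (simp add: a_def b_def a0_def b0_def)
  have "A ** disk_mat z ** transpose A = sym_prod a b"
    unfolding disk_mat_def sym_prod_matrix by (simp add: a_def b_def a0_def b0_def)
  moreover have "a \<noteq> 0 \<or> b \<noteq> 0" using nz by auto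
  ultimately show "0 < (A ** disk_mat z ** transpose A)$1$1 + (A ** disk_mat z ** transpose A)$2$2"
    by (simp add: sym_prod_def sum_power2_gt_zero_iff)
qed

lemma disk_mat_trace: "0 < disk_mat z $ 1 $ 1 + disk_mat z $ 2 $ 2"
proof -
  have "disk_mat z $ 1 $ 1 + disk_mat z $ 2 $ 2 = (1 + (cmod z)\<^sup>2) / 2"
    by (simp add: disk_mat_def sym_prod_def cmod_sq field_simps)
  also have "\<dots> > 0" by (simp add: add_pos_nonneg)
  finally show ?thesis .
qed

lemma disk_mat_sym: "disk_mat z $ 1 $ 2 = disk_mat z $ 2 $ 1"
  by (simp add: disk_mat_def sym_prod_def)

lemma klein_disk_mat: "klein z = klein_pt (disk_mat z)"
proof -
  have eq: "(z + 1) / 2 + \<i> * (\<i> * (z - 1) / 2) = 1" "(z + 1) / 2 - \<i> * (\<i> * (z - 1) / 2) = z"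
    by (simp_all add: complex_eq_iff field_simps)
  show ?thesis
    using klein_mobius[of "(z + 1) / 2" "\<i> * (z - 1) / 2"] unfolding eq disk_mat_def by simp
qed

lemma klein_surj:
  assumes "cmod k < 1"
  obtains z where "z \<in> ball 0 1" "klein z = k"
proof -
  \<comment> \<open>For \<open>m\<close> with \<open>m\<^sup>2 = 1 - (cmod k)\<^sup>2\<close>, the
    equation \<open>klein z = k\<close> is solved by \<open>z = k / (1 + m)\<close>.\<close>
  define m where "m = sqrt (1 - (cmod k)\<^sup>2)"
  have "(cmod k)\<^sup>2 < 1" using assms by (simp add: abs_square_less_1)
  then have m: "0 < m" "m\<^sup>2 = 1 - (cmod k)\<^sup>2" by (simp_all add: m_def)
  let ?z = "(1 / (1 + m)) *\<^sub>R k"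
  have n: "cmod ?z = cmod k / (1 + m)" using m by simp
  have "1 + (cmod ?z)\<^sup>2 = ((1 + m)\<^sup>2 + (cmod k)\<^sup>2) / (1 + m)\<^sup>2"
    unfolding n using m by (simp add: power_divide field_simps)
  also have "(1 + m)\<^sup>2 + (cmod k)\<^sup>2 = 2 * (1 + m)"
    using m by (simp add: power2_eq_square algebra_simps)
  also have "2 * (1 + m) / (1 + m)\<^sup>2 = 2 / (1 + m)"
  proof -
    have "2 * n / n\<^sup>2 = 2 / n" if "0 < n" for n :: real
      using that by (simp add: power2_eq_square)
    from this[of "1 + m"] m(1) show ?thesis by simp
  qed
  finally have "klein ?z = k" using m by (simp add: klein_def)
  moreover have "?z \<in> ball 0 1"
    using assms m by (simp add: n pos_divide_less_eq)
  ultimately show ?thesis using that by blast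
qed

text \<open>The squared trace times \<open>1 - (cmod (klein_pt Q))\<^sup>2\<close> is four times the
  determinant, so a positive determinant places \<open>klein_pt Q\<close> inside the disk.\<close>

lemma positive_definite_disk_mat:
  assumes "Q$1$2 = Q$2$1" "0 < Q$1$1 + Q$2$2" "(Q$1$2)\<^sup>2 < Q$1$1 * Q$2$2"
  obtains z c where "z \<in> ball 0 1" "0 < c" "klein z = klein_pt Q" "disk_mat z = c *\<^sub>R Q"
proof -
  define s where "s = Q$1$1 + Q$2$2"
  have "(cmod (klein_pt Q))\<^sup>2 = ((Q$1$1 - Q$2$2)\<^sup>2 + 4 * (Q$1$2)\<^sup>2) / s\<^sup>2"
    using assms(2) by (simp add: cmod_power2 klein_pt_def s_def power_divide power_mult_distrib
        add_divide_distrib)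
  also have "\<dots> < 1"
  proof -
    have "(Q$1$1 - Q$2$2)\<^sup>2 + 4 * (Q$1$2)\<^sup>2 < s\<^sup>2"
      using assms(3) by (simp add: s_def power2_eq_square algebra_simps)
    moreover have "0 < s\<^sup>2" using assms(2) by (simp add: s_def)
    ultimately show ?thesis by simp
  qed
  finally have "cmod (klein_pt Q) < 1" by (simp add: abs_square_less_1)
  then obtain z where z: "z \<in> ball 0 1" "klein z = klein_pt Q" using klein_surj by blast
  have "disk_mat z = ((disk_mat z$1$1 + disk_mat z$2$2) / (Q$1$1 + Q$2$2)) *\<^sub>R Q"
    using z(2) by (intro klein_pt_inj) (simp_all add: assms disk_mat_sym disk_mat_trace klein_disk_mat)
  with z show ?thesis
    using that[of z "(disk_mat z$1$1 + disk_mat z$2$2) / (Q$1$1 + Q$2$2)"] disk_mat_trace[of z] assms(2)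
    by simp
qed

lemma disk_mat_disk_act:
  assumes "z \<in> ball 0 1" "det A = 1"
  obtains c where "0 < c" "disk_mat (disk_act A z) = c *\<^sub>R (A ** disk_mat z ** transpose A)"
proof -
  let ?Q = "A ** disk_mat z ** transpose A"
  have "?Q$1$2 = ?Q$2$1"
    unfolding disk_mat_def sym_prod_matrix by (simp add: sym_prod_def)
  with disk_act_disk_mat[OF assms]
  have "disk_mat (disk_act A z)
      = ((disk_mat (disk_act A z)$1$1 + disk_mat (disk_act A z)$2$2) / (?Q$1$1 + ?Q$2$2)) *\<^sub>R ?Q"
    by (intro klein_pt_inj) (simp_all add: disk_mat_sym disk_mat_trace flip: klein_disk_mat)
  then show ?thesis
    using that disk_mat_trace disk_act_disk_mat(3)[OF assms] by (meson divide_pos_pos)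
qed

lemma positive_definite_rank_one_sum:
  assumes "0 < s" "0 < t" "0 \<le> c" "cross p q \<noteq> 0"
    and Q: "Q = s *\<^sub>R rank_one p + t *\<^sub>R rank_one q + c *\<^sub>R rank_one x"
  obtains z k where "z \<in> ball 0 1" "0 < k" "klein z = klein_pt Q" "disk_mat z = k *\<^sub>R Q"
proof (rule positive_definite_disk_mat)
  show "Q$1$2 = Q$2$1" by (simp add: Q rank_one_nth)
  have "p \<noteq> 0" using assms(4) by (auto simp: cross_def)
  then have "0 < s * (rank_one p$1$1 + rank_one p$2$2)"
    using trace_rank_one assms(1) by simp
  moreover have "0 \<le> t * (rank_one q$1$1 + rank_one q$2$2)" "0 \<le> c * (rank_one x$1$1 + rank_one x$2$2)"
    using assms(2,3) by (simp_all add: rank_one_nth)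
  ultimately show "0 < Q$1$1 + Q$2$2" unfolding Q by (simp add: algebra_simps)
  \<comment> \<open>Cauchy-Binet: the determinant of a sum of rank one matrices is a sum over pairs
    of squared areas.\<close>
  have "Q$1$1 * Q$2$2 - (Q$1$2)\<^sup>2 = s * t * (cross p q)\<^sup>2 + s * c * (cross p x)\<^sup>2 + t * c * (cross q x)\<^sup>2"
    unfolding Q by (simp add: rank_one_nth cross_def power2_eq_square algebra_simps)
  moreover have "0 < s * t * (cross p q)\<^sup>2" using assms by simp
  moreover have "0 \<le> s * c * (cross p x)\<^sup>2" "0 \<le> t * c * (cross q x)\<^sup>2" using assms by simp_all
  ultimately show "(Q$1$2)\<^sup>2 < Q$1$1 * Q$2$2" by linarith
qed (use that in blast)

lemma cross_form_geodesic:
  assumes z: "z \<in> geodesic (line_pt p) (line_pt q)" and "p \<noteq> 0" "q \<noteq> 0"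
  shows "cross_form p q (disk_mat z) = 0"
proof -
  obtain u where u: "0 < u" "u < 1" "klein z = (1 - u) *\<^sub>R line_pt p + u *\<^sub>R line_pt q"
    using z by (auto simp: geodesic_def in_segment)
  let ?tp = "rank_one p$1$1 + rank_one p$2$2" and ?tq = "rank_one q$1$1 + rank_one q$2$2"
  have pos: "0 < ?tp" "0 < ?tq" using assms trace_rank_one by blast+
  \<comment> \<open>Division by the traces turns the weights in \<open>klein_pt_add\<close> into
    exactly \<open>1 - u\<close> and \<open>u\<close>.\<close>
  define P where "P = ((1 - u) / ?tp) *\<^sub>R rank_one p"
  define Q where "Q = (u / ?tq) *\<^sub>R rank_one q"
  have tr: "P$1$1 + P$2$2 = 1 - u" "Q$1$1 + Q$2$2 = u"
    using pos unfolding P_def Q_def by (simp_all flip: distrib_left add_divide_distrib)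
  have "klein_pt P = line_pt p" "klein_pt Q = line_pt q"
    using pos u assms by (simp_all add: P_def Q_def klein_pt_scaleR klein_pt_rank_one)
  then have "klein_pt (disk_mat z) = klein_pt (P + Q)"
    using klein_pt_add[OF tr] u by (simp flip: klein_disk_mat)
  note kz = this
  have "disk_mat z = ((disk_mat z$1$1 + disk_mat z$2$2) / ((P + Q)$1$1 + (P + Q)$2$2)) *\<^sub>R (P + Q)"
  proof (rule klein_pt_inj)
    show "(P + Q)$1$2 = (P + Q)$2$1" by (simp add: P_def Q_def rank_one_nth mult.commute)
    have "(P + Q)$1$1 + (P + Q)$2$2 = 1" using tr by simp
    then show "0 < (P + Q)$1$1 + (P + Q)$2$2" by simp
  qed (simp_all add: disk_mat_sym disk_mat_trace kz)
  moreover have "cross_form p q (P + Q) = 0"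
    by (simp add: P_def Q_def cross_form_simps cross_self)
  ultimately show ?thesis by (metis cross_form_scaleR mult_zero_right)
qed

section \<open>Matrices acting on geodesics and ideal polygons\<close>

lemma rank_one_sum_geodesic:
  assumes "0 < s" "0 < t" "cross p q \<noteq> 0"
  obtains z k where "z \<in> geodesic (line_pt p) (line_pt q)" "0 < k"
    "disk_mat z = k *\<^sub>R (s *\<^sub>R rank_one p + t *\<^sub>R rank_one q)"
proof -
  let ?Q = "s *\<^sub>R rank_one p + t *\<^sub>R rank_one q"
  obtain z k where z: "z \<in> ball 0 1" "0 < k" "klein z = klein_pt ?Q" "disk_mat z = k *\<^sub>R ?Q"
    using positive_definite_rank_one_sum[OF assms(1,2) order_refl assms(3), of ?Q p] by auto
  have nz: "p \<noteq> 0" "q \<noteq> 0" using assms(3) by (auto simp: cross_def)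
  have "line_pt p \<noteq> line_pt q"
    using line_pt_eq_iff nz assms(3) by simp
  moreover have "0 < s * (rank_one p$1$1 + rank_one p$2$2)" "0 < t * (rank_one q$1$1 + rank_one q$2$2)"
    using nz assms trace_rank_one by simp_all
  ultimately have "klein z \<in> open_segment (line_pt p) (line_pt q)"
    using klein_pt_open_segment[of "s *\<^sub>R rank_one p" "t *\<^sub>R rank_one q"] nz assms
    by (simp add: z(3) klein_pt_scaleR klein_pt_rank_one distrib_left)
  with z(1) have "z \<in> geodesic (line_pt p) (line_pt q)" by (simp add: geodesic_def)
  with z(2,4) that show ?thesis by blast
qed

text \<open>A geodesic excludes its endpoints, so their images have to be recovered from interior
  points: the chord equation evaluated on the images is linear in the weights of \<open>p\<close>
  and \<open>q\<close>. Each image endpoint is then parallel to \<open>p'\<close> or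
  \<open>q'\<close>, without saying which.\<close>

lemma geodesic_map_endpoints:
  assumes "disk_act A ` geodesic (line_pt p) (line_pt q) = geodesic (line_pt p') (line_pt q')"
    and "det A = 1" "cross p q \<noteq> 0" "p' \<noteq> 0" "q' \<noteq> 0"
  shows "cross p' (A *v p) * cross q' (A *v p) = 0" "cross p' (A *v q) * cross q' (A *v q) = 0"
proof -
  let ?a = "cross p' (A *v p) * cross q' (A *v p)" and ?b = "cross p' (A *v q) * cross q' (A *v q)"
  have eq: "s * ?a + t * ?b = 0" if "0 < s" "0 < t" for s t
  proof -
    obtain z k where z: "z \<in> geodesic (line_pt p) (line_pt q)" "0 < k"
      "disk_mat z = k *\<^sub>R (s *\<^sub>R rank_one p + t *\<^sub>R rank_one q)"
      using rank_one_sum_geodesic[OF \<open>0 < s\<close> \<open>0 < t\<close> assms(3)] by blast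
    then obtain c where c: "0 < c" "disk_mat (disk_act A z) = c *\<^sub>R (A ** disk_mat z ** transpose A)"
      using disk_mat_disk_act[OF _ assms(2)] unfolding geodesic_def by blast
    have "disk_act A z \<in> geodesic (line_pt p') (line_pt q')" using z(1) assms(1) by blast
    from cross_form_geodesic[OF this assms(4,5)]
    have "c * (k * (s * ?a + t * ?b)) = 0"
      by (simp add: c z(3) sym_matrix_scaleR sym_matrix_add rank_one_matrix cross_form_simps)
    with c(1) z(2) show ?thesis by simp
  qed
  from eq[of 1 1] eq[of 1 2] show "?a = 0" "?b = 0" by linarith+
qed

text \<open>Two triangles in the Klein model with a common side, lying on the same side of it, overlap.\<close>

lemma triangles_overlap:
  assumes pq: "cross p q \<noteq> 0" and x: "cross p x * cross x q < 0" and y: "cross p y * cross y q < 0"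
  obtains s t c s' t' c' where "0 < s" "0 < t" "0 < c" "0 < s'" "0 < t'" "0 < c'"
    "s *\<^sub>R rank_one p + t *\<^sub>R rank_one q + c *\<^sub>R rank_one x
      = s' *\<^sub>R rank_one p + t' *\<^sub>R rank_one q + c' *\<^sub>R rank_one y"
proof -
  \<comment> \<open>By Cramer's rule \<open>v\<close> is a combination of \<open>p\<close> and
    \<open>q\<close>, so its matrix combines those of \<open>p\<close> and \<open>q\<close> and the
    mixed term \<open>S\<close>. The factor \<open>c v\<close> makes the coefficient of
    \<open>S\<close> equal to -1; the sign hypothesis is what makes \<open>c v\<close>
    positive.\<close>
  define \<rho> \<sigma> where "\<rho> v = - (cross v q / cross p v)" and "\<sigma> v = - (cross p v / cross v q)" for v
  define c where "c v = - ((cross p q)\<^sup>2 / (cross v q * cross p v))" for v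
  define S :: "real^2^2" where "S = (\<chi> i j. p$i * q$j + q$i * p$j)"
  have key: "0 < \<rho> v \<and> 0 < \<sigma> v \<and> 0 < c v \<and> c v *\<^sub>R rank_one v = \<rho> v *\<^sub>R rank_one p + \<sigma> v *\<^sub>R rank_one q - S"
    if "cross p v * cross v q < 0" for v
  proof -
    define a b d where "a = cross v q" and "b = cross p v" and "d = cross p q"
    have "a * b < 0" using that by (simp add: a_def b_def mult.commute)
    then have nz: "a \<noteq> 0" "b \<noteq> 0" "a < 0 \<and> 0 < b \<or> 0 < a \<and> b < 0"
      by (auto simp: mult_less_0_iff)
    have vi: "d * v$i = a * p$i + b * q$i" for i
      using arg_cong[OF cross_cramer[of p q v], of "\<lambda>v. v$i"] by (simp add: a_def b_def d_def)
    have "c v * (v$i * v$j) = \<rho> v * (p$i * p$j) + \<sigma> v * (q$i * q$j) - (p$i * q$j + q$i * p$j)" for i j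
    proof -
      have "c v * (v$i * v$j) = - ((d * v$i) * (d * v$j)) / (a * b)"
        by (simp add: c_def a_def b_def d_def power2_eq_square)
      also have "\<dots> = - (a / b) * (p$i * p$j) + - (b / a) * (q$i * q$j) - (p$i * q$j + q$i * p$j)"
        unfolding vi using nz(1,2) by (simp add: field_simps)
      finally show ?thesis by (simp add: \<rho>_def \<sigma>_def a_def b_def)
    qed
    then have "c v *\<^sub>R rank_one v = \<rho> v *\<^sub>R rank_one p + \<sigma> v *\<^sub>R rank_one q - S"
      by (simp add: vec_eq_iff rank_one_nth S_def)
    moreover have "0 < \<rho> v" "0 < \<sigma> v"
      using nz(3) by (auto simp: \<rho>_def \<sigma>_def simp flip: a_def b_def intro: divide_neg_pos divide_pos_neg)
    moreover have "0 < c v"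
      using \<open>a * b < 0\<close> pq unfolding c_def a_def b_def by (simp add: divide_pos_neg)
    ultimately show ?thesis by blast
  qed
  \<comment> \<open>Any \<open>M\<close> exceeding all four coefficients works: both combinations
    equal \<open>M\<close> times the matrices of \<open>p\<close> and \<open>q\<close> minus
    \<open>S\<close>.\<close>
  define M where "M = 1 + \<rho> x + \<sigma> x + \<rho> y + \<sigma> y"
  note kx = key[OF x] and ky = key[OF y]
  have "(M - \<rho> v) *\<^sub>R rank_one p + (M - \<sigma> v) *\<^sub>R rank_one q + c v *\<^sub>R rank_one v
      = M *\<^sub>R rank_one p + M *\<^sub>R rank_one q - S" if "cross p v * cross v q < 0" for v
    using key[OF that] by (simp add: algebra_simps)
  from this[OF x] this[OF y] show ?thesis
    using kx ky by (intro that[of "M - \<rho> x" "M - \<sigma> x" "c x" "M - \<rho> y" "M - \<sigma> y" "c y"])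
      (simp_all add: M_def)
qed

lemma klein_pt_hull:
  assumes "line_pt p \<in> V" "line_pt q \<in> V" "line_pt x \<in> V" "0 < s" "0 < t" "0 < c"
    and "p \<noteq> 0" "q \<noteq> 0" "x \<noteq> 0"
  shows "klein_pt (s *\<^sub>R rank_one p + t *\<^sub>R rank_one q + c *\<^sub>R rank_one x) \<in> convex hull V"
proof -
  have pos: "0 < (r *\<^sub>R rank_one v)$1$1 + (r *\<^sub>R rank_one v)$2$2" if "0 < r" "v \<noteq> 0" for r v
    using that trace_rank_one[of v] by (simp flip: distrib_left)
  have pt: "klein_pt (r *\<^sub>R rank_one v) \<in> convex hull V" if "0 < r" "v \<noteq> 0" "line_pt v \<in> V" for r v
    using that by (simp add: klein_pt_scaleR klein_pt_rank_one hull_inc)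
  have "0 < (s *\<^sub>R rank_one p + t *\<^sub>R rank_one q)$1$1 + (s *\<^sub>R rank_one p + t *\<^sub>R rank_one q)$2$2"
    using pos[of s p] pos[of t q] assms by simp
  then show ?thesis
    using assms by (intro klein_pt_convex convex_convex_hull pt pos)
qed

text \<open>With \<open>0 < \<kappa> * \<mu>\<close>, \<open>A\<close> keeps the sign that tells on
  which side of the chord a vertex lies. The image of the triangle over \<open>p', q', x'\<close> is
  then on the same side as the triangle over \<open>p, q, x\<close>, and the two share a point off
  the chord.\<close>

lemma ideal_polygon_overlap:
  assumes V: "line_pt p \<in> V" "line_pt q \<in> V" "line_pt x \<in> V"
      "line_pt p' \<in> V" "line_pt q' \<in> V" "line_pt x' \<in> V"
    and pq: "cross p q \<noteq> 0" "cross p x * cross x q < 0" "cross p' x' * cross x' q' < 0"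
    and A: "det A = 1" "A *v p' = \<kappa> *\<^sub>R p" "A *v q' = \<mu> *\<^sub>R q" "0 < \<kappa> * \<mu>"
  shows "\<not> disk_act A ` ideal_polygon V \<inter> ideal_polygon V \<subseteq> geodesic (line_pt p) (line_pt q)"
proof
  assume sub: "disk_act A ` ideal_polygon V \<inter> ideal_polygon V \<subseteq> geodesic (line_pt p) (line_pt q)"
  have lm: "\<kappa> \<noteq> 0" "\<mu> \<noteq> 0" using A(4) by auto
  have nz: "p \<noteq> 0" "q \<noteq> 0" "x \<noteq> 0" "p' \<noteq> 0" "q' \<noteq> 0" "x' \<noteq> 0"
    using pq by (auto simp: cross_def)
  have "cross p' q' = \<kappa> * \<mu> * cross p q"
    using cross_matrix[of A p' q'] A(1) by (simp add: A(2,3) cross_simps mult_ac)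
  then have pq': "cross p' q' \<noteq> 0" using pq(1) lm by simp
  have "\<kappa> * cross p (A *v x') = cross p' x'" "\<mu> * cross (A *v x') q = cross x' q'"
    using cross_matrix[of A p' x'] cross_matrix[of A x' q'] A(1) by (simp_all add: A(2,3) cross_simps)
  then have "(\<kappa> * cross p (A *v x')) * (\<mu> * cross (A *v x') q) < 0"
    using pq(3) by simp
  then have "(\<kappa> * \<mu>) * (cross p (A *v x') * cross (A *v x') q) < 0"
    by (simp only: mult_ac)
  then have "cross p (A *v x') * cross (A *v x') q < 0"
    using mult_less_cancel_left_pos[OF A(4), of _ 0] by simp
  from triangles_overlap[OF pq(1,2) this] obtain s t c s' t' c' where
    pos: "0 < s" "0 < t" "0 < c" "0 < s'" "0 < t'" "0 < c'" and
    eq: "s *\<^sub>R rank_one p + t *\<^sub>R rank_one q + c *\<^sub>R rank_one x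
      = s' *\<^sub>R rank_one p + t' *\<^sub>R rank_one q + c' *\<^sub>R rank_one (A *v x')" by blast
  define Q where "Q = s *\<^sub>R rank_one p + t *\<^sub>R rank_one q + c *\<^sub>R rank_one x"
  \<comment> \<open>The preimage of \<open>Q\<close> under the congruence; rank one matrices scale
    quadratically, hence the squares.\<close>
  define Q' where "Q' = (s' / \<kappa>\<^sup>2) *\<^sub>R rank_one p' + (t' / \<mu>\<^sup>2) *\<^sub>R rank_one q' + c' *\<^sub>R rank_one x'"
  have pos': "0 < s' / \<kappa>\<^sup>2" "0 < t' / \<mu>\<^sup>2" using pos lm by simp_all
  have r: "rank_one (k *\<^sub>R v) = k\<^sup>2 *\<^sub>R rank_one v" for k v
    by (simp add: vec_eq_iff rank_one_nth power2_eq_square)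
  have AQ: "A ** Q' ** transpose A = Q"
    unfolding Q_def Q'_def eq using lm
    by (simp add: sym_matrix_add sym_matrix_scaleR rank_one_matrix A(2,3) r)
  obtain z k where z: "z \<in> ball 0 1" "0 < k" "klein z = klein_pt Q'" "disk_mat z = k *\<^sub>R Q'"
    using positive_definite_rank_one_sum[OF pos' less_imp_le[OF pos(6)] pq' Q'_def] by blast
  have "klein_pt Q' \<in> convex hull V"
    unfolding Q'_def using klein_pt_hull V pos' pos nz by simp
  with z have zD: "z \<in> ideal_polygon V" by (simp add: ideal_polygon_def)
  have "klein (disk_act A z) = klein_pt Q"
    using disk_act_disk_mat(2)[OF z(1) A(1)] z(2,4) by (simp add: sym_matrix_scaleR AQ klein_pt_scaleR)
  moreover have "klein_pt Q \<in> convex hull V"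
    unfolding Q_def using klein_pt_hull V pos nz by simp
  ultimately have "disk_act A z \<in> ideal_polygon V"
    using disk_act_disk_mat(1)[OF z(1) A(1)] by (simp add: ideal_polygon_def)
  with zD sub have "disk_act A z \<in> geodesic (line_pt p) (line_pt q)" by blast
  then have 0: "cross_form p q (disk_mat (disk_act A z)) = 0"
    using nz by (intro cross_form_geodesic)
  obtain k' where "0 < k'" "disk_mat (disk_act A z) = k' *\<^sub>R (A ** disk_mat z ** transpose A)"
    using disk_mat_disk_act[OF z(1) A(1)] by blast
  with 0 z(2) have "cross_form p q Q = 0"
    by (simp add: z(4) sym_matrix_scaleR AQ cross_form_scaleR)
  \<comment> \<open>Only the term of \<open>x\<close> survives, and it is nonzero: the common point
    is off the chord.\<close>
  moreover have "cross_form p q Q = - (c * (cross p x * cross x q))"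
    unfolding Q_def by (simp add: cross_form_simps cross_self cross_commute[of q x])
  ultimately show False using pos(3) pq(2) by auto
qed

section \<open>Discrete subgroups of SL(2,R) and parabolic elements\<close>

text \<open>The adjugate, which inverts matrices of determinant 1. Its entries are linear in those
  of \<open>A\<close>, so it passes to limits entrywise.\<close>

definition adj2 :: "real^2^2 \<Rightarrow> real^2^2" where
  "adj2 A = vector [vector [A$2$2, - A$1$2], vector [- A$2$1, A$1$1]]"

lemma adj2_mult:
  assumes "det A = 1"
  shows "adj2 A ** A = mat 1" "A ** adj2 A = mat 1" "det (adj2 A) = 1"
  using assms
  by (simp_all add: adj2_def vec_eq_iff forall_2 matrix_matrix_mult_def mat_def sum_2 det_2 algebra_simps)

lemma SL2_simps:
  "A \<in> carrier SL2 \<longleftrightarrow> det A = 1" "A \<otimes>\<^bsub>SL2\<^esub> B = A ** B" "\<one>\<^bsub>SL2\<^esub> = mat 1"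
  by (simp_all add: SL2_def)

lemma group_SL2: "group SL2"
proof (rule groupI)
  fix A assume "A \<in> carrier SL2"
  then show "\<exists>B\<in>carrier SL2. B \<otimes>\<^bsub>SL2\<^esub> A = \<one>\<^bsub>SL2\<^esub>"
    using adj2_mult[of A] by (auto simp: SL2_simps)
qed (auto simp: SL2_simps det_mul matrix_mul_assoc)

lemma inv_SL2: "det A = 1 \<Longrightarrow> inv\<^bsub>SL2\<^esub> A = adj2 A"
  using group.inv_equality[OF group_SL2, of "adj2 A" A] adj2_mult[of A] by (simp add: SL2_simps)

lemma subgroup_SL2:
  assumes "subgroup L SL2"
  shows "A \<in> L \<Longrightarrow> det A = 1" "A \<in> L \<Longrightarrow> B \<in> L \<Longrightarrow> A ** B \<in> L" "A \<in> L \<Longrightarrow> adj2 A \<in> L" "mat 1 \<in> L"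
proof -
  show det: "det A = 1" if "A \<in> L" for A
    using subgroup.mem_carrier[OF assms that] by (simp add: SL2_simps)
  show "A \<in> L \<Longrightarrow> B \<in> L \<Longrightarrow> A ** B \<in> L"
    using subgroup.m_closed[OF assms] by (simp add: SL2_simps)
  show "A \<in> L \<Longrightarrow> adj2 A \<in> L"
    using subgroup.m_inv_closed[OF assms] det by (metis inv_SL2)
  show "mat 1 \<in> L" using subgroup.one_closed[OF assms] by (simp add: SL2_simps)
qed

lemma matrix_minus_mult: "(- A) ** B = - (A ** B)" "A ** (- B) = - (A ** B)" for A B :: "real^2^2"
  by (simp_all add: vec_eq_iff matrix_matrix_mult_def sum_2)

lemma adj2_minus: "adj2 (- A) = - adj2 A"
  by (simp add: adj2_def vec_eq_iff forall_2)

text \<open>Elements of \<open>\<Gamma>\<close> are classes \<open>{A, - A}\<close>, and a chosen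
  representative lies in the Veech group only up to sign.\<close>

definition up_to_sign :: "(real^2^2) set \<Rightarrow> (real^2^2) set" where
  "up_to_sign L = {A. A \<in> L \<or> - A \<in> L}"

text \<open>In squares and conjugates the sign cancels, so these land in \<open>L\<close>
  itself.\<close>

lemma up_to_sign:
  assumes "subgroup L SL2"
  shows "A \<in> up_to_sign L \<Longrightarrow> det A = 1"
    and "A \<in> up_to_sign L \<Longrightarrow> B \<in> up_to_sign L \<Longrightarrow> A ** B \<in> up_to_sign L"
    and "A \<in> up_to_sign L \<Longrightarrow> A ** A \<in> L"
    and "A \<in> up_to_sign L \<Longrightarrow> adj2 A \<in> up_to_sign L"
    and "mat 1 \<in> up_to_sign L"
    and "A \<in> up_to_sign L \<Longrightarrow> B \<in> L \<Longrightarrow> A ** B ** adj2 A \<in> L"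
proof -
  note L = subgroup_SL2[OF assms]
  have "det (- A) = det A" for A :: "real^2^2" by (simp add: det_2)
  then show "A \<in> up_to_sign L \<Longrightarrow> det A = 1"
    using L(1)[of A] L(1)[of "- A"] by (auto simp: up_to_sign_def)
  show "A \<in> up_to_sign L \<Longrightarrow> B \<in> up_to_sign L \<Longrightarrow> A ** B \<in> up_to_sign L"
    using L(2)[of A B] L(2)[of "- A" B] L(2)[of A "- B"] L(2)[of "- A" "- B"]
    by (auto simp: up_to_sign_def matrix_minus_mult)
  show "A \<in> up_to_sign L \<Longrightarrow> A ** A \<in> L"
    using L(2)[of A A] L(2)[of "- A" "- A"] by (auto simp: up_to_sign_def matrix_minus_mult)
  show "A \<in> up_to_sign L \<Longrightarrow> adj2 A \<in> up_to_sign L"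
    using L(3)[of A] L(3)[of "- A"] by (auto simp: up_to_sign_def adj2_minus)
  show "mat 1 \<in> up_to_sign L" using L(4) by (simp add: up_to_sign_def)
  show "A ** B ** adj2 A \<in> L" if "A \<in> up_to_sign L" "B \<in> L"
  proof (cases "A \<in> L")
    case True
    with that L(2,3) show ?thesis by blast
  next
    case False
    with that have "- A \<in> L" by (simp add: up_to_sign_def)
    then have "- A ** B ** adj2 (- A) \<in> L" using that L(2,3) by blast
    then show ?thesis by (simp add: matrix_minus_mult adj2_minus)
  qed
qed

lemma psl_mult: "psl A <#>\<^bsub>SL2\<^esub> psl B = psl (A ** B)"
  by (auto simp: psl_eq set_mult_def SL2_simps matrix_minus_mult)

lemma psl_subgroup:
  assumes "subgroup \<Gamma> (projective_veech_group S)"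
  shows "psl A \<in> \<Gamma> \<Longrightarrow> A \<in> up_to_sign (veech_group S)"
    and "psl A \<in> \<Gamma> \<Longrightarrow> psl B \<in> \<Gamma> \<Longrightarrow> psl (A ** B) \<in> \<Gamma>" and "psl (mat 1) \<in> \<Gamma>"
proof -
  show "A \<in> up_to_sign (veech_group S)" if A: "psl A \<in> \<Gamma>"
  proof -
    have "psl A \<in> psl ` veech_group S"
      using subgroup.mem_carrier[OF assms A] by (simp add: projective_veech_group_def)
    then obtain B where B: "B \<in> veech_group S" "psl A = psl B" by blast
    from B(2) have "A \<in> {B, - B}" by (auto simp: psl_eq)
    with B(1) show ?thesis by (auto simp: up_to_sign_def)
  qed
  show "psl A \<in> \<Gamma> \<Longrightarrow> psl B \<in> \<Gamma> \<Longrightarrow> psl (A ** B) \<in> \<Gamma>"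
    using subgroup.m_closed[OF assms, of "psl A" "psl B"]
    by (simp add: projective_veech_group_def PSL2_def FactGroup_def psl_mult)
  show "psl (mat 1) \<in> \<Gamma>"
    using subgroup.one_closed[OF assms]
    by (simp add: projective_veech_group_def PSL2_def FactGroup_def psl_eq)
qed

text \<open>An accumulation point would make the quotients of consecutive terms of a sequence of distinct
  elements converge to the identity.\<close>

lemma discrete_subgroup_finite:
  assumes L: "subgroup L SL2" "discrete L" and "compact C"
  shows "finite (L \<inter> C)"
proof (rule ccontr)
  note sg = subgroup_SL2[OF L(1)]
  assume "infinite (L \<inter> C)"
  then obtain x where "x islimpt L \<inter> C"
    using Heine_Borel_imp_Bolzano_Weierstrass[OF \<open>compact C\<close>] by blast
  then obtain f where f: "\<And>n::nat. f n \<in> L \<inter> C - {x}" "f \<longlonglongrightarrow> x"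
    unfolding islimpt_sequential by blast
  have c: "(\<lambda>n. f n $ i $ j) \<longlonglongrightarrow> x $ i $ j" for i j
    using f(2) by (intro tendsto_intros)
  have cS: "(\<lambda>n. f (Suc n) $ i $ j) \<longlonglongrightarrow> x $ i $ j" for i j
    using LIMSEQ_Suc[OF c] .
  have "(\<lambda>n. det (f n)) \<longlonglongrightarrow> det x"
    unfolding det_2 by (intro tendsto_intros c)
  moreover have "(\<lambda>n. det (f n)) = (\<lambda>n. 1)" using f(1) sg(1) by auto
  ultimately have "det x = 1" by (simp add: LIMSEQ_const_iff)
  define g where "g n = adj2 (f n) ** f (Suc n)" for n
  have a: "(\<lambda>n. adj2 (f n) $ i $ j) \<longlonglongrightarrow> adj2 x $ i $ j" for i j
    using exhaust_2[of i] exhaust_2[of j]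
    by (elim disjE; simp add: adj2_def; intro tendsto_intros f(2))
  have "(\<lambda>n. g n $ i $ j) \<longlonglongrightarrow> (adj2 x ** x) $ i $ j" for i j
    unfolding g_def matrix_matrix_mult_def by (simp, intro tendsto_intros a f(2) LIMSEQ_Suc[OF f(2)])
  then have "g \<longlonglongrightarrow> mat 1"
    using adj2_mult(1)[OF \<open>det x = 1\<close>] by (metis vec_tendstoI)
  moreover have gL: "g n \<in> L" for n using f(1) sg(2,3) by (auto simp: g_def)
  moreover obtain T where T: "open T" "mat 1 \<in> T" "T \<inter> L = {mat 1}"
    using L(2) sg(4) unfolding discrete_def isolated_in_def by blast
  ultimately have "\<forall>\<^sub>F n in sequentially. g n \<in> T" by (simp add: topological_tendstoD)
  then have "\<forall>\<^sub>F n in sequentially. f (Suc n) = f n"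
  proof eventually_elim
    case (elim n)
    then have "g n = mat 1" using gL T(3) by blast
    then have "f n ** (adj2 (f n) ** f (Suc n)) = f n" by (simp add: g_def)
    moreover have "f n ** (adj2 (f n) ** f (Suc n)) = f (Suc n)"
      using adj2_mult(2)[of "f n"] f(1) sg(1) by (simp add: matrix_mul_assoc)
    ultimately show ?case by simp
  qed
  then obtain N where N: "\<And>n. n \<ge> N \<Longrightarrow> f (Suc n) = f n"
    unfolding eventually_sequentially by blast
  have "f n = f N" if "N \<le> n" for n
    using that by (induction n rule: dec_induct) (simp_all add: N)
  then have "\<forall>\<^sub>F n in sequentially. f n = f N"
    unfolding eventually_sequentially by blast
  then have "f \<longlonglongrightarrow> f N" by (rule tendsto_eventually)
  with f(2) have "x = f N" using LIMSEQ_unique by blast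
  with f(1) show False by blast
qed

text \<open>The transvection adding \<open>\<tau> * cross w v\<close> times \<open>w\<close> to
  \<open>v\<close>. It is quadratic in \<open>w\<close> and therefore remembers \<open>w\<close>
  only up to sign.\<close>

definition shear :: "real \<Rightarrow> plane \<Rightarrow> real^2^2" where
  "shear \<tau> w = vector [vector [1 - \<tau> * w$1 * w$2, \<tau> * (w$1)\<^sup>2], vector [- \<tau> * (w$2)\<^sup>2, 1 + \<tau> * w$1 * w$2]]"

lemma shear_mult: "shear \<tau> w *v v = v + (\<tau> * cross w v) *\<^sub>R w"
  by (simp add: shear_def vec_eq_iff forall_2 matrix_vector_mult_def sum_2 cross_def
      power2_eq_square algebra_simps)

lemma shear_conjugate:
  assumes "det P = 1"
  shows "P ** shear \<tau> w ** adj2 P = shear \<tau> (P *v w)"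
proof -
  have "P ** shear \<tau> w = shear \<tau> (P *v w) ** P"
    unfolding matrix_eq
    using assms by (simp add: shear_mult matrix_vector_right_distrib matrix_vector_mult_scaleR cross_matrix
        flip: matrix_vector_mul_assoc)
  then have "P ** shear \<tau> w ** adj2 P = shear \<tau> (P *v w) ** (P ** adj2 P)"
    by (simp add: matrix_mul_assoc)
  then show ?thesis by (simp add: adj2_mult(2)[OF assms])
qed

text \<open>As \<open>H\<close> preserves \<open>cross\<close> and fixes \<open>p\<close>, it moves
  a complementary vector by a multiple of \<open>p\<close>. The complement used is \<open>p\<close>
  turned by a right angle.\<close>

lemma parabolic_shear:
  assumes "det H = 1" "H *v p = p" "p \<noteq> 0"
  obtains \<tau> where "H = shear \<tau> p"
proof -
  define q :: plane where "q = vector [- p$2, p$1]"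
  have "cross p q = (p$1)\<^sup>2 + (p$2)\<^sup>2" by (simp add: cross_def q_def power2_eq_square)
  then have pq: "cross p q \<noteq> 0"
    using assms(3) by (auto simp: vec_eq_iff forall_2 sum_power2_eq_zero_iff)
  have "cross p (H *v q) = cross p q"
    using cross_matrix[of H p q] assms by simp
  then have "cross p (H *v q - q) = 0" by (simp add: cross_simps)
  then obtain k where "H *v q - q = k *\<^sub>R p"
    using assms(3) cross_zero_imp_parallel by blast
  then have Hq: "H *v q = q + k *\<^sub>R p" by (simp add: algebra_simps)
  have "H *v v = shear (k / cross p q) p *v v" for v
  proof -
    have "cross p q *\<^sub>R (H *v v) = H *v (cross p q *\<^sub>R v)" by (simp add: matrix_vector_mult_scaleR)
    also have "\<dots> = H *v (cross v q *\<^sub>R p + cross p v *\<^sub>R q)" using cross_cramer[of p q v] by simp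
    also have "\<dots> = (cross v q *\<^sub>R p + cross p v *\<^sub>R q) + (cross p v * k) *\<^sub>R p"
      by (simp add: matrix_vector_right_distrib matrix_vector_mult_scaleR assms(2) Hq algebra_simps)
    also have "\<dots> = cross p q *\<^sub>R (shear (k / cross p q) p *v v)"
      using pq unfolding shear_mult cross_cramer[of p q v, symmetric]
      by (simp add: scaleR_right_distrib mult.commute)
    finally show ?thesis using pq by simp
  qed
  then have "H = shear (k / cross p q) p" by (simp add: matrix_eq)
  then show ?thesis using that by blast
qed

lemma shear_eq_imp:
  assumes "shear \<tau> w = shear \<tau> w'" "\<tau> \<noteq> 0"
  shows "w = w' \<or> w = - w'"
proof -
  have 1: "(w$1)\<^sup>2 = (w'$1)\<^sup>2" "(w$2)\<^sup>2 = (w'$2)\<^sup>2" "w$1 * w$2 = w'$1 * w'$2"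
    using assms by (auto simp: shear_def vec_eq_iff forall_2)
  show ?thesis
  proof (cases "w$1 = 0")
    case True
    with 1 show ?thesis by (auto simp: power2_eq_iff vec_eq_iff forall_2)
  next
    case False
    with 1 show ?thesis
      by (auto simp: power2_eq_iff vec_eq_iff forall_2)
  qed
qed

text \<open>The shear along \<open>P *v p\<close> is conjugate to the one along \<open>p\<close> and bounded in terms of \<open>P *v p\<close>.\<close>

lemma parabolic_orbit_finite:
  assumes L: "subgroup L SL2" "discrete L" and p: "shear \<tau> p \<in> L" "\<tau> \<noteq> 0"
  shows "finite {P *v p | P. P \<in> up_to_sign L \<and> norm (P *v p) \<le> R}" (is "finite ?X")
proof -
  have "continuous_on (cball 0 R) (shear \<tau>)"
    unfolding continuous_on_eq_continuous_within continuous_within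
  proof (intro ballI vec_tendstoI)
    fix w i j
    show "((\<lambda>v. shear \<tau> v $ i $ j) \<longlongrightarrow> shear \<tau> w $ i $ j) (at w within cball 0 R)"
      using exhaust_2[of i] exhaust_2[of j] by (elim disjE; simp add: shear_def; intro tendsto_intros)
  qed
  then have "compact (shear \<tau> ` cball 0 R)" by (rule compact_continuous_image) simp
  from discrete_subgroup_finite[OF L this] have fin: "finite (L \<inter> shear \<tau> ` cball 0 R)" .
  have "shear \<tau> ` ?X \<subseteq> L \<inter> shear \<tau> ` cball 0 R"
  proof (intro subsetI)
    fix B assume "B \<in> shear \<tau> ` ?X"
    then obtain P where P: "P \<in> up_to_sign L" "norm (P *v p) \<le> R" "B = shear \<tau> (P *v p)" by blast
    then have "B = P ** shear \<tau> p ** adj2 P"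
      using shear_conjugate up_to_sign(1)[OF L(1)] by simp
    then have "B \<in> L" using P(1) p(1) up_to_sign(6)[OF L(1)] by simp
    with P show "B \<in> L \<inter> shear \<tau> ` cball 0 R" by auto
  qed
  then have "finite (shear \<tau> ` ?X)" using fin finite_subset by blast
  \<comment> \<open>A shear with \<open>\<tau> \<noteq> 0\<close> determines its vector up to sign,
    so the fibres have at most two elements.\<close>
  moreover have "finite {w \<in> ?X. shear \<tau> w = shear \<tau> v}" for v
  proof (rule finite_subset)
    show "{w \<in> ?X. shear \<tau> w = shear \<tau> v} \<subseteq> {v, - v}" using shear_eq_imp p(2) by blast
  qed simp
  ultimately have "finite (\<Union>B\<in>shear \<tau> ` ?X. {w \<in> ?X. shear \<tau> w = B})"
    by (intro finite_UN_I) blast+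
  then show ?thesis by (rule finite_subset[rotated]) blast
qed

section \<open>Wedges and side pairings\<close>

lemma matrix_inv_mult:
  assumes "det (A :: real^2^2) \<noteq> 0"
  shows "A ** matrix_inv A = mat 1" "matrix_inv A ** A = mat 1"
proof -
  have "\<exists>B. A ** B = mat 1 \<and> B ** A = mat 1"
    using assms invertible_det_nz[of A] by (simp add: invertible_def)
  then have "A ** matrix_inv A = mat 1 \<and> matrix_inv A ** A = mat 1"
    unfolding matrix_inv_def by (rule someI_ex)
  then show "A ** matrix_inv A = mat 1" "matrix_inv A ** A = mat 1" by blast+
qed

lemma mat_prod_append: "mat_prod (xs @ ys) = mat_prod xs ** mat_prod ys"
  by (induction xs) (simp_all add: mat_prod_def matrix_mul_assoc)

lemma prefix_mat_0: "prefix_mat G a 0 = mat 1"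
  and prefix_mat_Suc: "prefix_mat G a (Suc n) = prefix_mat G a n ** G (a n)"
  unfolding prefix_mat_def by (simp_all add: mat_prod_append) (simp_all add: mat_prod_def)

lemma prefix_mat_add:
  "prefix_mat G a (m + n) = prefix_mat G a m ** prefix_mat G (\<lambda>k. a (m + k)) n"
  by (induction n) (simp_all add: prefix_mat_0 prefix_mat_Suc matrix_mul_assoc)

lemma shortest_holonomy_nonzero: "shortest_holonomy S \<xi> v \<Longrightarrow> v \<noteq> 0"
  by (auto simp: shortest_holonomy_def holonomies_def saddle_connection_def)

text \<open>\<open>A\<close> and its inverse both preserve holonomies. So
  \<open>c *\<^sub>R w\<close> and \<open>(1 / c) *\<^sub>R v\<close> are holonomies in the
  directions of \<open>w\<close> and \<open>v\<close>, and minimality bounds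
  \<open>\<bar>c\<bar>\<close> from below and above by 1.\<close>

lemma shortest_holonomy_scale:
  assumes S: "translation_surface S" "subgroup (veech_group S) SL2"
    and A: "A \<in> up_to_sign (veech_group S)"
    and v: "shortest_holonomy S \<xi> v" and w: "shortest_holonomy S \<zeta> w" and eq: "A *v v = c *\<^sub>R w"
  shows "\<bar>c\<bar> = 1"
proof -
  have det: "det A = 1" using up_to_sign(1)[OF S(2) A] .
  have nz: "v \<noteq> 0" "w \<noteq> 0" using v w by (auto dest: shortest_holonomy_nonzero)
  have "A *v v \<noteq> 0"
    using nz det by (metis invertible_det_nz matrix_left_invertible_ker invertible_def zero_neq_one)
  then have "c \<noteq> 0" using eq by auto
  have hol: "\<And>v. v \<in> holonomies S \<Longrightarrow> A *v v \<in> holonomies S" "\<And>v. v \<in> holonomies S \<Longrightarrow> adj2 A *v v \<in> holonomies S"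
    using holonomies_veech[OF S(1)] A up_to_sign(4)[OF S(2) A] unfolding up_to_sign_def by blast+
  have "adj2 A *v (A *v v) = v"
    using adj2_mult(1)[OF det] by (simp add: matrix_vector_mul_assoc)
  then have "(1 / c) *\<^sub>R (c *\<^sub>R (adj2 A *v w)) = (1 / c) *\<^sub>R v"
    unfolding eq matrix_vector_mult_scaleR by simp
  then have inv: "adj2 A *v w = (1 / c) *\<^sub>R v" using \<open>c \<noteq> 0\<close> by simp
  have le: "norm w' \<le> norm (k *\<^sub>R w')"
    if "shortest_holonomy S \<zeta>' w'" "k *\<^sub>R w' \<in> holonomies S" "k \<noteq> 0" for \<zeta>' w' k
    using that line_pt_scaleR[of k w'] unfolding shortest_holonomy_def by metis
  have "c *\<^sub>R w \<in> holonomies S" using hol(1)[of v] v eq by (simp add: shortest_holonomy_def)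
  then have "norm w \<le> norm (c *\<^sub>R w)" using le w \<open>c \<noteq> 0\<close> by blast
  moreover have "(1 / c) *\<^sub>R v \<in> holonomies S" using hol(2)[of w] w inv by (simp add: shortest_holonomy_def)
  then have "norm v \<le> norm ((1 / c) *\<^sub>R v)" using le[OF v] \<open>c \<noteq> 0\<close>
    by (metis divide_eq_0_iff zero_neq_one)
  ultimately show ?thesis using nz \<open>c \<noteq> 0\<close> by (simp add: field_simps)
qed

locale veech_coding =
  fixes S :: glued_polygons and \<Gamma> :: "(real^2^2) set set" and bar :: "'a::finite \<Rightarrow> 'a"
    and V :: "complex set" and \<xi>r \<xi>l :: "'a \<Rightarrow> complex" and G W :: "'a \<Rightarrow> real^2^2"
  assumes surface: "translation_surface S"
    and veech: "subgroup (veech_group S) SL2" "discrete (veech_group S)"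
    and \<Gamma>: "subgroup \<Gamma> (projective_veech_group S)"
    and bar: "bar (bar \<alpha>) = \<alpha>" and card_V: "4 \<le> card V"
    and labelling: "side_labelling V \<xi>r \<xi>l"
    and pairing: "side_pairing_maps \<Gamma> (ideal_polygon V) bar (\<lambda>\<alpha>. geodesic (\<xi>r \<alpha>) (\<xi>l \<alpha>)) G"
    and wedge: "is_wedge S (\<xi>r \<alpha>) (\<xi>l \<alpha>) (W \<alpha>)"
begin

abbreviation p :: "'a \<Rightarrow> plane" where "p \<alpha> \<equiv> column 1 (W \<alpha>)"
abbreviation q :: "'a \<Rightarrow> plane" where "q \<alpha> \<equiv> column 2 (W \<alpha>)"

lemma shortest: "shortest_holonomy S (\<xi>r \<alpha>) (p \<alpha>)" "shortest_holonomy S (\<xi>l \<alpha>) (q \<alpha>)"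
  using wedge[of \<alpha>] by (simp_all add: is_wedge_def Let_def)

lemma line_pt_pq: "line_pt (p \<alpha>) = \<xi>r \<alpha>" "line_pt (q \<alpha>) = \<xi>l \<alpha>"
  using shortest[of \<alpha>] by (simp_all add: shortest_holonomy_def)

lemma pq_nonzero: "p \<alpha> \<noteq> 0" "q \<alpha> \<noteq> 0"
  using shortest shortest_holonomy_nonzero by blast+

lemma cross_pq: "0 < cross (p \<alpha>) (q \<alpha>)"
  using wedge[of \<alpha>] by (simp add: is_wedge_def Let_def cross_columns)

text \<open>The two factors are the coordinates of \<open>v\<close> in the wedge times its area.
  Their product ignores the sign of \<open>v\<close>, as suits a condition on lines.\<close>

lemma arc_iff:
  assumes "v \<noteq> 0"
  shows "line_pt v \<in> cw_arc (\<xi>r \<alpha>) (\<xi>l \<alpha>) \<longleftrightarrow> 0 \<le> cross (p \<alpha>) v * cross v (q \<alpha>)"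
proof -
  let ?\<delta> = "cross (p \<alpha>) (q \<alpha>)"
  have "{v. v \<noteq> 0 \<and> line_pt v \<in> cw_arc (\<xi>r \<alpha>) (\<xi>l \<alpha>)} =
      {v. v \<noteq> 0 \<and> (\<exists>a b. a \<ge> 0 \<and> b \<ge> 0 \<and>
        (v = a *\<^sub>R p \<alpha> + b *\<^sub>R q \<alpha> \<or> v = - (a *\<^sub>R p \<alpha> + b *\<^sub>R q \<alpha>)))}"
    using wedge[of \<alpha>] by (simp add: is_wedge_def Let_def)
  then have iff: "line_pt v \<in> cw_arc (\<xi>r \<alpha>) (\<xi>l \<alpha>) \<longleftrightarrow> (\<exists>a b. a \<ge> 0 \<and> b \<ge> 0 \<and>
        (v = a *\<^sub>R p \<alpha> + b *\<^sub>R q \<alpha> \<or> v = - (a *\<^sub>R p \<alpha> + b *\<^sub>R q \<alpha>)))"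
    using assms by blast
  show ?thesis
  proof
    assume "line_pt v \<in> cw_arc (\<xi>r \<alpha>) (\<xi>l \<alpha>)"
    then obtain a b where ab: "a \<ge> 0" "b \<ge> 0" "v = a *\<^sub>R p \<alpha> + b *\<^sub>R q \<alpha> \<or> v = - (a *\<^sub>R p \<alpha> + b *\<^sub>R q \<alpha>)"
      using iff by blast
    then have "cross (p \<alpha>) v * cross v (q \<alpha>) = (a * ?\<delta>) * (b * ?\<delta>)"
      by (auto simp: cross_simps)
    then show "0 \<le> cross (p \<alpha>) v * cross v (q \<alpha>)" using ab(1,2) cross_pq[of \<alpha>] by simp
  next
    assume nn: "0 \<le> cross (p \<alpha>) v * cross v (q \<alpha>)"
    define a b where "a = cross v (q \<alpha>) / ?\<delta>" and "b = cross (p \<alpha>) v / ?\<delta>"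
    have "v = (1 / ?\<delta>) *\<^sub>R (?\<delta> *\<^sub>R v)" using cross_pq[of \<alpha>] by simp
    also have "\<dots> = a *\<^sub>R p \<alpha> + b *\<^sub>R q \<alpha>"
      unfolding cross_cramer[of "p \<alpha>" "q \<alpha>" v] by (simp add: a_def b_def scaleR_right_distrib)
    finally have v: "v = a *\<^sub>R p \<alpha> + b *\<^sub>R q \<alpha>" .
    have "a \<ge> 0 \<and> b \<ge> 0 \<or> a \<le> 0 \<and> b \<le> 0"
      using nn cross_pq[of \<alpha>] by (auto simp: a_def b_def zero_le_mult_iff divide_nonpos_pos)
    moreover have "v = - ((- a) *\<^sub>R p \<alpha> + (- b) *\<^sub>R q \<alpha>)" using v by simp
    ultimately show "line_pt v \<in> cw_arc (\<xi>r \<alpha>) (\<xi>l \<alpha>)"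
      unfolding iff using v by (metis neg_0_le_iff_le)
  qed
qed

lemma vertices: "V = range \<xi>r" "\<xi>l \<alpha> \<in> V" "inj \<xi>r"
  using labelling by (auto simp: side_labelling_def bij_betw_def)

lemma xi_r_in_V: "\<xi>r \<alpha> \<in> V"
  using vertices by blast

lemma cross_zero_iff:
  assumes "v \<noteq> 0"
  shows "cross (p \<alpha>) v = 0 \<longleftrightarrow> line_pt v = \<xi>r \<alpha>" "cross v (q \<alpha>) = 0 \<longleftrightarrow> line_pt v = \<xi>l \<alpha>"
  using line_pt_eq_iff[OF pq_nonzero(1) assms, of \<alpha>] line_pt_eq_iff[OF assms pq_nonzero(2), of \<alpha>]
  by (simp_all add: line_pt_pq eq_commute[of "\<xi>r \<alpha>" "line_pt v"])

lemma vertex_outside: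
  assumes "v \<noteq> 0" "line_pt v \<in> V"
  shows "cross (p \<alpha>) v * cross v (q \<alpha>) \<le> 0"
    and "cross (p \<alpha>) v * cross v (q \<alpha>) = 0 \<Longrightarrow> line_pt v \<in> {\<xi>r \<alpha>, \<xi>l \<alpha>}"
proof -
  have zero: "cross (p \<alpha>) v * cross v (q \<alpha>) = 0 \<longleftrightarrow> line_pt v \<in> {\<xi>r \<alpha>, \<xi>l \<alpha>}"
    using cross_zero_iff[OF assms(1), of \<alpha>] by simp
  then show "cross (p \<alpha>) v * cross v (q \<alpha>) = 0 \<Longrightarrow> line_pt v \<in> {\<xi>r \<alpha>, \<xi>l \<alpha>}" by blast
  show "cross (p \<alpha>) v * cross v (q \<alpha>) \<le> 0"
  proof (rule ccontr)
    assume pos: "\<not> ?thesis"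
    have "line_pt v \<in> cw_arc (\<xi>r \<alpha>) (\<xi>l \<alpha>) \<inter> V" using pos arc_iff[OF assms(1), of \<alpha>] assms(2) by simp
    moreover have "cw_arc (\<xi>r \<alpha>) (\<xi>l \<alpha>) \<inter> V = {\<xi>r \<alpha>, \<xi>l \<alpha>}"
      using labelling by (simp only: side_labelling_def)
    ultimately have "line_pt v \<in> {\<xi>r \<alpha>, \<xi>l \<alpha>}" by simp
    with zero pos show False by auto
  qed
qed

lemmas side_outside = vertex_outside[OF pq_nonzero(1), unfolded line_pt_pq, OF xi_r_in_V]
  vertex_outside[OF pq_nonzero(2), unfolded line_pt_pq, OF vertices(2)]

text \<open>The witness that shows on which side of a given side the polygon lies.\<close>

lemma third_vertex: obtains \<beta> where "cross (p \<alpha>) (p \<beta>) * cross (p \<beta>) (q \<alpha>) < 0"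
proof -
  have "\<not> V \<subseteq> {\<xi>r \<alpha>, \<xi>l \<alpha>}"
  proof
    assume "V \<subseteq> {\<xi>r \<alpha>, \<xi>l \<alpha>}"
    then have "card V \<le> card {\<xi>r \<alpha>, \<xi>l \<alpha>}" by (intro card_mono) simp_all
    also have "\<dots> \<le> 2" by (simp add: card_insert_if)
    finally show False using card_V by simp
  qed
  then obtain \<beta> where "\<xi>r \<beta> \<notin> {\<xi>r \<alpha>, \<xi>l \<alpha>}" using vertices(1) by auto
  then have "cross (p \<alpha>) (p \<beta>) * cross (p \<beta>) (q \<alpha>) < 0"
    using side_outside(1,2)[of \<alpha> \<beta>] by (meson order_le_less)
  then show ?thesis using that by blast
qed

section \<open>Side pairings acting on wedges\<close>

lemma det_G: "det (G \<alpha>) = 1" and psl_G: "psl (G \<alpha>) \<in> \<Gamma>"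
  using pairing by (simp_all add: side_pairing_maps_def)

text \<open>The pairing exchanges right and left ends. The other matching of endpoints would put the
  image polygon on the same side of \<open>e \<alpha>\<close> as the polygon, contradicting that
  they meet only in that side. The sign of \<open>m * k\<close> then comes from
  \<open>det (G \<alpha>) = 1\<close>.\<close>

lemma side_map:
  obtains m k where "G \<alpha> *v p (bar \<alpha>) = m *\<^sub>R q \<alpha>" "G \<alpha> *v q (bar \<alpha>) = k *\<^sub>R p \<alpha>" "m * k < 0"
proof -
  let ?\<gamma> = "bar \<alpha>"
  have img: "disk_act (G \<alpha>) ` geodesic (line_pt (p ?\<gamma>)) (line_pt (q ?\<gamma>)) = geodesic (line_pt (p \<alpha>)) (line_pt (q \<alpha>))"
    and dom: "disk_act (G \<alpha>) ` ideal_polygon V \<inter> ideal_polygon V = geodesic (line_pt (p \<alpha>)) (line_pt (q \<alpha>))"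
    using pairing by (simp_all add: side_pairing_maps_def line_pt_pq)
  have \<gamma>: "cross (p ?\<gamma>) (q ?\<gamma>) \<noteq> 0" using cross_pq[of ?\<gamma>] by simp
  note e = geodesic_map_endpoints[OF img det_G \<gamma> pq_nonzero]
  have cr: "cross (G \<alpha> *v p ?\<gamma>) (G \<alpha> *v q ?\<gamma>) = cross (p ?\<gamma>) (q ?\<gamma>)"
    by (simp add: cross_matrix det_G)
  have par: "\<exists>c. v = c *\<^sub>R w" if "cross w v = 0" "w \<noteq> 0" for v w :: plane
    using that cross_zero_imp_parallel by blast
  \<comment> \<open>The two image vectors are independent, so they cannot both lie on one
    line.\<close>
  have np: "\<not> (cross w (G \<alpha> *v p ?\<gamma>) = 0 \<and> cross w (G \<alpha> *v q ?\<gamma>) = 0)" if "w \<noteq> 0" for w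
  proof
    assume "cross w (G \<alpha> *v p ?\<gamma>) = 0 \<and> cross w (G \<alpha> *v q ?\<gamma>) = 0"
    then obtain c c' where "G \<alpha> *v p ?\<gamma> = c *\<^sub>R w" "G \<alpha> *v q ?\<gamma> = c' *\<^sub>R w"
      using par \<open>w \<noteq> 0\<close> by blast
    then show False using cr \<gamma> by (simp add: cross_simps)
  qed
  have nd: "\<not> (cross (p \<alpha>) (G \<alpha> *v p ?\<gamma>) = 0 \<and> cross (q \<alpha>) (G \<alpha> *v q ?\<gamma>) = 0)"
  proof
    assume "cross (p \<alpha>) (G \<alpha> *v p ?\<gamma>) = 0 \<and> cross (q \<alpha>) (G \<alpha> *v q ?\<gamma>) = 0"
    then obtain c c' where cc: "G \<alpha> *v p ?\<gamma> = c *\<^sub>R p \<alpha>" "G \<alpha> *v q ?\<gamma> = c' *\<^sub>R q \<alpha>"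
      using par[OF _ pq_nonzero(1)] par[OF _ pq_nonzero(2)] by meson
    have "c * c' * cross (p \<alpha>) (q \<alpha>) = cross (p ?\<gamma>) (q ?\<gamma>)"
      using cr unfolding cc by (simp add: cross_scaleR_left cross_scaleR_right mult.assoc mult.left_commute)
    also have "\<dots> > 0" by (rule cross_pq)
    finally have pos: "0 < c * c'" using zero_less_mult_pos2 cross_pq by blast
    obtain \<beta> where \<beta>: "cross (p \<alpha>) (p \<beta>) * cross (p \<beta>) (q \<alpha>) < 0" using third_vertex .
    obtain \<beta>' where \<beta>': "cross (p ?\<gamma>) (p \<beta>') * cross (p \<beta>') (q ?\<gamma>) < 0" using third_vertex .
    have in_V: "line_pt (p \<beta>) \<in> V" "line_pt (q \<beta>) \<in> V" for \<beta>
      using vertices by (auto simp: line_pt_pq)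
    have "cross (p \<alpha>) (q \<alpha>) \<noteq> 0" using cross_pq[of \<alpha>] by simp
    from ideal_polygon_overlap[OF in_V in_V(1) in_V in_V(1) this \<beta> \<beta>' det_G cc pos] dom
    show False by blast
  qed
  have nz: "p \<alpha> \<noteq> 0" "q \<alpha> \<noteq> 0" by (rule pq_nonzero)+
  have "cross (q \<alpha>) (G \<alpha> *v p ?\<gamma>) = 0" "cross (p \<alpha>) (G \<alpha> *v q ?\<gamma>) = 0"
    using e np[OF nz(1)] np[OF nz(2)] nd by auto
  then obtain m k where mk: "G \<alpha> *v p ?\<gamma> = m *\<^sub>R q \<alpha>" "G \<alpha> *v q ?\<gamma> = k *\<^sub>R p \<alpha>"
    using par nz by blast
  then have "cross (p ?\<gamma>) (q ?\<gamma>) = - (m * k * cross (p \<alpha>) (q \<alpha>))"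
    using cr by (simp add: cross_simps cross_commute[of "q \<alpha>" "p \<alpha>"] mult.assoc mult.left_commute)
  then have "m * k * cross (p \<alpha>) (q \<alpha>) < 0" using cross_pq[of ?\<gamma>] by simp
  then have "m * k < 0" using cross_pq[of \<alpha>] by (simp add: mult_less_0_iff)
  with mk that show ?thesis by blast
qed

lemma up_to_sign_G: "psl A \<in> \<Gamma> \<Longrightarrow> A \<in> up_to_sign (veech_group S)"
  using psl_subgroup(1)[OF \<Gamma>] .

text \<open>Two such sides would have complementary arcs, and a third vertex, being outside one arc,
  would lie inside the other. This excludes a transition in which both rays of a wedge are
  shared.\<close>

lemma sides_not_complementary:
  "\<not> (cross (p \<beta>) (q \<gamma>) = 0 \<and> cross (q \<beta>) (p \<gamma>) = 0)"
proof
  assume "cross (p \<beta>) (q \<gamma>) = 0 \<and> cross (q \<beta>) (p \<gamma>) = 0"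
  then have "cross (q \<gamma>) (p \<beta>) = 0" "cross (p \<gamma>) (q \<beta>) = 0"
    using cross_commute[of "q \<gamma>" "p \<beta>"] cross_commute[of "p \<gamma>" "q \<beta>"] by simp_all
  then obtain m k where mk: "p \<beta> = m *\<^sub>R q \<gamma>" "q \<beta> = k *\<^sub>R p \<gamma>"
    using cross_zero_imp_parallel pq_nonzero by metis
  have "cross (p \<beta>) (q \<beta>) = - (m * k * cross (p \<gamma>) (q \<gamma>))"
    by (simp add: mk cross_simps cross_commute[of "q \<gamma>" "p \<gamma>"])
  then have "m * k * cross (p \<gamma>) (q \<gamma>) < 0" using cross_pq[of \<beta>] by simp
  then have neg: "m * k < 0" using cross_pq[of \<gamma>] by (simp add: mult_less_0_iff)
  obtain \<alpha> where \<alpha>: "cross (p \<gamma>) (p \<alpha>) * cross (p \<alpha>) (q \<gamma>) < 0" using third_vertex .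
  have "cross (p \<beta>) (p \<alpha>) * cross (p \<alpha>) (q \<beta>) = (m * k) * (cross (p \<gamma>) (p \<alpha>) * cross (p \<alpha>) (q \<gamma>))"
    by (simp add: mk cross_simps cross_commute[of "p \<alpha>" "p \<gamma>"] cross_commute[of "q \<gamma>" "p \<alpha>"])
  then have "0 < cross (p \<beta>) (p \<alpha>) * cross (p \<alpha>) (q \<beta>)" using neg \<alpha> by (simp add: mult_neg_neg)
  then show False using side_outside(1)[of \<beta> \<alpha>] by simp
qed

text \<open>A side pairing carries every wedge but one into a wedge, up to sign. A ray shared by the two
  wedges carries the same vector of both, since this is the shortest holonomy in its direction.\<close>

lemma transition:
  assumes "\<beta> \<noteq> bar \<alpha>"
  shows "\<exists>e a b c d. (e = 1 \<or> e = - 1) \<and> 0 < a \<and> 0 < d \<and> 0 \<le> b \<and> 0 \<le> c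
    \<and> G \<alpha> *v p \<beta> = e *\<^sub>R (a *\<^sub>R p \<alpha> + c *\<^sub>R q \<alpha>) \<and> G \<alpha> *v q \<beta> = e *\<^sub>R (b *\<^sub>R p \<alpha> + d *\<^sub>R q \<alpha>)
    \<and> (c = 0 \<longrightarrow> a = 1 \<and> 0 < b) \<and> (b = 0 \<longrightarrow> d = 1 \<and> 0 < c)"
proof -
  let ?\<gamma> = "bar \<alpha>" and ?\<delta> = "cross (p \<alpha>) (q \<alpha>)"
  obtain m k where mk: "G \<alpha> *v p ?\<gamma> = m *\<^sub>R q \<alpha>" "G \<alpha> *v q ?\<gamma> = k *\<^sub>R p \<alpha>" "m * k < 0"
    using side_map .
  have \<delta>: "0 < ?\<delta>" by (rule cross_pq)
  define s t where "s v = cross (G \<alpha> *v v) (q \<alpha>) / ?\<delta>" and "t v = cross (p \<alpha>) (G \<alpha> *v v) / ?\<delta>" for v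
  have G: "G \<alpha> *v v = s v *\<^sub>R p \<alpha> + t v *\<^sub>R q \<alpha>" for v
  proof -
    have "G \<alpha> *v v = (1 / ?\<delta>) *\<^sub>R (?\<delta> *\<^sub>R (G \<alpha> *v v))" using \<delta> by simp
    also have "\<dots> = s v *\<^sub>R p \<alpha> + t v *\<^sub>R q \<alpha>"
      unfolding cross_cramer[of "p \<alpha>" "q \<alpha>" "G \<alpha> *v v"] by (simp add: s_def t_def scaleR_right_distrib)
    finally show ?thesis .
  qed
  have ms: "m * ?\<delta> * s v = cross v (p ?\<gamma>)" for v
    using cross_matrix[of "G \<alpha>" v "p ?\<gamma>"] \<delta> by (simp add: det_G mk(1) cross_simps s_def)
  have kt: "k * ?\<delta> * t v = cross (q ?\<gamma>) v" for v
    using cross_matrix[of "G \<alpha>" "q ?\<gamma>" v] \<delta> by (simp add: det_G mk(2) cross_simps t_def)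
  \<comment> \<open>A vertex lies outside the open arc of \<open>bar \<alpha>\<close>. As
    \<open>m * k < 0\<close>, \<open>G \<alpha>\<close> takes it into the cone of
    \<open>\<alpha>\<close>, up to sign.\<close>
  have st: "0 \<le> s v * t v" if "v \<noteq> 0" "line_pt v \<in> V" for v
  proof -
    have "(m * k) * ?\<delta>\<^sup>2 * (s v * t v) = (m * ?\<delta> * s v) * (k * ?\<delta> * t v)"
      by (simp add: power2_eq_square)
    also have "\<dots> = cross (p ?\<gamma>) v * cross v (q ?\<gamma>)"
      unfolding ms kt by (simp add: cross_commute[of v "p ?\<gamma>"] cross_commute[of "q ?\<gamma>" v])
    also have "\<dots> \<le> 0" using vertex_outside(1)[OF that] .
    finally show ?thesis
      using mult_neg_pos[OF mk(3), of "?\<delta>\<^sup>2"] \<delta> by (meson mult_neg_neg not_le zero_less_power)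
  qed
  \<comment> \<open>The right vertex of \<open>bar \<alpha>\<close> is not inside the arc of
    \<open>\<beta>\<close>, so \<open>s\<close> does not change sign across that wedge: one sign
    \<open>e\<close> serves both of its vectors.\<close>
  have ss: "0 \<le> s (p \<beta>) * s (q \<beta>)"
  proof -
    have "(m * ?\<delta>)\<^sup>2 * (s (p \<beta>) * s (q \<beta>)) = (m * ?\<delta> * s (p \<beta>)) * (m * ?\<delta> * s (q \<beta>))"
      by (simp add: power2_eq_square)
    also have "\<dots> = - (cross (p \<beta>) (p ?\<gamma>) * cross (p ?\<gamma>) (q \<beta>))"
      unfolding ms by (simp add: cross_commute[of "q \<beta>" "p ?\<gamma>"])
    also have "\<dots> \<ge> 0" using side_outside(1)[of \<beta> ?\<gamma>] by simp
    finally show ?thesis using mk(3) \<delta> by (auto simp: zero_le_mult_iff)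
  qed
  have det: "0 < s (p \<beta>) * t (q \<beta>) - s (q \<beta>) * t (p \<beta>)"
  proof -
    have "cross (p \<beta>) (q \<beta>) = cross (G \<alpha> *v p \<beta>) (G \<alpha> *v q \<beta>)" by (simp add: cross_matrix det_G)
    also have "\<dots> = (s (p \<beta>) * t (q \<beta>) - s (q \<beta>) * t (p \<beta>)) * ?\<delta>"
      by (simp add: G cross_simps cross_commute[of "q \<alpha>" "p \<alpha>"] algebra_simps)
    finally show ?thesis using cross_pq[of \<beta>] \<delta> by (simp add: zero_less_mult_iff)
  qed
  \<comment> \<open>No-backtracking enters here: distinct letters have distinct right
    vertices.\<close>
  have "cross (p \<beta>) (p ?\<gamma>) \<noteq> 0"
    using assms line_pt_eq_iff[OF pq_nonzero(1) pq_nonzero(1), of \<beta> ?\<gamma>] vertices(3)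
    by (auto simp: line_pt_pq dest: injD)
  then have s0: "s (p \<beta>) \<noteq> 0" using ms[of "p \<beta>"] by auto
  define e where "e = sgn (s (p \<beta>))"
  have e: "e = 1 \<or> e = - 1" "e * e = 1" "0 < e * s (p \<beta>)"
    using s0 by (auto simp: e_def sgn_if)
  have stp: "0 \<le> s (p \<beta>) * t (p \<beta>)"
    using st pq_nonzero vertices by (simp add: line_pt_pq)
  have b: "0 \<le> e * s (q \<beta>)" and c: "0 \<le> e * t (p \<beta>)"
    using e(1,3) ss stp by (auto simp: zero_le_mult_iff)
  have "0 < (e * s (p \<beta>)) * (e * t (q \<beta>))"
  proof -
    have "0 \<le> (e * s (q \<beta>)) * (e * t (p \<beta>))" using b c by simp
    then have "0 \<le> s (q \<beta>) * t (p \<beta>)" using e(1) by auto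
    with det have "0 < s (p \<beta>) * t (q \<beta>)" by linarith
    then show ?thesis using e(1) by auto
  qed
  then have d: "0 < e * t (q \<beta>)" using e(3) zero_less_mult_pos by blast
  have Gp: "G \<alpha> *v p \<beta> = e *\<^sub>R ((e * s (p \<beta>)) *\<^sub>R p \<alpha> + (e * t (p \<beta>)) *\<^sub>R q \<alpha>)"
    and Gq: "G \<alpha> *v q \<beta> = e *\<^sub>R ((e * s (q \<beta>)) *\<^sub>R p \<alpha> + (e * t (q \<beta>)) *\<^sub>R q \<alpha>)"
    using e(1) by (auto simp: G)
  have ne: "\<not> (e * t (p \<beta>) = 0 \<and> e * s (q \<beta>) = 0)"
  proof
    assume "e * t (p \<beta>) = 0 \<and> e * s (q \<beta>) = 0"
    then have "t (p \<beta>) = 0" "s (q \<beta>) = 0" using e(1) by auto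
    then have "cross (q ?\<gamma>) (p \<beta>) = 0" "cross (q \<beta>) (p ?\<gamma>) = 0" using ms[of "q \<beta>"] kt[of "p \<beta>"] by simp_all
    then show False using sides_not_complementary[of \<beta> ?\<gamma>] cross_commute[of "q ?\<gamma>" "p \<beta>"] by simp
  qed
  note scale = shortest_holonomy_scale[OF surface veech(1) up_to_sign_G[OF psl_G]]
  have c0: "e * s (p \<beta>) = 1 \<and> 0 < e * s (q \<beta>)" if "e * t (p \<beta>) = 0"
  proof -
    have "G \<alpha> *v p \<beta> = (e * (e * s (p \<beta>))) *\<^sub>R p \<alpha>" using Gp that by simp
    from scale[OF shortest(1) shortest(1) this] have "e * s (p \<beta>) = 1" using e(1,3) by auto
    moreover have "e * s (q \<beta>) \<noteq> 0" using ne that by blast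
    ultimately show ?thesis using b order_le_imp_less_or_eq by metis
  qed
  have b0: "e * t (q \<beta>) = 1 \<and> 0 < e * t (p \<beta>)" if "e * s (q \<beta>) = 0"
  proof -
    have "G \<alpha> *v q \<beta> = (e * (e * t (q \<beta>))) *\<^sub>R q \<alpha>" using Gq that by simp
    from scale[OF shortest(2) shortest(2) this] have "e * t (q \<beta>) = 1" using e(1) d by auto
    moreover have "e * t (p \<beta>) \<noteq> 0" using ne that by blast
    ultimately show ?thesis using c order_le_imp_less_or_eq by metis
  qed
  show ?thesis using e(1,3) b c d Gp Gq c0 b0 by blast
qed

lemma psl_prefix: "psl (prefix_mat G a n) \<in> \<Gamma>"
  by (induction n) (simp_all add: prefix_mat_0 prefix_mat_Suc psl_subgroup[OF \<Gamma>] psl_G)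

lemmas up_to_sign_prefix = up_to_sign_G[OF psl_prefix]

lemma det_prefix: "det (prefix_mat G a n) = 1"
  using up_to_sign(1)[OF veech(1) up_to_sign_prefix] .

text \<open>The labelling gives injectivity for right vertices only. If two sides share the left
  vertex, each right vertex is outside the other's arc; the two sign conditions are opposite, so the
  right vertices coincide as well.\<close>

lemma inj_xi_l: "inj \<xi>l"
proof (rule injI)
  fix \<alpha> \<beta> assume "\<xi>l \<alpha> = \<xi>l \<beta>"
  then have "cross (q \<alpha>) (q \<beta>) = 0"
    using cross_zero_iff(2)[OF pq_nonzero(2), of \<alpha> \<beta>] by (simp add: line_pt_pq)
  then obtain c where c: "q \<beta> = c *\<^sub>R q \<alpha>" using cross_zero_imp_parallel pq_nonzero by metis
  have "0 < c * cross (p \<beta>) (q \<alpha>)" using cross_pq[of \<beta>] by (simp add: c cross_simps)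
  moreover have "0 < c * cross (p \<alpha>) (q \<beta>)"
  proof -
    have "c \<noteq> 0" using c pq_nonzero(2)[of \<beta>] by auto
    then have "0 < c * c" using not_real_square_gt_zero by blast
    then have "0 < (c * c) * cross (p \<alpha>) (q \<alpha>)" using cross_pq by (rule mult_pos_pos)
    then show ?thesis by (simp add: c cross_simps)
  qed
  moreover have "cross (p \<alpha>) (p \<beta>) * cross (p \<beta>) (q \<alpha>) \<le> 0" "- cross (p \<alpha>) (p \<beta>) * cross (p \<alpha>) (q \<beta>) \<le> 0"
    using side_outside(1)[of \<alpha> \<beta>] side_outside(1)[of \<beta> \<alpha>] cross_commute[of "p \<beta>" "p \<alpha>"] by simp_all
  ultimately have "cross (p \<alpha>) (p \<beta>) = 0"
    by (smt (verit) mult_minus_left mult_neg_neg mult_pos_neg mult_pos_pos zero_less_mult_iff)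
  then have "\<xi>r \<alpha> = \<xi>r \<beta>"
    using cross_zero_iff(1)[OF pq_nonzero(1), of \<alpha> \<beta>] by (simp add: line_pt_pq)
  then show "\<alpha> = \<beta>" using vertices(3) by (simp add: inj_eq)
qed

text \<open>Turning around a vertex of the polygon, from side to side, eventually closes up; the product
  of the side pairings along the way fixes the vertex.\<close>

lemma vertex_parabolic: "\<exists>\<tau>. \<tau> \<noteq> 0 \<and> shear \<tau> (p \<alpha>) \<in> veech_group S"
proof -
  \<comment> \<open>\<open>G \<beta>\<close> takes the left vertex of \<open>bar \<beta>\<close> to
    the right vertex of \<open>\<beta>\<close>. Continuing with the letter whose right vertex is
    that left vertex therefore keeps the right ray of the wedge.\<close>
  define nxt where "nxt \<beta> = inv_into UNIV \<xi>r (\<xi>l (bar \<beta>))" for \<beta>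
  have nxt: "\<xi>r (nxt \<beta>) = \<xi>l (bar \<beta>)" for \<beta>
    unfolding nxt_def using vertices(1) vertices(2)[of "bar \<beta>"] by (simp add: f_inv_into_f)
  have "inj nxt"
  proof (rule injI)
    fix \<beta> \<gamma> assume "nxt \<beta> = nxt \<gamma>"
    then have "\<xi>l (bar \<beta>) = \<xi>l (bar \<gamma>)" using nxt by metis
    then have "bar \<beta> = bar \<gamma>" using inj_xi_l by (simp add: inj_eq)
    then show "\<beta> = \<gamma>" using bar by metis
  qed
  then obtain n where n: "n > 0" "(nxt ^^ n) \<alpha> = \<alpha>"
    by (rule funpow_inj_finite[of nxt \<alpha>]) simp_all
  have step: "\<exists>e b d. (e = 1 \<or> e = - 1) \<and> 0 < b \<and> 0 < d
      \<and> G \<beta> *v p (nxt \<beta>) = e *\<^sub>R p \<beta> \<and> G \<beta> *v q (nxt \<beta>) = e *\<^sub>R (b *\<^sub>R p \<beta> + d *\<^sub>R q \<beta>)" for \<beta>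
  proof -
    have "\<xi>l (bar \<beta>) \<noteq> \<xi>r (bar \<beta>)" using labelling by (simp add: side_labelling_def)
    then have "nxt \<beta> \<noteq> bar \<beta>" using nxt by metis
    from transition[OF this] obtain e a b c d where T: "e = 1 \<or> e = - 1" "0 < a" "0 < d" "0 \<le> b" "0 \<le> c"
      "G \<beta> *v p (nxt \<beta>) = e *\<^sub>R (a *\<^sub>R p \<beta> + c *\<^sub>R q \<beta>)" "G \<beta> *v q (nxt \<beta>) = e *\<^sub>R (b *\<^sub>R p \<beta> + d *\<^sub>R q \<beta>)"
      "c = 0 \<longrightarrow> a = 1 \<and> 0 < b" by blast
    have "cross (q (bar \<beta>)) (p (nxt \<beta>)) = 0"
      using line_pt_eq_iff[OF pq_nonzero(2) pq_nonzero(1), of "bar \<beta>" "nxt \<beta>"] nxt[of \<beta>]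
      by (simp add: line_pt_pq)
    then obtain l where l: "p (nxt \<beta>) = l *\<^sub>R q (bar \<beta>)"
      using cross_zero_imp_parallel pq_nonzero by metis
    obtain m k where "G \<beta> *v q (bar \<beta>) = k *\<^sub>R p \<beta>" using side_map by metis
    then have "cross (p \<beta>) (G \<beta> *v p (nxt \<beta>)) = 0"
      unfolding l by (simp add: matrix_vector_mult_scaleR cross_simps)
    then have "c = 0" using T(1,6) cross_pq[of \<beta>] by (auto simp: cross_simps)
    with T show ?thesis by (intro exI[of _ e] exI[of _ b] exI[of _ d]) simp
  qed
  let ?P = "prefix_mat G (\<lambda>i. (nxt ^^ i) \<alpha>)"
  \<comment> \<open>The coefficient \<open>B\<close> collects the positive drift along
    \<open>p \<alpha>\<close>, which will show that the closed product is not trivial.\<close>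
  have "\<exists>e B D. (e = 1 \<or> e = - 1) \<and> 0 < D \<and> 0 \<le> B \<and> (0 < k \<longrightarrow> 0 < B)
      \<and> ?P k *v p ((nxt ^^ k) \<alpha>) = e *\<^sub>R p \<alpha> \<and> ?P k *v q ((nxt ^^ k) \<alpha>) = e *\<^sub>R (B *\<^sub>R p \<alpha> + D *\<^sub>R q \<alpha>)" for k
  proof (induction k)
    case 0
    show ?case by (intro exI[of _ 1] exI[of _ 0]) (simp add: prefix_mat_0)
  next
    case (Suc k)
    then obtain e B D where *: "e = 1 \<or> e = - 1" "0 < D" "0 \<le> B"
      "?P k *v p ((nxt ^^ k) \<alpha>) = e *\<^sub>R p \<alpha>" "?P k *v q ((nxt ^^ k) \<alpha>) = e *\<^sub>R (B *\<^sub>R p \<alpha> + D *\<^sub>R q \<alpha>)" by blast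
    obtain e' b d where T: "e' = 1 \<or> e' = - 1" "0 < b" "0 < d"
      "G ((nxt ^^ k) \<alpha>) *v p (nxt ((nxt ^^ k) \<alpha>)) = e' *\<^sub>R p ((nxt ^^ k) \<alpha>)"
      "G ((nxt ^^ k) \<alpha>) *v q (nxt ((nxt ^^ k) \<alpha>)) = e' *\<^sub>R (b *\<^sub>R p ((nxt ^^ k) \<alpha>) + d *\<^sub>R q ((nxt ^^ k) \<alpha>))"
      using step by blast
    have "?P (Suc k) *v p ((nxt ^^ Suc k) \<alpha>) = (e * e') *\<^sub>R p \<alpha>"
      by (simp add: prefix_mat_Suc T(4) *(4) matrix_vector_mult_scaleR mult.commute flip: matrix_vector_mul_assoc)
    moreover have "?P (Suc k) *v q ((nxt ^^ Suc k) \<alpha>) = (e * e') *\<^sub>R ((b + d * B) *\<^sub>R p \<alpha> + (d * D) *\<^sub>R q \<alpha>)"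
      by (simp add: prefix_mat_Suc T(5) *(4,5) matrix_vector_mult_scaleR matrix_vector_right_distrib
          algebra_simps flip: matrix_vector_mul_assoc)
    moreover have "0 < b + d * B" "0 < d * D" "e * e' = 1 \<or> e * e' = - 1"
      using *(1-3) T(1-3) by (auto simp: add_pos_nonneg)
    ultimately show ?case by (meson less_imp_le)
  qed
  from this[of n] n obtain e B D where P: "e = 1 \<or> e = - 1" "0 < D" "0 < B"
    "?P n *v p \<alpha> = e *\<^sub>R p \<alpha>" "?P n *v q \<alpha> = e *\<^sub>R (B *\<^sub>R p \<alpha> + D *\<^sub>R q \<alpha>)" by auto
  \<comment> \<open>Squaring removes two signs at once: that of the fixed vector and that of
    membership in the Veech group.\<close>
  define H where "H = ?P n ** ?P n"
  have H: "H \<in> veech_group S" unfolding H_def by (rule up_to_sign(3)[OF veech(1) up_to_sign_prefix])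
  have Hp: "H *v p \<alpha> = p \<alpha>"
    using P(1) by (auto simp: H_def P(4) matrix_vector_mult_scaleR simp flip: matrix_vector_mul_assoc)
  then obtain \<tau> where \<tau>: "H = shear \<tau> (p \<alpha>)"
    using parabolic_shear[OF subgroup_SL2(1)[OF veech(1) H] _ pq_nonzero(1)] by blast
  have "H *v q \<alpha> = (B + D * B) *\<^sub>R p \<alpha> + (D * D) *\<^sub>R q \<alpha>"
    using P(1) by (auto simp: H_def P(4,5) matrix_vector_mult_scaleR matrix_vector_right_distrib
        algebra_simps simp flip: matrix_vector_mul_assoc)
  \<comment> \<open>For \<open>\<tau> = 0\<close> the matrix would be the identity and this
    \<open>cross\<close> would be 0.\<close>
  then have "cross (H *v q \<alpha>) (q \<alpha>) = (B + D * B) * cross (p \<alpha>) (q \<alpha>)"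
    by (simp add: cross_simps)
  also have "\<dots> > 0" using P(2,3) cross_pq[of \<alpha>] by (simp add: add_pos_pos)
  finally have "\<tau> \<noteq> 0" using \<tau> by (auto simp: shear_mult cross_simps)
  with H \<tau> show ?thesis by blast
qed

lemma orbit_finite:
  "finite {P *v p \<alpha> | P \<alpha>. P \<in> up_to_sign (veech_group S) \<and> norm (P *v p \<alpha>) \<le> R}"
  "finite {P *v q \<alpha> | P \<alpha>. P \<in> up_to_sign (veech_group S) \<and> norm (P *v q \<alpha>) \<le> R}"
proof -
  have "finite {P *v p \<alpha> | P. P \<in> up_to_sign (veech_group S) \<and> norm (P *v p \<alpha>) \<le> R}" for \<alpha>
    using vertex_parabolic[of \<alpha>] parabolic_orbit_finite[OF veech] by blast
  then have "finite (\<Union>\<alpha>. {P *v p \<alpha> | P. P \<in> up_to_sign (veech_group S) \<and> norm (P *v p \<alpha>) \<le> R})"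
    by simp
  then show 1: "finite {P *v p \<alpha> | P \<alpha>. P \<in> up_to_sign (veech_group S) \<and> norm (P *v p \<alpha>) \<le> R}"
    by (rule finite_subset[rotated]) blast
  \<comment> \<open>A left vector is, up to sign, the right vector of the neighbouring side: both
    are shortest holonomies in one direction, compared by the identity matrix.\<close>
  have "\<exists>P' \<beta>. P' \<in> up_to_sign (veech_group S) \<and> P *v q \<alpha> = P' *v p \<beta>"
    if P: "P \<in> up_to_sign (veech_group S)" for P \<alpha>
  proof -
    obtain \<beta> where \<beta>: "\<xi>l \<alpha> = \<xi>r \<beta>" using vertices(1) vertices(2)[of \<alpha>] by auto
    have "cross (p \<beta>) (q \<alpha>) = 0"
      using line_pt_eq_iff[OF pq_nonzero(1) pq_nonzero(2), of \<beta> \<alpha>] \<beta> by (simp add: line_pt_pq)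
    then obtain c where c: "q \<alpha> = c *\<^sub>R p \<beta>" using cross_zero_imp_parallel pq_nonzero by metis
    then have "\<bar>c\<bar> = 1"
      using shortest_holonomy_scale[OF surface veech(1) up_to_sign(5)[OF veech(1)] shortest(2)[of \<alpha>] shortest(1)[of \<beta>]]
      by simp
    then have "c = 1 \<or> c = - 1" by linarith
    then have "P *v q \<alpha> = P *v p \<beta> \<or> P *v q \<alpha> = (- P) *v p \<beta>"
      by (auto simp: c vec_eq_iff matrix_vector_mult_def sum_2)
    moreover have "- P \<in> up_to_sign (veech_group S)" using P by (auto simp: up_to_sign_def)
    ultimately show ?thesis using P by blast
  qed
  then have "{P *v q \<alpha> | P \<alpha>. P \<in> up_to_sign (veech_group S) \<and> norm (P *v q \<alpha>) \<le> R}
      \<subseteq> {P *v p \<alpha> | P \<alpha>. P \<in> up_to_sign (veech_group S) \<and> norm (P *v p \<alpha>) \<le> R}"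
    by (smt (verit) Collect_mono mem_Collect_eq)
  with 1 show "finite {P *v q \<alpha> | P \<alpha>. P \<in> up_to_sign (veech_group S) \<and> norm (P *v q \<alpha>) \<le> R}"
    by (rule finite_subset[rotated])
qed

end

section \<open>Continued fractions and areas\<close>

lemma mat_prod_Cons: "mat_prod (M # Ms) = M ** mat_prod Ms"
  by (simp add: mat_prod_def)

lemma Area_cross:
  "Area v \<theta> = \<bar>cross v (vector [- sin \<theta>, cos \<theta>])\<bar> * \<bar>v \<bullet> vector [- sin \<theta>, cos \<theta>]\<bar>"
proof -
  have "Re (cis (- \<theta>) * to_complex v) = cross v (vector [- sin \<theta>, cos \<theta>])"
    "Im (cis (- \<theta>) * to_complex v) = v \<bullet> vector [- sin \<theta>, cos \<theta>]"
    by (simp_all add: to_complex_def cross_def inner_vec_def sum_2 algebra_simps)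
  then show ?thesis by (simp add: Area_def)
qed

lemma mat_prod_conjugate:
  assumes "det A \<noteq> 0" "\<And>x. x \<in> set xs \<Longrightarrow> f x = A ** g x ** matrix_inv A"
  shows "mat_prod (map f xs) = A ** mat_prod (map g xs) ** matrix_inv A"
  using assms(2)
proof (induction xs)
  case Nil
  show ?case by (simp add: mat_prod_def matrix_inv_mult(1)[OF assms(1)])
next
  case (Cons x xs)
  have "mat_prod (map f (x # xs)) = A ** g x ** (matrix_inv A ** A) ** mat_prod (map g xs) ** matrix_inv A"
    using Cons by (simp add: mat_prod_Cons matrix_mul_assoc)
  also have "\<dots> = A ** mat_prod (map g (x # xs)) ** matrix_inv A"
    by (simp add: matrix_inv_mult(2)[OF assms(1)] mat_prod_Cons matrix_mul_assoc)
  finally show ?case .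
qed

lemma matrix_inv_unique:
  fixes A B :: "real^2^2"
  assumes "A ** B = mat 1" "det A \<noteq> 0"
  shows "matrix_inv A = B"
  using assms matrix_inv_mult(2)[OF assms(2)] by (metis matrix_mul_assoc matrix_mul_lid matrix_mul_rid)

text \<open>Conjugating by \<open>matrix_inv (W \<alpha>) ** G \<alpha>\<close>, the products of matrices \<open>cf_A\<close> telescope.\<close>

lemma cf_plus_eq:
  assumes W: "det (W \<alpha>) \<noteq> 0" and G: "det (G \<alpha>) \<noteq> 0"
  shows "cf_plus G W \<alpha> (map b [0..<Suc k])
    = image_of_inf (matrix_inv (W \<alpha>) ** G \<alpha> ** prefix_mat G b k ** W (b k))"
proof -
  let ?A = "matrix_inv (W \<alpha>) ** G \<alpha>"
  have "det (matrix_inv (W \<alpha>)) * det (W \<alpha>) = 1"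
    using matrix_inv_mult(2)[OF W] det_mul[of "matrix_inv (W \<alpha>)" "W \<alpha>"] by simp
  then have A: "det ?A \<noteq> 0" using G by (auto simp: det_mul)
  have "?A ** (matrix_inv (G \<alpha>) ** W \<alpha>)
      = matrix_inv (W \<alpha>) ** (G \<alpha> ** matrix_inv (G \<alpha>)) ** W \<alpha>" by (simp add: matrix_mul_assoc)
  also have "\<dots> = mat 1" by (simp add: matrix_inv_mult W G)
  finally have inv: "matrix_inv ?A = matrix_inv (G \<alpha>) ** W \<alpha>" using A by (rule matrix_inv_unique)
  have cf: "cf_A G W \<alpha> \<beta> = ?A ** G \<beta> ** matrix_inv ?A" for \<beta>
    unfolding inv cf_A_def by (simp add: matrix_mul_assoc)
  have "mat_prod (map (cf_A G W \<alpha>) (map b [0..<k])) ** ?A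
      = ?A ** mat_prod (map G (map b [0..<k])) ** (matrix_inv ?A ** ?A)"
    by (subst mat_prod_conjugate[OF A, of _ _ G]) (simp_all add: cf matrix_mul_assoc)
  also have "\<dots> = ?A ** prefix_mat G b k"
    unfolding matrix_inv_mult(2)[OF A] by (simp add: prefix_mat_def comp_def)
  finally have "mat_prod (map (cf_A G W \<alpha>) (map b [0..<k])) ** ?A = ?A ** prefix_mat G b k" .
  then show ?thesis
    by (simp add: cf_plus_def butlast_append matrix_mul_assoc)
qed

text \<open>The products of \<open>cf_B\<close> telescope with conjugator
  \<open>swap_mat ** transpose (W \<alpha>)\<close>. Transposition reverses products, so the
  reversed word gives the transpose of the ordinary prefix matrix.\<close>

lemma cf_minus_eq:
  assumes "det (W \<alpha>) \<noteq> 0" "0 < n"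
  shows "cf_minus G W \<alpha> (rev (map a [0..<n])) = image_of_inf
    (swap_mat ** transpose (prefix_mat G a n ** W \<alpha>) ** matrix_inv (transpose (W (a 0))) ** swap_mat)"
proof -
  let ?A = "swap_mat ** transpose (W \<alpha>)"
  have sw: "swap_mat ** swap_mat = mat 1" "det swap_mat \<noteq> 0"
    by (simp_all add: swap_mat_def vec_eq_iff forall_2 matrix_matrix_mult_def mat_def sum_2 det_2)
  have T: "det (transpose (W \<alpha>)) \<noteq> 0" using assms(1) by (simp add: det_transpose)
  have A: "det ?A \<noteq> 0" using sw(2) T by (simp add: det_mul)
  have "?A ** (matrix_inv (transpose (W \<alpha>)) ** swap_mat)
      = swap_mat ** (transpose (W \<alpha>) ** matrix_inv (transpose (W \<alpha>))) ** swap_mat"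
    by (simp add: matrix_mul_assoc)
  also have "\<dots> = mat 1" unfolding matrix_inv_mult(1)[OF T] by (simp add: sw)
  finally have inv: "matrix_inv ?A = matrix_inv (transpose (W \<alpha>)) ** swap_mat"
    using A by (rule matrix_inv_unique)
  have cf: "cf_B G W \<alpha> \<beta> = ?A ** transpose (G \<beta>) ** matrix_inv ?A" for \<beta>
    unfolding inv cf_B_def by (simp add: matrix_mul_assoc)
  have pre: "mat_prod (map (\<lambda>\<beta>. transpose (G \<beta>)) (rev (map a [0..<m]))) = transpose (prefix_mat G a m)" for m
  proof (induction m)
    case 0
    show ?case by (simp add: prefix_mat_0 mat_prod_def transpose_mat)
  next
    case (Suc m)
    then show ?case by (simp add: prefix_mat_Suc mat_prod_Cons matrix_transpose_mul)
  qed
  have "mat_prod (map (cf_B G W \<alpha>) (rev (map a [0..<n]))) ** ?A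
      = ?A ** mat_prod (map (\<lambda>\<beta>. transpose (G \<beta>)) (rev (map a [0..<n]))) ** (matrix_inv ?A ** ?A)"
    by (subst mat_prod_conjugate[OF A, of _ _ "\<lambda>\<beta>. transpose (G \<beta>)"]) (simp_all only: cf matrix_mul_assoc)
  also have "\<dots> = ?A ** transpose (prefix_mat G a n)"
    unfolding matrix_inv_mult(2)[OF A] pre by simp
  finally have "mat_prod (map (cf_B G W \<alpha>) (rev (map a [0..<n]))) ** ?A = ?A ** transpose (prefix_mat G a n)" .
  \<comment> \<open>The innermost letter is \<open>a 0\<close>, provided that the word is not
    empty.\<close>
  moreover have "last (rev (map a [0..<n])) = a 0"
    using assms(2) by (simp add: last_rev hd_map)
  ultimately show ?thesis
    by (simp add: cf_minus_def matrix_transpose_mul matrix_mul_assoc)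
qed

text \<open>The first column of \<open>M\<close> holds the coordinates of the first column of
  \<open>Y\<close> in the basis \<open>X\<close>; Cramer's rule gives their quotient.\<close>

lemma image_of_inf_cross:
  assumes "X ** M = Y" "det X \<noteq> 0"
  shows "image_of_inf M = (if cross (column 1 X) (column 1 Y) = 0 then \<infinity>
    else ereal (cross (column 1 Y) (column 2 X) / cross (column 1 X) (column 1 Y)))"
proof -
  have Y: "column 1 Y = M$1$1 *\<^sub>R column 1 X + M$2$1 *\<^sub>R column 2 X"
    unfolding assms(1)[symmetric] column_matrix_mult
    by (subst matrix_vector_columns) (simp add: column_def)
  then have "cross (column 1 X) (column 1 Y) = M$2$1 * det X" "cross (column 1 Y) (column 2 X) = M$1$1 * det X"
    by (simp_all add: cross_simps cross_columns)
  then show ?thesis using assms(2) by (simp add: image_of_inf_def)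
qed

lemma image_of_inf_swap:
  "image_of_inf (swap_mat ** transpose X ** B ** swap_mat) = (if column 1 X \<bullet> column 2 B = 0 then \<infinity>
    else ereal ((column 2 X \<bullet> column 2 B) / (column 1 X \<bullet> column 2 B)))"
  by (simp add: image_of_inf_def swap_mat_def matrix_matrix_mult_def transpose_def column_def
      inner_vec_def sum_2)

context veech_coding
begin

text \<open>Chooses the coefficients as functions of two letters; finiteness of the alphabet yields
  the uniform \<open>\<epsilon>\<close>.\<close>

lemma transition_coefficients:
  obtains t a b c d :: "'a \<Rightarrow> 'a \<Rightarrow> real" and \<epsilon> where "0 < \<epsilon>"
    "\<And>\<alpha> \<beta>. \<beta> \<noteq> bar \<alpha> \<Longrightarrow> (t \<alpha> \<beta> = 1 \<or> t \<alpha> \<beta> = - 1) \<and> 0 < a \<alpha> \<beta> \<and> 0 < d \<alpha> \<beta> \<and> 0 \<le> b \<alpha> \<beta> \<and> 0 \<le> c \<alpha> \<beta>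
      \<and> G \<alpha> *v p \<beta> = t \<alpha> \<beta> *\<^sub>R (a \<alpha> \<beta> *\<^sub>R p \<alpha> + c \<alpha> \<beta> *\<^sub>R q \<alpha>)
      \<and> G \<alpha> *v q \<beta> = t \<alpha> \<beta> *\<^sub>R (b \<alpha> \<beta> *\<^sub>R p \<alpha> + d \<alpha> \<beta> *\<^sub>R q \<alpha>)
      \<and> (c \<alpha> \<beta> = 0 \<longrightarrow> a \<alpha> \<beta> = 1 \<and> \<epsilon> \<le> b \<alpha> \<beta>) \<and> (b \<alpha> \<beta> = 0 \<longrightarrow> d \<alpha> \<beta> = 1 \<and> \<epsilon> \<le> c \<alpha> \<beta>)"
proof -
  define ok where "ok \<alpha> \<beta> = (\<lambda>(t, a, b, c, d). (t = 1 \<or> t = - 1) \<and> 0 < a \<and> 0 < d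
    \<and> (0::real) \<le> b \<and> (0::real) \<le> c
    \<and> G \<alpha> *v p \<beta> = t *\<^sub>R (a *\<^sub>R p \<alpha> + c *\<^sub>R q \<alpha>) \<and> G \<alpha> *v q \<beta> = t *\<^sub>R (b *\<^sub>R p \<alpha> + d *\<^sub>R q \<alpha>)
    \<and> (c = 0 \<longrightarrow> a = 1 \<and> 0 < b) \<and> (b = 0 \<longrightarrow> d = 1 \<and> 0 < c))" for \<alpha> \<beta>
  define f where "f \<alpha> \<beta> = (SOME x. ok \<alpha> \<beta> x)" for \<alpha> \<beta>
  have okf: "ok \<alpha> \<beta> (f \<alpha> \<beta>)" if \<beta>: "\<beta> \<noteq> bar \<alpha>" for \<alpha> \<beta>
  proof -
    obtain t a b c d where "ok \<alpha> \<beta> (t, a, b, c, d)"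
      unfolding ok_def prod.case using transition[OF \<beta>] by blast
    then show ?thesis unfolding f_def by (rule someI)
  qed
  define t a b c d where "t \<alpha> \<beta> = fst (f \<alpha> \<beta>)" and "a \<alpha> \<beta> = fst (snd (f \<alpha> \<beta>))"
    and "b \<alpha> \<beta> = fst (snd (snd (f \<alpha> \<beta>)))" and "c \<alpha> \<beta> = fst (snd (snd (snd (f \<alpha> \<beta>))))"
    and "d \<alpha> \<beta> = snd (snd (snd (snd (f \<alpha> \<beta>))))" for \<alpha> \<beta>
  have f: "f \<alpha> \<beta> = (t \<alpha> \<beta>, a \<alpha> \<beta>, b \<alpha> \<beta>, c \<alpha> \<beta>, d \<alpha> \<beta>)" for \<alpha> \<beta>
    by (simp add: t_def a_def b_def c_def d_def)
  note T = okf[unfolded ok_def f prod.case]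
  \<comment> \<open>The element 1 only guarantees that the minimum is taken over a nonempty
    set.\<close>
  define B where "B = {x \<in> insert 1 (range (case_prod b) \<union> range (case_prod c)). 0 < x}"
  have B: "finite B" "1 \<in> B" by (simp_all add: B_def)
  define \<epsilon> where "\<epsilon> = Min B"
  have "\<epsilon> \<in> B" using B Min_in unfolding \<epsilon>_def by blast
  then have "0 < \<epsilon>" by (simp add: B_def)
  have le: "\<epsilon> \<le> x" if "x \<in> B" for x using that B by (simp add: \<epsilon>_def)
  have "\<epsilon> \<le> b \<alpha> \<beta>" if "0 < b \<alpha> \<beta>" for \<alpha> \<beta>
    using that by (intro le) (auto simp: B_def intro!: rev_image_eqI[of "(\<alpha>, \<beta>)"])
  moreover have "\<epsilon> \<le> c \<alpha> \<beta>" if "0 < c \<alpha> \<beta>" for \<alpha> \<beta>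
    using that by (intro le) (auto simp: B_def intro!: rev_image_eqI[of "(\<alpha>, \<beta>)"])
  ultimately have "(c \<alpha> \<beta> = 0 \<longrightarrow> a \<alpha> \<beta> = 1 \<and> \<epsilon> \<le> b \<alpha> \<beta>) \<and> (b \<alpha> \<beta> = 0 \<longrightarrow> d \<alpha> \<beta> = 1 \<and> \<epsilon> \<le> c \<alpha> \<beta>)"
    if \<beta>: "\<beta> \<noteq> bar \<alpha>" for \<alpha> \<beta>
    using T[OF \<beta>] by blast
  with T show ?thesis by (intro that[of \<epsilon> t a d b c] \<open>0 < \<epsilon>\<close> conjI) blast+
qed

section \<open>Position of a non-cuspidal direction in its wedges\<close>

lemma cuspidal_vertex:
  assumes "psl P \<in> \<Gamma>" "v \<noteq> 0" "line_pt v \<in> V"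
  shows "cuspidal \<Gamma> V (line_pt (P *v v))"
proof -
  have "det P = 1" using up_to_sign(1)[OF veech(1) up_to_sign_G[OF assms(1)]] .
  then have "line_pt (P *v v) = disk_act P (line_pt v)" using assms(2) by (simp add: disk_act_line_pt)
  moreover have "P \<in> psl P" by (simp add: psl_eq)
  ultimately show ?thesis using assms unfolding cuspidal_def by blast
qed

lemma arc_line_pt:
  assumes "\<zeta> \<in> cw_arc (\<xi>r \<alpha>) (\<xi>l \<alpha>)"
  obtains v where "v \<noteq> 0" "line_pt v = \<zeta>"
proof -
  have "p \<alpha> $ 1 \<noteq> 0 \<or> p \<alpha> $ 2 \<noteq> 0"
    using pq_nonzero(1)[of \<alpha>] by (auto simp: vec_eq_iff forall_2)
  then have "to_complex (p \<alpha>) \<noteq> 0" by (auto simp: to_complex_def complex_eq_iff)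
  then have "cmod (\<xi>r \<alpha>) = 1"
    by (simp add: line_pt_def norm_divide flip: line_pt_pq)
  then have "cmod \<zeta> = 1" using assms by (auto simp: cw_arc_def norm_mult)
  then show ?thesis using that unit_circle_line_pt by blast
qed

text \<open>Membership in the arc gives the weak inequality. Equality would make \<open>u\<close>
  parallel to the image of a vertex, that is, cuspidal.\<close>

lemma direction_in_wedge:
  assumes nc: "\<not> cuspidal \<Gamma> V (line_pt u)" and "u \<noteq> 0" and P: "psl P \<in> \<Gamma>"
    and arc: "line_pt u \<in> disk_act P ` cw_arc (\<xi>r \<alpha>) (\<xi>l \<alpha>)"
  shows "0 < cross (P *v p \<alpha>) u * cross u (P *v q \<alpha>)"
proof -
  have det: "det P = 1" using up_to_sign(1)[OF veech(1) up_to_sign_G[OF P]] .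
  have nz: "P *v v \<noteq> 0" if "v \<noteq> 0" for v
    using that det by (metis invertible_det_nz matrix_left_invertible_ker invertible_def zero_neq_one)
  obtain \<zeta> where \<zeta>: "\<zeta> \<in> cw_arc (\<xi>r \<alpha>) (\<xi>l \<alpha>)" "line_pt u = disk_act P \<zeta>" using arc by blast
  obtain v where v: "v \<noteq> 0" "line_pt v = \<zeta>" using arc_line_pt[OF \<zeta>(1)] .
  have "line_pt (P *v v) = line_pt u"
    using disk_act_line_pt[of P v] v \<zeta>(2) det by simp
  then have "cross (P *v v) u = 0" using line_pt_eq_iff[OF nz[OF v(1)] \<open>u \<noteq> 0\<close>] by simp
  then obtain c where c: "u = c *\<^sub>R (P *v v)" using cross_zero_imp_parallel nz[OF v(1)] by blast
  have "cross (P *v p \<alpha>) u * cross u (P *v q \<alpha>) = c\<^sup>2 * (cross (p \<alpha>) v * cross v (q \<alpha>))"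
    by (simp add: c cross_simps cross_matrix det power2_eq_square)
  also have "\<dots> \<ge> 0" using \<zeta>(1) v arc_iff[OF v(1)] by simp
  finally have "0 \<le> cross (P *v p \<alpha>) u * cross u (P *v q \<alpha>)" .
  moreover have "cross (P *v p \<alpha>) u \<noteq> 0"
    using nc cuspidal_vertex[OF P pq_nonzero(1)] vertices(1) line_pt_eq_iff[OF nz[OF pq_nonzero(1)] \<open>u \<noteq> 0\<close>]
    by (metis line_pt_pq(1) rangeI)
  moreover have "cross u (P *v q \<alpha>) \<noteq> 0"
    using nc cuspidal_vertex[OF P pq_nonzero(2)] vertices(2) line_pt_eq_iff[OF \<open>u \<noteq> 0\<close> nz[OF pq_nonzero(2)]]
    by (metis line_pt_pq(2))
  ultimately show ?thesis by (simp add: order_less_le)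
qed

text \<open>The signs are chosen such that the direction \<open>u\<close> lies in the cone itself.\<close>

lemma signed_wedges:
  assumes nc: "\<not> cuspidal \<Gamma> V (line_pt u)" and "u \<noteq> 0"
    and exp: "boundary_expansion bar G \<xi>r \<xi>l w (line_pt u)"
  obtains e x y :: "nat \<Rightarrow> real" and r l where
    "\<And>n. e n = 1 \<or> e n = - 1"
    "\<And>n. column 1 (wedge_seq G W w n) = e n *\<^sub>R r n" "\<And>n. column 2 (wedge_seq G W w n) = e n *\<^sub>R l n"
    "\<And>n. u = x n *\<^sub>R r n + y n *\<^sub>R l n" "\<And>n. 0 < x n" "\<And>n. 0 < y n"
    "\<And>n. cross (r n) (l n) = det (W (w n))"
    "\<And>v. 0 < u \<bullet> v \<Longrightarrow> filterlim (\<lambda>n. r n \<bullet> v) at_top sequentially"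
    "\<And>v. 0 < u \<bullet> v \<Longrightarrow> filterlim (\<lambda>n. l n \<bullet> v) at_top sequentially"
    "\<And>v v'. cross v u \<noteq> 0 \<Longrightarrow> (\<lambda>n. cross (r n) v' / cross v (r n)) \<longlonglongrightarrow> cross u v' / cross v u"
proof -
  define P where "P n = prefix_mat G w n" for n
  have P: "psl (P n) \<in> \<Gamma>" "det (P n) = 1" "P n \<in> up_to_sign (veech_group S)" for n
    by (simp_all add: P_def psl_prefix det_prefix up_to_sign_prefix)
  define r0 l0 where "r0 n = P n *v p (w n)" and "l0 n = P n *v q (w n)" for n
  have col: "column 1 (wedge_seq G W w n) = r0 n" "column 2 (wedge_seq G W w n) = l0 n" for n
    by (simp_all add: wedge_seq_def column_matrix_mult r0_def l0_def P_def)
  have det0: "cross (r0 n) (l0 n) = det (W (w n))" for n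
    by (simp add: r0_def l0_def cross_matrix P cross_columns)
  have pos0: "0 < cross (r0 n) u * cross u (l0 n)" for n
    unfolding r0_def l0_def
    using exp by (intro direction_in_wedge nc \<open>u \<noteq> 0\<close> P) (simp add: boundary_expansion_def P_def)
  define e where "e n = sgn (cross (r0 n) u)" for n
  have "cross (r0 n) u \<noteq> 0" for n using pos0[of n] by auto
  then have e: "e n = 1 \<or> e n = - 1" "e n * e n = 1" "0 < e n * cross (r0 n) u" for n
    using linorder_less_linear[of "cross (r0 n) u" 0] by (auto simp: e_def)
  define r l where "r n = e n *\<^sub>R r0 n" and "l n = e n *\<^sub>R l0 n" for n
  have rl0: "r0 n = e n *\<^sub>R r n" "l0 n = e n *\<^sub>R l n" for n
    using e(2)[of n] by (simp_all add: r_def l_def)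
  define \<delta> where "\<delta> n = det (W (w n))" for n
  have rl: "cross (r n) (l n) = \<delta> n" for n
    using e(1)[of n] by (auto simp: r_def l_def cross_simps det0 \<delta>_def)
  have \<delta>: "0 < \<delta> n" for n using cross_pq[of "w n"] by (simp add: \<delta>_def cross_columns)
  have ru: "0 < cross (r n) u" for n using e(3) by (simp add: r_def cross_simps)
  have ul: "0 < cross u (l n)" for n
  proof -
    have "cross (r n) u * cross u (l n) = cross (r0 n) u * cross u (l0 n)"
      using e(1)[of n] by (auto simp: r_def l_def cross_simps)
    then show ?thesis using pos0[of n] ru[of n] zero_less_mult_pos by metis
  qed
  define x y where "x n = cross u (l n) / \<delta> n" and "y n = cross (r n) u / \<delta> n" for n
  have xy: "0 < x n" "0 < y n" for n using ru ul \<delta> by (simp_all add: x_def y_def)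
  have u: "u = x n *\<^sub>R r n + y n *\<^sub>R l n" for n
  proof -
    have "u = (1 / \<delta> n) *\<^sub>R (cross (r n) (l n) *\<^sub>R u)" using \<delta>[of n] by (simp add: rl)
    also have "\<dots> = x n *\<^sub>R r n + y n *\<^sub>R l n"
      unfolding cross_cramer[of "r n" "l n" u] by (simp add: x_def y_def scaleR_right_distrib)
    finally show ?thesis .
  qed
  obtain \<epsilon> :: real and t a d b c :: "'a \<Rightarrow> 'a \<Rightarrow> real" where "0 < \<epsilon>" and T:
    "\<And>\<alpha> \<beta>. \<beta> \<noteq> bar \<alpha> \<Longrightarrow> (t \<alpha> \<beta> = 1 \<or> t \<alpha> \<beta> = - 1) \<and> 0 < a \<alpha> \<beta> \<and> 0 < d \<alpha> \<beta> \<and> 0 \<le> b \<alpha> \<beta> \<and> 0 \<le> c \<alpha> \<beta>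
      \<and> G \<alpha> *v p \<beta> = t \<alpha> \<beta> *\<^sub>R (a \<alpha> \<beta> *\<^sub>R p \<alpha> + c \<alpha> \<beta> *\<^sub>R q \<alpha>)
      \<and> G \<alpha> *v q \<beta> = t \<alpha> \<beta> *\<^sub>R (b \<alpha> \<beta> *\<^sub>R p \<alpha> + d \<alpha> \<beta> *\<^sub>R q \<alpha>)
      \<and> (c \<alpha> \<beta> = 0 \<longrightarrow> a \<alpha> \<beta> = 1 \<and> \<epsilon> \<le> b \<alpha> \<beta>) \<and> (b \<alpha> \<beta> = 0 \<longrightarrow> d \<alpha> \<beta> = 1 \<and> \<epsilon> \<le> c \<alpha> \<beta>)"
    by (rule transition_coefficients) (rule that; assumption)
  have "w (Suc n) \<noteq> bar (w n)" for n using exp by (simp add: boundary_expansion_def)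
  note Tw = T[OF this]
  define t' A B C D where "t' n = t (w n) (w (Suc n))" and "A n = a (w n) (w (Suc n))"
    and "B n = b (w n) (w (Suc n))" and "C n = c (w n) (w (Suc n))" and "D n = d (w n) (w (Suc n))" for n
  have ABCD: "0 < A n" "0 < D n" "0 \<le> B n" "0 \<le> C n" "C n = 0 \<Longrightarrow> A n = 1 \<and> \<epsilon> \<le> B n"
    "B n = 0 \<Longrightarrow> D n = 1 \<and> \<epsilon> \<le> C n" "t' n = 1 \<or> t' n = - 1" for n
    using Tw[of n] by (simp_all add: t'_def A_def B_def C_def D_def)
  have r0S: "r0 (Suc n) = t' n *\<^sub>R (A n *\<^sub>R r0 n + C n *\<^sub>R l0 n)"
    and l0S: "l0 (Suc n) = t' n *\<^sub>R (B n *\<^sub>R r0 n + D n *\<^sub>R l0 n)" for n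
    using Tw[of n] by (simp_all add: r0_def l0_def P_def prefix_mat_Suc t'_def A_def B_def C_def D_def
        matrix_vector_mult_scaleR matrix_vector_right_distrib flip: matrix_vector_mul_assoc)
  define s where "s n = e (Suc n) * t' n * e n" for n
  have s1: "s n = 1 \<or> s n = - 1" for n
    using e(1)[of n] e(1)[of "Suc n"] ABCD(7)[of n] by (auto simp: s_def)
  have rS': "r (Suc n) = s n *\<^sub>R (A n *\<^sub>R r n + C n *\<^sub>R l n)"
    and lS': "l (Suc n) = s n *\<^sub>R (B n *\<^sub>R r n + D n *\<^sub>R l n)" for n
    unfolding r_def[of "Suc n"] l_def[of "Suc n"] r0S l0S rl0[of n] s_def
    by (simp_all add: algebra_simps)
  \<comment> \<open>\<open>cross u (l n)\<close> is positive and equals \<open>s n\<close> times a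
    nonnegative number, so consecutive cones are nested as cones and not merely up to sign.\<close>
  have s: "s n = 1" for n
  proof -
    have "cross u (l n) = s n * ((x (Suc n) * A n + y (Suc n) * B n) * \<delta> n)"
      by (subst u[of "Suc n"]) (simp add: rS' lS' cross_simps rl algebra_simps)
    moreover have "0 \<le> (x (Suc n) * A n + y (Suc n) * B n) * \<delta> n"
      using xy[of "Suc n"] ABCD[of n] \<delta>[of n] by (simp add: less_imp_le)
    ultimately show ?thesis using s1[of n] ul[of n] by auto
  qed
  have rS: "r (Suc n) = A n *\<^sub>R r n + C n *\<^sub>R l n" and lS: "l (Suc n) = B n *\<^sub>R r n + D n *\<^sub>R l n" for n
    using rS'[of n] lS'[of n] by (simp_all add: s)
  define \<Delta> where "\<Delta> = Max (range (\<lambda>\<alpha>. det (W \<alpha>)))"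
  have \<Delta>: "\<delta> n \<le> \<Delta>" for n by (simp add: \<Delta>_def \<delta>_def)
  \<comment> \<open>The chosen sign is absorbed into the matrix, which stays in
    \<open>up_to_sign\<close>; the signed vectors thus remain in the orbits that are locally
    finite.\<close>
  have signed: "\<exists>P'. P' \<in> up_to_sign (veech_group S) \<and> e n *\<^sub>R (P n *v v) = P' *v v" for n v
  proof -
    have "- P n *v v = - (P n *v v)" by (simp add: vec_eq_iff matrix_vector_mult_def sum_2)
    moreover have "- P n \<in> up_to_sign (veech_group S)" using P(3)[of n] by (auto simp: up_to_sign_def)
    ultimately show ?thesis using e(1)[of n] P(3)[of n] by (metis scaleR_minus1_left scaleR_one)
  qed
  have fin: "finite {r n | n. norm (r n) \<le> R}" "finite {l n | n. norm (l n) \<le> R}" for R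
  proof -
    have "{r n | n. norm (r n) \<le> R} \<subseteq> {P *v p \<alpha> | P \<alpha>. P \<in> up_to_sign (veech_group S) \<and> norm (P *v p \<alpha>) \<le> R}"
    proof
      fix z assume "z \<in> {r n | n. norm (r n) \<le> R}"
      then obtain n where n: "z = r n" "norm (r n) \<le> R" by blast
      moreover obtain P' where "P' \<in> up_to_sign (veech_group S)" "r n = P' *v p (w n)"
        using signed[of n "p (w n)"] unfolding r_def r0_def by blast
      ultimately show "z \<in> {P *v p \<alpha> | P \<alpha>. P \<in> up_to_sign (veech_group S) \<and> norm (P *v p \<alpha>) \<le> R}" by auto
    qed
    then show "finite {r n | n. norm (r n) \<le> R}" using orbit_finite(1) by (rule finite_subset)
    have "{l n | n. norm (l n) \<le> R} \<subseteq> {P *v q \<alpha> | P \<alpha>. P \<in> up_to_sign (veech_group S) \<and> norm (P *v q \<alpha>) \<le> R}"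
    proof
      fix z assume "z \<in> {l n | n. norm (l n) \<le> R}"
      then obtain n where n: "z = l n" "norm (l n) \<le> R" by blast
      moreover obtain P' where "P' \<in> up_to_sign (veech_group S)" "l n = P' *v q (w n)"
        using signed[of n "q (w n)"] unfolding l_def l0_def by blast
      ultimately show "z \<in> {P *v q \<alpha> | P \<alpha>. P \<in> up_to_sign (veech_group S) \<and> norm (P *v q \<alpha>) \<le> R}" by auto
    qed
    then show "finite {l n | n. norm (l n) \<le> R}" using orbit_finite(2) by (rule finite_subset)
  qed
  have nr: "filterlim (\<lambda>n. norm (r n)) at_top sequentially"
    by (rule fan_unbounded[where r = r and l = l and a = A and b = B and c = C and d = D
      and x = x and y = y and s = 1 and \<Delta> = \<Delta>, OF rS lS ABCD(3,4,1,2,5) \<open>0 < \<epsilon>\<close> u xy])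
      (simp_all add: rl \<delta> \<Delta> fin)
  \<comment> \<open>The mirror image of the recursion, for applying \<open>fan_unbounded\<close> to
    \<open>l\<close>.\<close>
  have lS2: "l (Suc n) = D n *\<^sub>R l n + B n *\<^sub>R r n" and rS2: "r (Suc n) = C n *\<^sub>R l n + A n *\<^sub>R r n"
    and u2: "u = y n *\<^sub>R l n + x n *\<^sub>R r n" for n
    using rS[of n] lS[of n] u[of n] by (simp_all add: add.commute)
  have nl: "filterlim (\<lambda>n. norm (l n)) at_top sequentially"
    by (rule fan_unbounded[where r = l and l = r and a = D and b = C and c = B and d = A
      and x = y and y = x and s = "- 1" and \<Delta> = \<Delta>, OF lS2 rS2 ABCD(4,3,2,1,6) \<open>0 < \<epsilon>\<close> u2 xy(2,1)])
      (simp_all add: rl \<delta> \<Delta> fin cross_commute[of "l _" "r _"])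
  have cone: "\<exists>s\<ge>0. \<exists>t\<ge>0. r n = s *\<^sub>R r 0 + t *\<^sub>R l 0" "\<exists>s\<ge>0. \<exists>t\<ge>0. l n = s *\<^sub>R r 0 + t *\<^sub>R l 0" for n
    using nested_cones[where r = r and l = l and a = A and b = B and c = C and d = D, OF rS lS less_imp_le[OF ABCD(1)] ABCD(3,4) less_imp_le[OF ABCD(2)]] by blast+
  have pos: "0 < cross (r n) (l n)" "cross (r n) (l n) \<le> \<Delta>" for n by (simp_all add: rl \<delta> \<Delta>)
  note lim = cone_limits[where r = r and l = l and x = x and y = y, OF cone u xy pos nr nl]
  show ?thesis
    by (rule that[of e r l x y]) (use e(1) rl0 u xy rl lim in \<open>simp_all add: col \<delta>_def\<close>)
qed

text \<open>The matrix of the \<open>k\<close>-th convergent is the transition from wedge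
  \<open>n\<close> to wedge \<open>n + 1 + k\<close>, so the convergent is the quotient of the
  coordinates of \<open>r (n + 1 + k)\<close> in wedge \<open>n\<close>. In the limit
  \<open>r\<close> is replaced by \<open>u\<close>.\<close>

lemma cf_plus_inf_coordinates:
  assumes e: "\<And>n. e n = 1 \<or> e n = - 1"
    and col: "\<And>n. column 1 (wedge_seq G W w n) = e n *\<^sub>R r n" "\<And>n. column 2 (wedge_seq G W w n) = e n *\<^sub>R l n"
    and pos: "0 < cross (r n) u" "0 < cross u (l n)"
    and lim: "(\<lambda>m. cross (r m) (l n) / cross (r n) (r m)) \<longlonglongrightarrow> cross u (l n) / cross (r n) u"
  shows "cf_plus_inf G W (w n) (\<lambda>k. w (n + 1 + k)) = ereal (cross u (l n) / cross (r n) u)"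
proof -
  have W: "det (W \<alpha>) \<noteq> 0" for \<alpha> using cross_pq[of \<alpha>] by (simp add: cross_columns)
  define b where "b = (\<lambda>k. w (n + 1 + k))"
  define g where "g k = cross (r (n + 1 + k)) (l n) / cross (r n) (r (n + 1 + k))" for k
  have cf: "cf_plus G W (w n) (map b [0..<Suc k])
    = (if cross (r n) (r (n + 1 + k)) = 0 then \<infinity> else ereal (g k))" for k
  proof -
    let ?M = "matrix_inv (W (w n)) ** G (w n) ** prefix_mat G b k ** W (b k)"
    have "wedge_seq G W w n ** ?M
      = prefix_mat G w n ** (W (w n) ** matrix_inv (W (w n))) ** G (w n) ** prefix_mat G b k ** W (b k)"
      by (simp add: wedge_seq_def matrix_mul_assoc)
    also have "\<dots> = prefix_mat G w (Suc n) ** prefix_mat G b k ** W (b k)"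
      unfolding matrix_inv_mult(1)[OF W] prefix_mat_Suc by simp
    also have "\<dots> = wedge_seq G W w (n + 1 + k)"
      using prefix_mat_add[of G w "n + 1" k] by (simp add: b_def wedge_seq_def)
    finally have "wedge_seq G W w n ** ?M = wedge_seq G W w (n + 1 + k)" .
    moreover have "det (wedge_seq G W w n) \<noteq> 0" by (simp add: wedge_seq_def det_mul det_prefix W)
    ultimately have "image_of_inf ?M = (if cross (r n) (r (n + 1 + k)) = 0 then \<infinity> else ereal (g k))"
      using e[of n] e[of "n + 1 + k"] by (auto simp: image_of_inf_cross col cross_simps g_def)
    then show ?thesis using cf_plus_eq[where W = W and G = G and \<alpha> = "w n" and b = b and k = k, OF W] by (simp add: det_G)
  qed
  have g: "g \<longlonglongrightarrow> cross u (l n) / cross (r n) u"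
    using LIMSEQ_ignore_initial_segment[OF lim, of "n + 1"] unfolding g_def by (simp add: add.commute)
  \<comment> \<open>Early convergents may be infinite, namely while the right ray is shared. There
    \<open>g\<close> is 0 by division by zero, so its eventual positivity excludes this
    case.\<close>
  have "0 < cross u (l n) / cross (r n) u" using pos by simp
  with g have "\<forall>\<^sub>F k in sequentially. 0 < g k" by (rule order_tendstoD)
  then have "\<forall>\<^sub>F k in sequentially. ereal (g k) = cf_plus G W (w n) (map b [0..<Suc k])"
    unfolding cf by eventually_elim (auto simp: g_def)
  then have "(\<lambda>k. cf_plus G W (w n) (map b [0..<Suc k])) \<longlonglongrightarrow> ereal (cross u (l n) / cross (r n) u)"
    using g by (intro Lim_transform_eventually[OF tendsto_ereal])
  then show ?thesis unfolding cf_plus_inf_def b_def by (rule limI)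
qed

lemma asymp_sameI:
  assumes "\<forall>\<^sub>F n in sequentially. x n = ereal (f n) \<and> y n = ereal (g n) \<and> f n - g n = c / (h n * k n)"
    and "filterlim h at_top sequentially" "filterlim k at_top sequentially"
  shows "asymp_same x y"
  unfolding asymp_same_def
proof (rule Lim_transform_eventually)
  have "(\<lambda>n. c / (h n * k n)) \<longlonglongrightarrow> 0"
    using assms(2,3) by (intro real_tendsto_divide_at_top[OF tendsto_const] filterlim_at_top_mult_at_top)
  then have "(\<lambda>n. ereal \<bar>c / (h n * k n)\<bar>) \<longlonglongrightarrow> ereal \<bar>0\<bar>"
    by (intro tendsto_ereal tendsto_rabs)
  then show "(\<lambda>n. ereal \<bar>c / (h n * k n)\<bar>) \<longlonglongrightarrow> 0" by (simp add: zero_ereal_def)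
  show "\<forall>\<^sub>F n in sequentially. ereal \<bar>c / (h n * k n)\<bar> = \<bar>x n - y n\<bar>"
    using assms(1) by eventually_elim (metis abs_ereal.simps(1) ereal_minus(1))
qed

text \<open>In the coordinates \<open>u = x n *\<^sub>R r n + y n *\<^sub>R l n\<close> one has \<open>1 / Area (r n) = (x n / y n +
  (l n \<bullet> u) / (r n \<bullet> u)) / det\<close>. The first summand is the forward continued fraction; the backward
  one is \<open>(l n \<bullet> w) / (r n \<bullet> w)\<close>, where \<open>w\<close> is orthogonal to the right vector of the initial wedge.\<close>

lemma area_asymptotics:
  assumes nc: "\<not> cuspidal \<Gamma> V (direction_pt \<theta>)"
    and exp: "boundary_expansion bar G \<xi>r \<xi>l a (direction_pt \<theta>)"
  shows "asymp_same
      (\<lambda>n. 1 / ereal (Area (column 1 (wedge_seq G W a n)) \<theta>))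
      (\<lambda>n. 1 / ereal (det (W (a n))) *
         (cf_minus G W (a n) (rev (map a [0..<n])) + cf_plus_inf G W (a n) (\<lambda>k. a (n + 1 + k))))"
    and "asymp_same
      (\<lambda>n. 1 / ereal (Area (column 2 (wedge_seq G W a n)) \<theta>))
      (\<lambda>n. 1 / ereal (det (W (a n))) *
         (1 / cf_minus G W (a n) (rev (map a [0..<n])) + 1 / cf_plus_inf G W (a n) (\<lambda>k. a (n + 1 + k))))"
proof -
  define u :: plane where "u = vector [- sin \<theta>, cos \<theta>]"
  have uu: "u \<bullet> u = 1"
    by (simp add: u_def inner_vec_def sum_2 flip: power2_eq_square)
  then have "u \<noteq> 0" by auto
  have dir: "direction_pt \<theta> = line_pt u" by (simp add: direction_pt_def u_def)
  obtain e r l x y where e: "\<And>n. e n = 1 \<or> e n = - 1"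
    and col: "\<And>n. column 1 (wedge_seq G W a n) = e n *\<^sub>R r n" "\<And>n. column 2 (wedge_seq G W a n) = e n *\<^sub>R l n"
    and u: "\<And>n. u = x n *\<^sub>R r n + y n *\<^sub>R l n" and xy: "\<And>n. 0 < x n" "\<And>n. 0 < y n"
    and det: "\<And>n. cross (r n) (l n) = det (W (a n))"
    and lim: "\<And>v. 0 < u \<bullet> v \<Longrightarrow> filterlim (\<lambda>n. r n \<bullet> v) at_top sequentially"
      "\<And>v. 0 < u \<bullet> v \<Longrightarrow> filterlim (\<lambda>n. l n \<bullet> v) at_top sequentially"
      "\<And>v v'. cross v u \<noteq> 0 \<Longrightarrow> (\<lambda>n. cross (r n) v' / cross v (r n)) \<longlonglongrightarrow> cross u v' / cross v u"
    by (rule signed_wedges[OF nc[unfolded dir] \<open>u \<noteq> 0\<close> exp[unfolded dir]]) (rule that; assumption)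
  define \<delta> where "\<delta> n = det (W (a n))" for n
  have \<delta>: "0 < \<delta> n" for n using cross_pq[of "a n"] by (simp add: \<delta>_def cross_columns)
  have ru: "cross (r n) u = y n * \<delta> n" and ul: "cross u (l n) = x n * \<delta> n" for n
    by (subst u[of n], simp add: cross_simps det \<delta>_def)+
  have one: "x n * (r n \<bullet> u) + y n * (l n \<bullet> u) = 1" for n
    using arg_cong[OF u[of n], of "\<lambda>v. v \<bullet> u"] by (simp add: uu inner_add_left)
  have plus: "cf_plus_inf G W (a n) (\<lambda>k. a (n + 1 + k)) = ereal (x n / y n)" for n
    using cf_plus_inf_coordinates[OF e col, of n u] lim(3)[of "r n" "l n"] xy[of n] \<delta>[of n]
    by (simp add: ru ul)
  \<comment> \<open>The dual vector that is 0 on \<open>p (a 0)\<close> and 1 on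
    \<open>q (a 0)\<close>, with the sign that makes it positive on \<open>u\<close>.\<close>
  define w where "w = e 0 *\<^sub>R column 2 (matrix_inv (transpose (W (a 0))))"
  have minus: "cf_minus G W (a n) (rev (map a [0..<n]))
      = (if r n \<bullet> w = 0 then \<infinity> else ereal ((l n \<bullet> w) / (r n \<bullet> w)))" if "0 < n" for n
  proof -
    have "det (W (a n)) \<noteq> 0" using \<delta>[of n] by (simp add: \<delta>_def)
    from cf_minus_eq[where W = W and G = G and a = a and n = n, OF this that] have "cf_minus G W (a n) (rev (map a [0..<n])) = image_of_inf
        (swap_mat ** transpose (wedge_seq G W a n) ** matrix_inv (transpose (W (a 0))) ** swap_mat)"
      by (simp add: wedge_seq_def)
    then show ?thesis
      using e[of n] e[of 0] by (auto simp: image_of_inf_swap col w_def)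
  qed
  have "0 < u \<bullet> w"
  proof -
    let ?B = "matrix_inv (transpose (W (a 0)))"
    have "det (transpose (W (a 0))) \<noteq> 0" using \<delta>[of 0] by (simp add: \<delta>_def det_transpose)
    then have B: "transpose (W (a 0)) ** ?B = mat 1" by (rule matrix_inv_mult)
    have "column i (W (a 0)) \<bullet> column 2 ?B = (transpose (W (a 0)) ** ?B) $ i $ 2" for i
      by (simp add: matrix_matrix_mult_def transpose_def column_def inner_vec_def)
    then have "p (a 0) \<bullet> column 2 ?B = 0" "q (a 0) \<bullet> column 2 ?B = 1"
      unfolding B by (simp_all add: mat_def)
    moreover have "p (a 0) = e 0 *\<^sub>R r 0" "q (a 0) = e 0 *\<^sub>R l 0"
      using col[of 0] by (simp_all add: wedge_seq_def prefix_mat_0)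
    ultimately have "r 0 \<bullet> w = 0" "l 0 \<bullet> w = 1" by (simp_all add: w_def)
    then have "u \<bullet> w = y 0" by (subst u[of 0]) (simp add: inner_add_left)
    then show ?thesis using xy by simp
  qed
  note lims = lim(1)[of u] lim(1)[OF this] lim(2)[of u] lim(2)[OF this]
  have large: "\<forall>\<^sub>F n in sequentially. 0 < n \<and> 0 < r n \<bullet> u \<and> 0 < r n \<bullet> w \<and> 0 < l n \<bullet> u \<and> 0 < l n \<bullet> w"
    using lims uu by (intro eventually_conj eventually_gt_at_top) (simp_all add: filterlim_at_top_dense)
  have area: "Area (column 1 (wedge_seq G W a n)) \<theta> = y n * \<delta> n * \<bar>r n \<bullet> u\<bar>"
    "Area (column 2 (wedge_seq G W a n)) \<theta> = x n * \<delta> n * \<bar>l n \<bullet> u\<bar>" for n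
    using e[of n] xy[of n] \<delta>[of n]
    by (auto simp: Area_cross col cross_simps ru cross_commute[of "l n" u] ul abs_mult simp flip: u_def)
  have inv: "1 / ereal z = ereal (1 / z)" if "z \<noteq> 0" for z
    using that by (simp add: one_ereal_def)
  \<comment> \<open>The factor \<open>\<delta> n\<close> cancels the determinant in front, which
    leaves a numerator independent of \<open>n\<close>.\<close>
  have K: "(l n \<bullet> u) * (r n \<bullet> w) - (l n \<bullet> w) * (r n \<bullet> u) = - \<delta> n * cross u w" for n
    unfolding inner_cross by (simp add: cross_commute[of "l n" "r n"] det \<delta>_def)
  show "asymp_same
      (\<lambda>n. 1 / ereal (Area (column 1 (wedge_seq G W a n)) \<theta>))
      (\<lambda>n. 1 / ereal (det (W (a n))) *
         (cf_minus G W (a n) (rev (map a [0..<n])) + cf_plus_inf G W (a n) (\<lambda>k. a (n + 1 + k))))"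
  proof (rule asymp_sameI)
    show "filterlim (\<lambda>n. r n \<bullet> u) at_top sequentially" "filterlim (\<lambda>n. r n \<bullet> w) at_top sequentially"
      using lims uu by simp_all
    show "\<forall>\<^sub>F n in sequentially.
      1 / ereal (Area (column 1 (wedge_seq G W a n)) \<theta>) = ereal (1 / (y n * \<delta> n * (r n \<bullet> u))) \<and>
      1 / ereal (det (W (a n))) *
         (cf_minus G W (a n) (rev (map a [0..<n])) + cf_plus_inf G W (a n) (\<lambda>k. a (n + 1 + k)))
        = ereal (1 / \<delta> n * ((l n \<bullet> w) / (r n \<bullet> w) + x n / y n)) \<and>
      1 / (y n * \<delta> n * (r n \<bullet> u)) - 1 / \<delta> n * ((l n \<bullet> w) / (r n \<bullet> w) + x n / y n)
        = - cross u w / ((r n \<bullet> u) * (r n \<bullet> w))"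
      using large
    proof eventually_elim
      case (elim n)
      \<comment> \<open>The numerator 1 is replaced by the left side of \<open>one\<close>, which
        splits the fraction into two.\<close>
      have "1 / (y n * \<delta> n * (r n \<bullet> u)) = 1 / \<delta> n * ((l n \<bullet> u) / (r n \<bullet> u) + x n / y n)"
        using xy[of n] \<delta>[of n] elim one[of n] by (simp add: field_simps)
      then have "1 / (y n * \<delta> n * (r n \<bullet> u)) - 1 / \<delta> n * ((l n \<bullet> w) / (r n \<bullet> w) + x n / y n)
          = ((l n \<bullet> u) / (r n \<bullet> u) - (l n \<bullet> w) / (r n \<bullet> w)) / \<delta> n"
        by (simp add: diff_divide_distrib add_divide_distrib)
      also have "(l n \<bullet> u) / (r n \<bullet> u) - (l n \<bullet> w) / (r n \<bullet> w) = - \<delta> n * cross u w / ((r n \<bullet> u) * (r n \<bullet> w))"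
        using elim by (simp add: diff_frac_eq K)
      finally show ?case
        using elim xy[of n] \<delta>[of n] by (simp add: area minus plus plus[simplified] inv flip: \<delta>_def)
    qed
  qed
  show "asymp_same
      (\<lambda>n. 1 / ereal (Area (column 2 (wedge_seq G W a n)) \<theta>))
      (\<lambda>n. 1 / ereal (det (W (a n))) *
         (1 / cf_minus G W (a n) (rev (map a [0..<n])) + 1 / cf_plus_inf G W (a n) (\<lambda>k. a (n + 1 + k))))"
  proof (rule asymp_sameI)
    show "filterlim (\<lambda>n. l n \<bullet> u) at_top sequentially" "filterlim (\<lambda>n. l n \<bullet> w) at_top sequentially"
      using lims uu by simp_all
    show "\<forall>\<^sub>F n in sequentially.
      1 / ereal (Area (column 2 (wedge_seq G W a n)) \<theta>) = ereal (1 / (x n * \<delta> n * (l n \<bullet> u))) \<and>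
      1 / ereal (det (W (a n))) *
         (1 / cf_minus G W (a n) (rev (map a [0..<n])) + 1 / cf_plus_inf G W (a n) (\<lambda>k. a (n + 1 + k)))
        = ereal (1 / \<delta> n * ((r n \<bullet> w) / (l n \<bullet> w) + y n / x n)) \<and>
      1 / (x n * \<delta> n * (l n \<bullet> u)) - 1 / \<delta> n * ((r n \<bullet> w) / (l n \<bullet> w) + y n / x n)
        = cross u w / ((l n \<bullet> u) * (l n \<bullet> w))"
      using large
    proof eventually_elim
      case (elim n)
      have "1 / (x n * \<delta> n * (l n \<bullet> u)) = 1 / \<delta> n * ((r n \<bullet> u) / (l n \<bullet> u) + y n / x n)"
        using xy[of n] \<delta>[of n] elim one[of n] by (simp add: field_simps)
      then have "1 / (x n * \<delta> n * (l n \<bullet> u)) - 1 / \<delta> n * ((r n \<bullet> w) / (l n \<bullet> w) + y n / x n)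
          = ((r n \<bullet> u) / (l n \<bullet> u) - (r n \<bullet> w) / (l n \<bullet> w)) / \<delta> n"
        by (simp add: diff_divide_distrib add_divide_distrib)
      also have "(r n \<bullet> u) * (l n \<bullet> w) - (r n \<bullet> w) * (l n \<bullet> u) = \<delta> n * cross u w"
        using K[of n] by (simp add: mult.commute)
      then have "(r n \<bullet> u) / (l n \<bullet> u) - (r n \<bullet> w) / (l n \<bullet> w) = \<delta> n * cross u w / ((l n \<bullet> u) * (l n \<bullet> w))"
        using elim by (simp add: diff_frac_eq)
      finally show ?case
        using elim xy[of n] \<delta>[of n] by (simp add: area minus plus plus[simplified] inv flip: \<delta>_def)
    qed
  qed
qed

end

theorem theorem5p1:
  fixes S :: glued_polygons
    and \<Gamma> :: "(real^2^2) set set"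
    and d :: nat
    and A0 :: "'a::finite set" and bar :: "'a \<Rightarrow> 'a"
    and V :: "complex set"
    and \<xi>r \<xi>l :: "'a \<Rightarrow> complex"
    and G W :: "'a \<Rightarrow> real^2^2"
    and \<theta> :: real
    and a :: "nat \<Rightarrow> 'a"
  assumes "veech_surface S"
    and "torsion_free_subgroup \<Gamma> (projective_veech_group S)"
    and "finite_index_subgroup \<Gamma> (projective_veech_group S)"
    and "d \<ge> 2" and "CARD('a) = 2 * d" and "alphabet_involution A0 bar"
    and "V \<subseteq> sphere 0 1" and "card V = 2 * d"
    and "fundamental_domain \<Gamma> (ideal_polygon V)" and "0 \<in> ideal_polygon V"
    and "side_labelling V \<xi>r \<xi>l"
    and "side_pairing_maps \<Gamma> (ideal_polygon V) bar (\<lambda>\<alpha>. geodesic (\<xi>r \<alpha>) (\<xi>l \<alpha>)) G"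
    and "line_pt (vector [1, 0]) \<in> V"
    and "\<And>\<alpha>. is_wedge S (\<xi>r \<alpha>) (\<xi>l \<alpha>) (W \<alpha>)"
    and "- pi / 2 \<le> \<theta>" and "\<theta> < pi / 2"
    and "\<not> cuspidal \<Gamma> V (direction_pt \<theta>)"
    and "boundary_expansion bar G \<xi>r \<xi>l a (direction_pt \<theta>)"
  shows "asymp_same
      (\<lambda>n. 1 / ereal (Area (column 1 (wedge_seq G W a n)) \<theta>))
      (\<lambda>n. 1 / ereal (det (W (a n))) *
         (cf_minus G W (a n) (rev (map a [0..<n])) +
          cf_plus_inf G W (a n) (\<lambda>k. a (n + 1 + k))))
    \<and> asymp_same
      (\<lambda>n. 1 / ereal (Area (column 2 (wedge_seq G W a n)) \<theta>))
      (\<lambda>n. 1 / ereal (det (W (a n))) *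
         (1 / cf_minus G W (a n) (rev (map a [0..<n])) +
          1 / cf_plus_inf G W (a n) (\<lambda>k. a (n + 1 + k))))"
proof -
  interpret veech_coding S \<Gamma> bar V \<xi>r \<xi>l G W
  proof (rule veech_coding.intro)
    show "translation_surface S" "subgroup (veech_group S) SL2" "discrete (veech_group S)"
      using assms(1) by (simp_all add: veech_surface_def SL2_lattice_def)
    show "subgroup \<Gamma> (projective_veech_group S)"
      using assms(2) by (simp add: torsion_free_subgroup_def)
    show "bar (bar \<alpha>) = \<alpha>" for \<alpha>
      using assms(6) by (simp add: alphabet_involution_def)
    show "4 \<le> card V" using assms(4,8) by simp
  qed (fact assms)+
  show ?thesis using area_asymptotics[OF assms(17,18)] by blast
qed

end
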